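(* Let $\mathbb{C}_K$ be a complete and algebraically closed non-archimedean field with residual characteristic $\operatorname{char}(\widetilde{\mathbb{C}}_K)=2$. Then there exist constants $a,b\in\mathbb{C}_K$ such that the rational function $$R(z)=\frac{z^2-z}{bz-\frac{1}{a}}$$ has wandering components in its Fatou set.
   Context: $\mathbb{C}_K$ is a field complete with respect to a nontrivial non-archimedean absolute value $|\cdot|$, algebraically closed, with residue field $\widetilde{\mathbb{C}}_K$. A rational function $R\in\mathbb{C}_K(z)$ acts on the projective line $\mathbb{P}(\mathbb{C}_K)=\mathbb{C}_K\cup\{\infty\}$, and $R^n$ denotes its $n$-th iterate. The Fatou set (stable set) of $R$ is the set of points of $\mathbb{P}(\mathbb{C}_K)$ having a neighbourhood on which the family $\{R^n\}_{n\ge 0}$ is equicontinuous for the chordal metric; its complement is the Julia set. Components of the Fatou set $F$ are understood in the (analytic) sense of non-archimedean dynamics: the component of $F$ containing $x\in F$ is the union of all connected affinoids $X$ with $x\in X\subset F$, where a connected affinoid is the complement in $\mathbb{P}(\mathbb{C}_K)$ of a finite nonempty union of open disks of $\mathbb{P}(\mathbb{C}_K)$ (when this complement is nonempty). $R$ maps each component of $F$ onto a component of $F$. A component $U$ of the Fatou set is preperiodic if $R^{n}(U)=R^{m}(U)$ for some integers $0\le m<n$; a wandering component is a component of the Fatou set that is not preperiodic. *)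

theory Defs
  imports
    "HOL-Analysis.Analysis"
    "HOL-Computational_Algebra.Computational_Algebra"
    "HOL-Algebra.QuotRing"
begin

section \<open>Non-archimedean fields\<close>

locale nonarch_abs =
  fixes v :: "'k::field \<Rightarrow> real"
  assumes nonneg: "v x \<ge> 0"
    and eq_0_iff: "v x = 0 \<longleftrightarrow> x = 0"
    and mult: "v (x * y) = v x * v y"
    and ultrametric: "v (x + y) \<le> max (v x) (v y)"
    and nontrivial: "\<exists>x. x \<noteq> 0 \<and> v x \<noteq> 1"

definition nonarch_complete :: "('k::field \<Rightarrow> real) \<Rightarrow> bool" where
  "nonarch_complete v \<longleftrightarrow> Metric_space.mcomplete UNIV (\<lambda>x y. v (x - y))"

definition valuation_ring :: "('k::field \<Rightarrow> real) \<Rightarrow> 'k ring" where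
  "valuation_ring v =
     \<lparr>carrier = {x. v x \<le> 1}, monoid.mult = (*), one = 1, ring.zero = 0, add = (+)\<rparr>"

definition residue_field :: "('k::field \<Rightarrow> real) \<Rightarrow> 'k set ring" where
  "residue_field v = valuation_ring v Quot {x. v x < 1}"

text \<open>The characteristic is the nonnegative generator of the kernel of the map from the
  integers to the ring, as for \<^const>\<open>semiring_char\<close> on type classes.\<close>

definition ring_char :: "('a, 'b) ring_scheme \<Rightarrow> nat" where
  "ring_char R = Gcd {n::nat. add_pow R n \<one>\<^bsub>R\<^esub> = \<zero>\<^bsub>R\<^esub>}"

context nonarch_abs
begin

lemma zero [simp]: "v 0 = 0"
  by (simp add: eq_0_iff)

lemma one [simp]: "v 1 = 1"
  using mult[of 1 1] eq_0_iff[of 1] by simp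

lemma minus [simp]: "v (- x) = v x"
proof -
  have "v (-1) * v (-1) = 1"
    using mult[of "-1" "-1"] by simp
  then have "v (-1) = 1"
    using nonneg[of "-1"] by (metis abs_of_nonneg abs_square_eq_1 power2_eq_square)
  then show ?thesis
    using mult[of "-1" x] by simp
qed

lemma minus_commute: "v (x - y) = v (y - x)"
  by (metis minus minus_diff_eq)

lemma ultrametric_diff: "v (x - z) \<le> max (v (x - y)) (v (y - z))"
  using ultrametric[of "x - y" "y - z"] by simp

lemma Metric_space_abs: "Metric_space UNIV (\<lambda>x y. v (x - y))"
proof
  fix x y z
  show "0 \<le> v (x - y)" by (rule nonneg)
  show "v (x - y) = v (y - x)" by (rule minus_commute)
  show "v (x - y) = 0 \<longleftrightarrow> x = y" by (simp add: eq_0_iff)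
  show "v (x - z) \<le> v (x - y) + v (y - z)"
    using ultrametric_diff[of x z y] nonneg[of "x - y"] nonneg[of "y - z"] by linarith
qed

lemma cring_valuation_ring: "cring (valuation_ring v)"
proof (rule cringI)
  show "abelian_group (valuation_ring v)"
  proof (rule abelian_groupI)
    fix x assume "x \<in> carrier (valuation_ring v)"
    then show "\<exists>y\<in>carrier (valuation_ring v). y \<oplus>\<^bsub>valuation_ring v\<^esub> x = \<zero>\<^bsub>valuation_ring v\<^esub>"
      by (intro bexI[of _ "- x"]) (auto simp: valuation_ring_def)
  qed (auto simp: valuation_ring_def intro: order_trans[OF ultrametric])
  show "Group.comm_monoid (valuation_ring v)"
    by (rule comm_monoidI) (auto simp: valuation_ring_def mult intro: mult_le_one nonneg)
qed (auto simp: valuation_ring_def algebra_simps)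

lemma field_residue_field: "field (residue_field v)"
proof -
  interpret cring "valuation_ring v" by (rule cring_valuation_ring)
  have ideal: "ideal {x. v x < 1} (valuation_ring v)"
  proof (rule idealI)
    show "subgroup {x. v x < 1} (add_monoid (valuation_ring v))"
    proof (rule group.subgroupI)
      show "Group.group (add_monoid (valuation_ring v))"
        by (rule a_group)
    next
      fix x assume x: "x \<in> {x. v x < 1}"
      then have "inv\<^bsub>add_monoid (valuation_ring v)\<^esub> x = - x"
        using minus_equality[of "- x" x]
        by (auto simp: valuation_ring_def a_inv_def)
      then show "inv\<^bsub>add_monoid (valuation_ring v)\<^esub> x \<in> {x. v x < 1}"
        using x by simp
    next
      show "{x. v x < 1} \<noteq> {}"
        by (auto intro: exI[of _ 0])
    qed (auto simp: valuation_ring_def intro: le_less_trans[OF ultrametric])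
  next
    fix a x assume "a \<in> {x. v x < 1}" "x \<in> carrier (valuation_ring v)"
    then have "v a < 1" "v x \<le> 1" by (auto simp: valuation_ring_def)
    then have "v a * v x < 1"
      by (meson mult_left_le nonneg order_le_less_trans)
    then show "x \<otimes>\<^bsub>valuation_ring v\<^esub> a \<in> {x. v x < 1}"
      "a \<otimes>\<^bsub>valuation_ring v\<^esub> x \<in> {x. v x < 1}"
      by (auto simp: valuation_ring_def mult mult.commute)
  qed (rule ring_axioms)
  have "maximalideal {x. v x < 1} (valuation_ring v)"
  proof (rule maximalidealI[OF ideal])
    show "carrier (valuation_ring v) \<noteq> {x. v x < 1}"
    proof
      assume "carrier (valuation_ring v) = {x. v x < 1}"
      moreover have "1 \<in> carrier (valuation_ring v)" by (simp add: valuation_ring_def)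
      ultimately show False by simp
    qed
    fix J assume J: "ideal J (valuation_ring v)" "{x. v x < 1} \<subseteq> J" "J \<subseteq> carrier (valuation_ring v)"
    show "J = {x. v x < 1} \<or> J = carrier (valuation_ring v)"
    proof (rule ccontr)
      assume neg: "\<not> (J = {x. v x < 1} \<or> J = carrier (valuation_ring v))"
      then obtain x where x: "x \<in> J" "\<not> v x < 1"
        using J(2) by auto
      then have "v x = 1" using J(3) by (auto simp: valuation_ring_def)
      then have "x \<noteq> 0" by auto
      have "v (inverse x) = 1"
        using mult[of x "inverse x"] \<open>v x = 1\<close> \<open>x \<noteq> 0\<close> by simp
      then have "inverse x \<in> carrier (valuation_ring v)"
        by (simp add: valuation_ring_def)
      from ideal.I_l_closed[OF J(1) x(1) this] have "\<one>\<^bsub>valuation_ring v\<^esub> \<in> J"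
        using \<open>x \<noteq> 0\<close> by (simp add: valuation_ring_def)
      with ideal.one_imp_carrier[OF J(1)] neg show False by simp
    qed
  qed
  then show ?thesis
    unfolding residue_field_def
    by (rule maximalideal.quotient_is_field) (rule cring_valuation_ring)
qed

end


section \<open>The projective line and its chordal metric\<close>

datatype 'k P1 = Fin 'k | Infty

fun chordal :: "('k::field \<Rightarrow> real) \<Rightarrow> 'k P1 \<Rightarrow> 'k P1 \<Rightarrow> real" where
  "chordal v (Fin x) (Fin y) = v (x - y) / (max 1 (v x) * max 1 (v y))"
| "chordal v (Fin x) Infty = 1 / max 1 (v x)"
| "chordal v Infty (Fin y) = 1 / max 1 (v y)"
| "chordal v Infty Infty = 0"

lemma (in nonarch_abs) chordal_commute: "chordal v x y = chordal v y x"
  by (cases x; cases y) (simp_all add: minus_commute mult.commute)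

lemma (in nonarch_abs) chordal_ultrametric:
  "chordal v x z \<le> max (chordal v x y) (chordal v y z)"
proof -
  have key: "v (x * z' - z * x') * m \<le> max (v (x * y' - y * x') * n) (v (y * z' - z * y') * l)"
    if "m = max (v y) (v y')" "n = max (v z) (v z')" "l = max (v x) (v x')"
    for x x' y y' z z' m n l
  proof -
    have *: "v (a + b) \<le> max (v a) (v b)" for a b by (rule ultrametric)
    have "v (x * z' - z * x') * v y \<le> max (v (x * y' - y * x') * n) (v (y * z' - z * y') * l)"
    proof -
      have "(x * z' - z * x') * y = (x * y' - y * x') * z + (y * z' - z * y') * x"
        by (simp add: algebra_simps)
      then have "v (x * z' - z * x') * v y
          \<le> max (v (x * y' - y * x') * v z) (v (y * z' - z * y') * v x)"
        by (metis * mult)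
      also have "\<dots> \<le> max (v (x * y' - y * x') * n) (v (y * z' - z * y') * l)"
        unfolding that by (intro max.mono mult_left_mono nonneg) auto
      finally show ?thesis .
    qed
    moreover have "v (x * z' - z * x') * v y' \<le> max (v (x * y' - y * x') * n) (v (y * z' - z * y') * l)"
    proof -
      have "(x * z' - z * x') * y' = (x * y' - y * x') * z' + (y * z' - z * y') * x'"
        by (simp add: algebra_simps)
      then have "v (x * z' - z * x') * v y'
          \<le> max (v (x * y' - y * x') * v z') (v (y * z' - z * y') * v x')"
        by (metis * mult)
      also have "\<dots> \<le> max (v (x * y' - y * x') * n) (v (y * z' - z * y') * l)"
        unfolding that by (intro max.mono mult_left_mono nonneg) auto
      finally show ?thesis .
    qed
    ultimately show ?thesis
      unfolding that(1) by (auto simp: max_def)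
  qed
  define h where "h = (\<lambda>p. case p of Fin x \<Rightarrow> (x, 1) | Infty \<Rightarrow> (1 :: 'k, 0 :: 'k))"
  define H where "H = (\<lambda>p. max (v (fst (h p))) (v (snd (h p))))"
  have H: "H p > 0" for p
    by (cases p) (auto simp: H_def h_def)
  have chord: "chordal v p q = v (fst (h p) * snd (h q) - fst (h q) * snd (h p)) / (H p * H q)"
    for p q
    by (cases p; cases q) (auto simp: H_def h_def max.commute)
  define A B C where
    "A = v (fst (h x) * snd (h z) - fst (h z) * snd (h x))" and
    "B = v (fst (h x) * snd (h y) - fst (h y) * snd (h x))" and
    "C = v (fst (h y) * snd (h z) - fst (h z) * snd (h y))"
  have "A * H y \<le> max (B * H z) (C * H x)"
    unfolding A_def B_def C_def by (rule key) (simp_all add: H_def)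
  then have "A * H y / (H x * H y * H z) \<le> max (B * H z) (C * H x) / (H x * H y * H z)"
    using H[of x] H[of y] H[of z] by (intro divide_right_mono) auto
  also have "\<dots> = max (B * H z / (H x * H y * H z)) (C * H x / (H x * H y * H z))"
    using H[of x] H[of y] H[of z] by (simp add: max_divide_distrib_right)
  finally have "A / (H x * H z) \<le> max (B / (H x * H y)) (C / (H y * H z))"
    using H[of x] H[of y] H[of z] by (simp add: mult_ac)
  then show ?thesis
    by (simp add: chord A_def B_def C_def)
qed

lemma (in nonarch_abs) Metric_space_chordal: "Metric_space UNIV (chordal v)"
proof
  fix x y z
  have nn: "0 \<le> chordal v x y" for x y
    by (cases x; cases y) (simp_all add: nonneg)
  show "0 \<le> chordal v x y" by (rule nn)
  show "chordal v x y = chordal v y x" by (rule chordal_commute)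
  have [simp]: "max 1 (v u) \<noteq> 0" for u
    by (simp add: max_def)
  show "chordal v x y = 0 \<longleftrightarrow> x = y"
    by (cases x; cases y) (simp_all add: eq_0_iff)
  show "chordal v x z \<le> chordal v x y + chordal v y z"
    using chordal_ultrametric[of x z y] nn[of x y] nn[of y z] by linarith
qed


section \<open>Rational functions acting on the projective line\<close>

fun eval_ratio :: "'k::field poly \<Rightarrow> 'k poly \<Rightarrow> 'k P1 \<Rightarrow> 'k P1" where
  "eval_ratio p q (Fin z) = (if poly q z = 0 then Infty else Fin (poly p z / poly q z))"
| "eval_ratio p q Infty = (let d = max (degree p) (degree q) in
     if coeff q d = 0 then Infty else Fin (coeff p d / coeff q d))"

text \<open>The action is evaluated on a numerator and denominator in lowest terms, where it is never
  of the form 0/0; the result does not depend on the chosen representation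
  (\<open>rat_action_Fract\<close> below).\<close>

definition rat_action :: "'k::field poly fract \<Rightarrow> 'k P1 \<Rightarrow> 'k P1" where
  "rat_action r = (case (SOME (p, q). q \<noteq> 0 \<and> coprime p q \<and> r = Fract p q) of
     (p, q) \<Rightarrow> eval_ratio p q)"

lemma ex_lowest_terms:
  fixes r :: "'k::field poly fract"
  shows "\<exists>p q. q \<noteq> 0 \<and> coprime p q \<and> r = Fract p q"
proof -
  obtain p q where "r = Fract p q" "q \<noteq> 0"
    by (cases r) auto
  then show ?thesis
  proof (induction "degree q" arbitrary: p q rule: less_induct)
    case less
    show ?case
    proof (cases "coprime p q")
      case False
      then obtain c where c: "c dvd p" "c dvd q" "\<not> is_unit c"
        by (auto simp: coprime_def)
      then obtain p' q' where pq: "p = c * p'" "q = c * q'"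
        by (auto elim!: dvdE)
      with less.prems have "c \<noteq> 0" "q' \<noteq> 0" by auto
      moreover have "degree c \<noteq> 0"
        using c(3) \<open>c \<noteq> 0\<close> by (simp add: is_unit_iff_degree)
      ultimately have "degree q' < degree q"
        by (simp add: pq degree_mult_eq)
      moreover have "r = Fract p' q'"
        using less.prems \<open>c \<noteq> 0\<close> \<open>q' \<noteq> 0\<close> by (simp add: pq eq_fract mult_ac)
      ultimately show ?thesis
        using less.hyps \<open>q' \<noteq> 0\<close> by blast
    qed (use less.prems in blast)
  qed
qed

lemma poly_bezout:
  fixes p q :: "'k::field poly"
  assumes "coprime p q"
  shows "\<exists>s t. s * p + t * q = 1"
proof -
  define I where "I = {f. \<exists>s t. f = s * p + t * q}"
  have I_diff: "f - h * g \<in> I" if fg: "f \<in> I" "g \<in> I" for f g h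
  proof -
    obtain s t s' t' where "f = s * p + t * q" "g = s' * p + t' * q"
      using fg by (auto simp: I_def)
    then have "f - h * g = (s - h * s') * p + (t - h * t') * q"
      by (simp add: algebra_simps)
    then show ?thesis by (auto simp: I_def)
  qed
  have pI: "p \<in> I"
    unfolding I_def by (rule CollectI, rule exI[of _ 1], rule exI[of _ 0]) simp
  have qI: "q \<in> I"
    unfolding I_def by (rule CollectI, rule exI[of _ 0], rule exI[of _ 1]) simp
  have "p \<noteq> 0 \<or> q \<noteq> 0"
    using assms by auto
  then have "\<exists>f. f \<in> I \<and> f \<noteq> 0"
    using pI qI by blast
  then obtain g where g: "g \<in> I" "g \<noteq> 0" and
    min: "\<And>f. f \<in> I \<and> f \<noteq> 0 \<Longrightarrow> degree g \<le> degree f"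
    using ex_has_least_nat[of "\<lambda>f. f \<in> I \<and> f \<noteq> 0" _ degree] by metis
  have "g dvd f" if "f \<in> I" for f
  proof (rule ccontr)
    assume "\<not> g dvd f"
    then have nz: "f mod g \<noteq> 0" by (simp add: dvd_eq_mod_eq_0)
    then have "degree (f mod g) < degree g"
      using degree_mod_less[of g f] g(2) by auto
    moreover have "f mod g \<in> I"
      using I_diff[OF that g(1), of "f div g"] by (simp add: minus_div_mult_eq_mod)
    ultimately show False
      using min[of "f mod g"] nz by simp
  qed
  then have "is_unit g"
    using assms pI qI by (auto simp: coprime_def)
  then obtain u where "g * u = 1"
    by (auto elim!: dvdE)
  moreover obtain s t where "g = s * p + t * q"
    using g(1) by (auto simp: I_def)
  ultimately have "(u * s) * p + (u * t) * q = 1"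
    by (simp add: algebra_simps)
  then show ?thesis by blast
qed

lemma rat_action_Fract:
  fixes p q :: "'k::field poly"
  assumes "q \<noteq> 0" "coprime p q"
  shows "rat_action (Fract p q) = eval_ratio p q"
proof -
  obtain p' q' where *: "(SOME (p', q'). q' \<noteq> 0 \<and> coprime p' q' \<and> Fract p q = Fract p' q') = (p', q')"
    by fastforce
  have "q' \<noteq> 0 \<and> coprime p' q' \<and> Fract p q = Fract p' q'"
    using someI_ex[of "\<lambda>(p', q'). q' \<noteq> 0 \<and> coprime p' q' \<and> Fract p q = Fract p' q'"] assms
    unfolding * by blast
  then have q': "q' \<noteq> 0" "coprime p' q'" and eq: "p * q' = p' * q"
    using assms by (auto simp: eq_fract)
  obtain s t s' t' where st: "s * p + t * q = 1" "s' * p' + t' * q' = 1"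
    using poly_bezout[OF assms(2)] poly_bezout[OF q'(2)] by blast
  have "q' = (s * p + t * q) * q'" using st by simp
  also have "\<dots> = q * (s * p' + t * q')"
    using eq by (simp add: algebra_simps)
  finally have d1: "q' = q * (s * p' + t * q')" .
  have "q = (s' * p' + t' * q') * q" using st by simp
  also have "\<dots> = s' * (p' * q) + t' * q' * q" by (simp add: algebra_simps)
  also have "\<dots> = q' * (s' * p + t' * q)"
    unfolding eq[symmetric] by (simp add: algebra_simps)
  finally have d2: "q = q' * (s' * p + t' * q)" .
  define c where "c = s * p' + t * q'"
  have "q = q * (c * (s' * p + t' * q))"
    using d1 d2 unfolding c_def by (metis mult.assoc)
  then have "c * (s' * p + t' * q) = 1"
    using assms(1) by (metis mult_cancel_left mult_1_right)
  then have "is_unit c" by (metis dvd_triv_left)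
  then obtain k where k: "c = [:k:]" "k \<noteq> 0"
    unfolding is_unit_poly_iff by fastforce
  have q'k: "q' = smult k q"
    using d1 k unfolding c_def[symmetric] by simp
  then have "p' * q = smult k p * q"
    using eq by (simp add: algebra_simps)
  then have p'k: "p' = smult k p"
    using assms(1) by (metis mult_right_cancel)
  have "eval_ratio p' q' x = eval_ratio p q x" for x
    using k(2) by (cases x) (auto simp: q'k p'k Let_def)
  then show ?thesis
    unfolding rat_action_def * by auto
qed


section \<open>Fatou set and its components\<close>

definition equicontinuous_on :: "('a \<Rightarrow> 'a \<Rightarrow> real) \<Rightarrow> 'a set \<Rightarrow> ('a \<Rightarrow> 'a) set \<Rightarrow> bool" where
  "equicontinuous_on d U \<F> \<longleftrightarrow>
     (\<forall>x\<in>U. \<forall>\<epsilon>>0. \<exists>\<delta>>0. \<forall>y\<in>U. d x y < \<delta> \<longrightarrow> (\<forall>f\<in>\<F>. d (f x) (f y) < \<epsilon>))"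

definition fatou_set :: "('k::field \<Rightarrow> real) \<Rightarrow> ('k P1 \<Rightarrow> 'k P1) \<Rightarrow> 'k P1 set" where
  "fatou_set v R = {x. \<exists>U. openin (Metric_space.mtopology UNIV (chordal v)) U \<and> x \<in> U \<and>
     equicontinuous_on (chordal v) U (range (\<lambda>n. R ^^ n))}"

inductive P1_open_disk :: "('k::field \<Rightarrow> real) \<Rightarrow> 'k P1 set \<Rightarrow> bool" for v where
  "r > 0 \<Longrightarrow> P1_open_disk v (Fin ` {z. v (z - a) < r})"
| "r > 0 \<Longrightarrow> P1_open_disk v (insert Infty (Fin ` {z. v (z - a) > r}))"

definition connected_affinoid :: "('k::field \<Rightarrow> real) \<Rightarrow> 'k P1 set \<Rightarrow> bool" where
  "connected_affinoid v X \<longleftrightarrow>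
     (\<exists>\<D>. finite \<D> \<and> \<D> \<noteq> {} \<and> (\<forall>D\<in>\<D>. P1_open_disk v D) \<and> X = - \<Union>\<D> \<and> X \<noteq> {})"

definition analytic_component :: "('k::field \<Rightarrow> real) \<Rightarrow> 'k P1 set \<Rightarrow> 'k P1 \<Rightarrow> 'k P1 set" where
  "analytic_component v F x = \<Union>{X. connected_affinoid v X \<and> x \<in> X \<and> X \<subseteq> F}"

definition fatou_component ::
  "('k::field \<Rightarrow> real) \<Rightarrow> ('k P1 \<Rightarrow> 'k P1) \<Rightarrow> 'k P1 set \<Rightarrow> bool" where
  "fatou_component v R U \<longleftrightarrow> (\<exists>x\<in>fatou_set v R. U = analytic_component v (fatou_set v R) x)"

definition preperiodic :: "('a \<Rightarrow> 'a) \<Rightarrow> 'a set \<Rightarrow> bool" where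
  "preperiodic R U \<longleftrightarrow> (\<exists>m n. m < n \<and> (R ^^ n) ` U = (R ^^ m) ` U)"

definition wandering_component ::
  "('k::field \<Rightarrow> real) \<Rightarrow> ('k P1 \<Rightarrow> 'k P1) \<Rightarrow> 'k P1 set \<Rightarrow> bool" where
  "wandering_component v R U \<longleftrightarrow> fatou_component v R U \<and> \<not> preperiodic R U"

end

theory Submission
  imports Defs
begin

text \<open>
  Write \<open>q = v \<pi> < 1\<close>, where \<open>v 2\<close> is negligible against small powers of \<open>q\<close>, and take
  \<open>a = - \<kappa> / \<pi>\<^sup>2\<close> and \<open>b = - 1 / \<kappa>\<close> with \<open>v \<kappa> = 1\<close>. In the coordinate \<open>x = z / \<pi>\<close> the map becomes
  \<open>R \<kappa> x = \<kappa> x (1 - \<pi> x) / (\<pi> (x - \<pi>))\<close>. It has a repelling fixed point \<open>0\<close> of multiplier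
  \<open>- \<kappa> / \<pi>\<^sup>2\<close>, whose other preimage is \<open>1 / \<pi>\<close>, and, because of residue characteristic two, a wild
  critical point: near \<open>1\<close> the derivative is \<open>(x - 1)\<^sup>2\<close> up to a unit and multiples of \<open>2\<close>. For \<open>\<kappa>\<close>
  near a primitive sixth root of unity, two steps take \<open>1\<close> close to \<open>1 / \<pi>\<close>, hence three steps take
  it close to \<open>0\<close>, from where the expansion leads back to the unit sphere. The parameter \<open>\<kappa>\<close> is
  kept near a value for which \<open>1\<close> has period five (\<open>exists_centre\<close>).

  An orbit can then do two things. Started at distance \<open>q\<^sup>4 B\<close> from \<open>1\<close>, with \<open>B\<close> slightly above
  \<open>1\<close>, it makes cycles of five steps which replace \<open>B\<close> by \<open>B\<^sup>2\<close> (\<open>slow_orbit_exact\<close>). Each of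
  these contracts by \<open>q\<^sup>2\<close> or more, and there are as many of them as one likes. When it has reached
  distance \<open>q\<^sup>2\<close> from \<open>1\<close>, it can hit \<open>1 / \<pi>\<close> almost exactly and so spend a long time near \<open>0\<close>,
  where it expands, before it returns near \<open>1\<close>. If every such jump of length \<open>n\<close> is preceded by at
  least \<open>n\<close> slow cycles, then the derivatives along the orbit stay bounded, and the orbit lies in
  the Fatou set (\<open>tame_orbit_fatou\<close>). If moreover the lengths of the jumps are unbounded, its
  component wanders. For the itinerary is an invariant of the component: whenever one point
  returns to the residue class of \<open>1\<close>, then so does the whole component, since preimages of the
  repelling point \<open>0\<close> occur in infinitely many residue classes of the unit sphere
  (\<open>component_follows_orbit\<close>).

  It remains to find a parameter for which the orbit of a fixed starting point has such an
  itinerary. For a fixed parameter, the points that follow longer and longer initial parts of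
  the itinerary form nested disks whose radii stay away from \<open>0\<close>, and as the field need not be
  spherically complete their intersection may be empty. Nested disks of parameters do shrink to a
  point. This rests on two facts: the slow cycles forget the past, so that at
  the landing on \<open>0\<close> only the dependence on the parameter along the last two cycles counts; and this
  dependence is nondegenerate (\<open>transversality\<close>). The lower bound does not depend on the number
  of slow cycles, and therefore the length of the next jump can be fixed before this number is
  (\<open>stage_extend\<close>).
\<close>

section \<open>Non-archimedean estimates\<close>

context nonarch_abs
begin

lemma abs_power: "v (x ^ n) = v x ^ n"
  by (induction n) (simp_all add: mult)

lemma abs_inverse: "v (inverse x) = inverse (v x)"
proof (cases "x = 0")
  case False
  then have "v (inverse x) * v x = 1"
    by (simp flip: mult)
  then show ?thesis
    by (metis inverse_unique mult.commute)
qed simp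

lemma abs_divide: "v (x / y) = v x / v y"
  by (simp add: divide_inverse mult abs_inverse)

lemmas abs_simps = mult abs_power abs_inverse abs_divide

lemma pos_iff: "v x > 0 \<longleftrightarrow> x \<noteq> 0"
  using nonneg[of x] eq_0_iff[of x] by linarith

lemma add_le: "v x \<le> r \<Longrightarrow> v y \<le> r \<Longrightarrow> v (x + y) \<le> r"
  using ultrametric[of x y] by linarith

lemma add_less: "v x < r \<Longrightarrow> v y < r \<Longrightarrow> v (x + y) < r"
  using ultrametric[of x y] by linarith

lemma diff_le: "v x \<le> r \<Longrightarrow> v y \<le> r \<Longrightarrow> v (x - y) \<le> r"
  using add_le[of x r "- y"] by simp

lemma diff_less: "v x < r \<Longrightarrow> v y < r \<Longrightarrow> v (x - y) < r"
  using add_less[of x r "- y"] by simp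

lemma add_dominant: "v y < v x \<Longrightarrow> v (x + y) = v x"
  using ultrametric[of x y] ultrametric[of "x + y" "- y"] by auto

lemma diff_dominant: "v y < v x \<Longrightarrow> v (x - y) = v x"
  using add_dominant[of "- y" x] by simp

lemma diff_dominant': "v y < v x \<Longrightarrow> v (y - x) = v x"
  using diff_dominant[of y x] minus_commute[of x y] by simp

lemma close_imp_eq: "v (x - y) < v y \<Longrightarrow> v x = v y"
  using add_dominant[of "x - y" y] by simp

lemma dist_trans_le: "v (x - y) \<le> r \<Longrightarrow> v (y - z) \<le> r \<Longrightarrow> v (x - z) \<le> r"
  using ultrametric_diff[of x z y] by linarith

lemma dist_trans_less: "v (x - y) < r \<Longrightarrow> v (y - z) < r \<Longrightarrow> v (x - z) < r"
  using ultrametric_diff[of x z y] by linarith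

text \<open>Relative closeness with error at most \<open>e\<close>. For \<open>e < 1\<close> this is a congruence for
  multiplication and division, so long products can be tracked to a fixed relative precision.\<close>

definition near :: "real \<Rightarrow> 'k \<Rightarrow> 'k \<Rightarrow> bool" where
  "near e x y \<longleftrightarrow> v (x - y) \<le> e * v y"

lemma near_refl: "0 \<le> e \<Longrightarrow> near e x x"
  by (simp add: near_def nonneg)

lemma near_abs:
  assumes "near e x y" "e < 1"
  shows "v x = v y"
proof (cases "y = 0")
  case True
  then show ?thesis using assms nonneg[of x] by (simp add: near_def)
next
  case False
  then have "v (x - y) < v y"
    using assms unfolding near_def pos_iff[symmetric]
    by (meson less_le_trans mult_less_cancel_right2 not_le)
  then show ?thesis by (rule close_imp_eq)
qed

lemma near_sym: "near e x y \<Longrightarrow> e < 1 \<Longrightarrow> near e y x"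
  using near_abs[of e x y] by (simp add: near_def minus_commute)

lemma near_trans:
  assumes "near e x y" "near e y z" "e < 1"
  shows "near e x z"
  using assms near_abs[of e y z] unfolding near_def by (auto intro: dist_trans_le)

lemma near_mult:
  assumes "near e x y" "near e x' y'" "0 \<le> e" "e < 1"
  shows "near e (x * x') (y * y')"
proof -
  have "v ((x - y) * x') \<le> e * v (y * y')"
    using assms near_abs[of e x' y'] mult_right_mono[of "v (x - y)" "e * v y" "v y'"]
    by (simp add: mult near_def nonneg mult.assoc)
  moreover have "v (y * (x' - y')) \<le> e * v (y * y')"
    using assms mult_left_mono[of "v (x' - y')" "e * v y'" "v y"]
    by (simp add: mult near_def nonneg mult_ac)
  ultimately have "v ((x - y) * x' + y * (x' - y')) \<le> e * v (y * y')"
    by (rule add_le)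
  then show ?thesis
    by (simp add: near_def algebra_simps)
qed

lemma near_inverse:
  assumes "near e x y" "e < 1"
  shows "near e (inverse x) (inverse y)"
proof (cases "x = 0 \<or> y = 0")
  case True
  then show ?thesis
    using near_abs[OF assms] eq_0_iff[of x] eq_0_iff[of y] by (auto simp: near_def)
next
  case False
  then have "v (inverse x - inverse y) = v (x - y) / (v x * v y)"
    by (simp add: inverse_eq_divide diff_frac_eq abs_divide mult minus_commute)
  also have "\<dots> \<le> (e * v y) / (v x * v y)"
    using assms nonneg[of x] nonneg[of y] by (intro divide_right_mono) (auto simp: near_def)
  also have "\<dots> = e * v (inverse y)"
    using False near_abs[OF assms] by (simp add: abs_inverse divide_inverse eq_0_iff)
  finally show ?thesis by (simp add: near_def)
qed

lemma near_divide:
  assumes "near e x y" "near e x' y'" "0 \<le> e" "e < 1"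
  shows "near e (x / x') (y / y')"
  unfolding divide_inverse by (intro near_mult near_inverse assms)

lemma near_minus: "near e x y \<Longrightarrow> near e (- x) (- y)"
  by (metis minus near_def minus_commute minus_diff_minus)

lemma near_add_small: "v z \<le> e * v y \<Longrightarrow> near e x y \<Longrightarrow> near e (x + z) y"
  unfolding near_def by (metis add_diff_eq add.commute add_le diff_add_eq)

lemma near_power:
  assumes "near e x y" "0 \<le> e" "e < 1"
  shows "near e (x ^ n) (y ^ n)"
  by (induction n) (auto intro: near_refl near_mult assms)

end

section \<open>Rational functions on disks\<close>

locale alg_closed_nonarch = nonarch_abs v for v :: "'k::alg_closed_field \<Rightarrow> real"
begin

abbreviation closed_disk :: "'k \<Rightarrow> real \<Rightarrow> 'k set" where
  "closed_disk c r \<equiv> {z. v (z - c) \<le> r}"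

abbreviation open_disk :: "'k \<Rightarrow> real \<Rightarrow> 'k set" where
  "open_disk c r \<equiv> {z. v (z - c) < r}"

text \<open>A factor \<open>z - a\<close> whose root \<open>a\<close> lies outside a disk has constant absolute value on that
  disk, and even varies there by less than this value. Splitting a polynomial into linear factors
  turns this into the following lemma, on which all covering statements below rest.\<close>

lemma poly_zero_free_closed_disk:
  assumes "\<forall>z\<in>closed_disk c r. poly p z \<noteq> 0" "z \<in> closed_disk c r"
  shows "v (poly p z - poly p c) < v (poly p c)"
  using assms(1)
proof (induction "degree p" arbitrary: p)
  case 0
  then obtain a where "p = [:a:]" by (metis degree_eq_zeroE)
  with 0 assms(2) show ?case by (auto simp: pos_iff)
next
  case (Suc n)
  then obtain a where "poly p a = 0"
    by (metis alg_closed_imp_poly_has_root zero_less_Suc)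
  then obtain q where p: "p = [:-a, 1:] * q"
    by (metis poly_eq_0_iff_dvd dvdE)
  have "q \<noteq> 0" using Suc.hyps p by auto
  then have "degree q = n"
    using Suc.hyps(2) unfolding p by (subst (asm) degree_mult_eq) auto
  have r: "r \<ge> 0" using assms(2) nonneg[of "z - c"] by auto
  have z: "v (z - c) \<le> r" using assms(2) by simp
  have qz: "\<forall>w\<in>closed_disk c r. poly q w \<noteq> 0"
    using Suc.prems unfolding p by auto
  then have q: "v (poly q z - poly q c) < v (poly q c)"
    using Suc.hyps(1) \<open>degree q = n\<close> by blast
  have "a \<notin> closed_disk c r"
    using Suc.prems \<open>poly p a = 0\<close> by blast
  then have a: "v (z - c) < v (c - a)"
    using z by (simp add: minus_commute)
  then have za: "v (z - a) = v (c - a)"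
    using add_dominant[of "z - c" "c - a"] by simp
  have "v ((z - a) * (poly q z - poly q c)) < v (c - a) * v (poly q c)"
    using q a nonneg[of "z - c"] unfolding mult za by (intro mult_strict_left_mono) auto
  moreover have "v ((z - c) * poly q c) < v (c - a) * v (poly q c)"
    using a q nonneg[of "poly q z - poly q c"] unfolding mult
    by (intro mult_strict_right_mono) auto
  ultimately have "v ((z - a) * (poly q z - poly q c) + (z - c) * poly q c) < v (c - a) * v (poly q c)"
    by (rule add_less)
  then show ?case
    unfolding p by (simp add: mult[symmetric] algebra_simps)
qed

text \<open>On the bounding sphere zeros are allowed; passing to it can only decrease the factors.\<close>

lemma poly_zero_free_open_disk:
  assumes "\<forall>z\<in>open_disk c r. poly p z \<noteq> 0" "v (z - c) \<le> r"
  shows "v (poly p z) \<le> v (poly p c)"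
  using assms(1)
proof (induction "degree p" arbitrary: p)
  case 0
  then obtain a where "p = [:a:]" by (metis degree_eq_zeroE)
  then show ?case by simp
next
  case (Suc n)
  then obtain a where "poly p a = 0"
    by (metis alg_closed_imp_poly_has_root zero_less_Suc)
  then obtain q where p: "p = [:-a, 1:] * q"
    by (metis poly_eq_0_iff_dvd dvdE)
  have "q \<noteq> 0" using Suc.hyps p by auto
  then have "degree q = n"
    using Suc.hyps(2) unfolding p by (subst (asm) degree_mult_eq) auto
  have qz: "\<forall>w\<in>open_disk c r. poly q w \<noteq> 0"
    using Suc.prems unfolding p by auto
  then have q: "v (poly q z) \<le> v (poly q c)"
    using Suc.hyps(1) \<open>degree q = n\<close> by blast
  have "a \<notin> open_disk c r"
    using Suc.prems \<open>poly p a = 0\<close> by blast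
  then have "r \<le> v (c - a)"
    by (simp add: minus_commute)
  then have "v (z - a) \<le> v (c - a)"
    using assms(2) dist_trans_le[of z c "v (c - a)" a] by linarith
  with q have "v (z - a) * v (poly q z) \<le> v (c - a) * v (poly q c)"
    by (intro mult_mono nonneg)
  moreover have "poly p y = (y - a) * poly q y" for y
    unfolding p by (simp add: algebra_simps)
  ultimately show ?case
    by (simp add: mult)
qed

definition rational_on :: "'k set \<Rightarrow> ('k \<Rightarrow> 'k) \<Rightarrow> bool" where
  "rational_on A h \<longleftrightarrow> (\<exists>p q. \<forall>z\<in>A. poly q z \<noteq> 0 \<and> h z = poly p z / poly q z)"

lemma rational_on_const: "rational_on A (\<lambda>_. c)"
  unfolding rational_on_def by (intro exI[of _ "[:c:]"] exI[of _ 1]) simp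

lemma rational_on_ident: "rational_on A (\<lambda>z. z)"
  unfolding rational_on_def by (intro exI[of _ "[:0,1:]"] exI[of _ 1]) simp

lemma rational_on_mult:
  assumes "rational_on A f" "rational_on A g"
  shows "rational_on A (\<lambda>z. f z * g z)"
proof -
  obtain p q p' q' where
    "\<forall>z\<in>A. poly q z \<noteq> 0 \<and> f z = poly p z / poly q z"
    "\<forall>z\<in>A. poly q' z \<noteq> 0 \<and> g z = poly p' z / poly q' z"
    using assms unfolding rational_on_def by blast
  then show ?thesis
    unfolding rational_on_def by (intro exI[of _ "p * p'"] exI[of _ "q * q'"]) auto
qed

lemma rational_on_diff:
  assumes "rational_on A f" "rational_on A g"
  shows "rational_on A (\<lambda>z. f z - g z)"
proof -
  obtain p q p' q' where
    "\<forall>z\<in>A. poly q z \<noteq> 0 \<and> f z = poly p z / poly q z"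
    "\<forall>z\<in>A. poly q' z \<noteq> 0 \<and> g z = poly p' z / poly q' z"
    using assms unfolding rational_on_def by blast
  then show ?thesis
    unfolding rational_on_def
    by (intro exI[of _ "p * q' - p' * q"] exI[of _ "q * q'"]) (auto simp: field_simps)
qed

lemma rational_on_divide:
  assumes "rational_on A f" "rational_on A g" "\<forall>z\<in>A. g z \<noteq> 0"
  shows "rational_on A (\<lambda>z. f z / g z)"
proof -
  obtain p q p' q' where
    "\<forall>z\<in>A. poly q z \<noteq> 0 \<and> f z = poly p z / poly q z"
    "\<forall>z\<in>A. poly q' z \<noteq> 0 \<and> g z = poly p' z / poly q' z"
    using assms unfolding rational_on_def by blast
  with assms(3) show ?thesis
    unfolding rational_on_def
    by (intro exI[of _ "p * q'"] exI[of _ "q * p'"]) (auto simp: field_simps)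
qed

lemma rational_on_subset: "rational_on A h \<Longrightarrow> B \<subseteq> A \<Longrightarrow> rational_on B h"
  unfolding rational_on_def by blast

text \<open>If \<open>w\<close> is omitted on the disk, then \<open>h - w\<close> is a quotient of two zero-free polynomials there,
  so it is close to its value at the centre, which bounds \<open>v (h z - h c)\<close> by \<open>v (w - h c)\<close>.\<close>

lemma rational_covers_closed_disk:
  assumes h: "rational_on (closed_disk c r) h" and z: "z \<in> closed_disk c r"
    and w: "v (w - h c) \<le> v (h z - h c)"
  shows "\<exists>y\<in>closed_disk c r. h y = w"
proof (rule ccontr)
  assume neg: "\<not> ?thesis"
  obtain p q where pq: "\<forall>z\<in>closed_disk c r. poly q z \<noteq> 0 \<and> h z = poly p z / poly q z"
    using h unfolding rational_on_def by blast
  define f where "f = p - smult w q"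
  have f: "poly f y = (h y - w) * poly q y" if "y \<in> closed_disk c r" for y
    using pq that by (auto simp: f_def algebra_simps)
  have "\<forall>y\<in>closed_disk c r. poly f y \<noteq> 0"
    using f neg pq by auto
  then have 1: "v (poly f z - poly f c) < v (poly f c)"
    using z by (rule poly_zero_free_closed_disk)
  have 2: "v (poly q z - poly q c) < v (poly q c)"
    using pq z by (intro poly_zero_free_closed_disk) auto
  have c: "c \<in> closed_disk c r"
    using z nonneg[of "z - c"] by auto
  have "(h z - h c) * poly q z
      = (poly f z - poly f c) - (h c - w) * (poly q z - poly q c)"
    unfolding f[OF z] f[OF c] by (simp add: algebra_simps)
  moreover have "v ((h c - w) * (poly q z - poly q c)) < v (poly f c)"
  proof -
    have "h c \<noteq> w" using neg c by blast
    then show ?thesis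
      using 2 unfolding f[OF c] mult by (intro mult_strict_left_mono) (auto simp: pos_iff)
  qed
  ultimately have "v ((h z - h c) * poly q z) < v (poly f c)"
    using diff_less[OF 1] by simp
  also have "\<dots> = v (h c - w) * v (poly q z)"
    using close_imp_eq[OF 2] by (simp add: f[OF c] mult)
  finally have "v (h z - h c) < v (h c - w)"
    using nonneg[of "poly q z"] by (simp add: mult mult_less_cancel_right)
  with w show False by (simp add: minus_commute)
qed

text \<open>The radius \<open>r\<close> is the distance from \<open>c\<close> to a nearest preimage of \<open>w\<close>. Closer to \<open>c\<close> the value
  \<open>w\<close> is omitted, which bounds \<open>h\<close> there. A value closer to \<open>h c\<close> than \<open>w\<close> cannot be omitted: up to
  that preimage, \<open>h\<close> would then not get farther from it than it is at \<open>c\<close>.\<close>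

lemma rational_disk_onto_disk:
  assumes h: "rational_on (closed_disk c d) h" and z: "z \<in> closed_disk c d"
    and w: "h z = w" "w \<noteq> h c"
  obtains r where "0 < r" "r \<le> d"
    "\<And>y. y \<in> open_disk c r \<Longrightarrow> v (h y - h c) < v (w - h c)"
    "\<And>w'. v (w' - h c) < v (w - h c) \<Longrightarrow> \<exists>y\<in>open_disk c r. h y = w'"
proof -
  obtain p q where pq: "\<forall>z\<in>closed_disk c d. poly q z \<noteq> 0 \<and> h z = poly p z / poly q z"
    using h unfolding rational_on_def by blast
  have c: "c \<in> closed_disk c d"
    using z nonneg[of "z - c"] by auto
  have f: "poly (p - smult w' q) y = (h y - w') * poly q y" if "y \<in> closed_disk c d" for y w'
    using pq that by (auto simp: algebra_simps)
  define S where "S = {y \<in> closed_disk c d. h y = w}"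
  have "S \<subseteq> {y. poly (p - smult w q) y = 0}"
    using f by (auto simp: S_def simp del: poly_diff poly_smult)
  moreover have "p - smult w q \<noteq> 0"
    using f[OF c, of w] w pq c by auto
  ultimately have "finite S"
    using poly_roots_finite finite_subset by blast
  moreover have "S \<noteq> {}"
    using z w by (auto simp: S_def)
  ultimately obtain y0 where y0: "y0 \<in> S" "\<And>y. y \<in> S \<Longrightarrow> v (y0 - c) \<le> v (y - c)"
    using arg_min_if_finite[of S "\<lambda>y. v (y - c)"] by (metis not_less)
  define r where "r = v (y0 - c)"
  have r: "r > 0" "r \<le> d"
    using y0(1) w by (auto simp: r_def S_def pos_iff)
  have omit: "h y \<noteq> w" if "v (y - c) < r" for y
    using y0(2)[of y] that r by (auto simp: S_def r_def)
  show ?thesis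
  proof (rule that[OF r])
    fix y assume y: "y \<in> open_disk c r"
    have sub: "closed_disk c (v (y - c)) \<subseteq> closed_disk c d"
      using y r by auto
    show "v (h y - h c) < v (w - h c)"
    proof (rule ccontr)
      assume "\<not> ?thesis"
      then have "\<exists>u\<in>closed_disk c (v (y - c)). h u = w"
        by (intro rational_covers_closed_disk[where z = y] rational_on_subset[OF h sub]) auto
      then obtain u where "v (u - c) \<le> v (y - c)" "h u = w"
        by auto
      then show False
        using omit[of u] y by auto
    qed
  next
    fix w' assume w': "v (w' - h c) < v (w - h c)"
    show "\<exists>y\<in>open_disk c r. h y = w'"
    proof (rule ccontr)
      assume neg: "\<not> ?thesis"
      have y0d: "y0 \<in> closed_disk c d" and hy0: "h y0 = w"
        using y0(1) by (auto simp: S_def)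
      have "\<forall>y\<in>open_disk c r. poly (p - smult w' q) y \<noteq> 0"
      proof
        fix y assume y: "y \<in> open_disk c r"
        then have yd: "y \<in> closed_disk c d" using r by auto
        then show "poly (p - smult w' q) y \<noteq> 0"
          using neg y pq f[OF yd, of w'] by auto
      qed
      then have "v (poly (p - smult w' q) y0) \<le> v (poly (p - smult w' q) c)"
        by (rule poly_zero_free_open_disk) (simp add: r_def)
      moreover have "v (poly q y0) = v (poly q c)"
        using pq y0d by (intro close_imp_eq poly_zero_free_closed_disk) auto
      moreover have "v (poly q c) > 0"
        using pq c by (simp add: pos_iff)
      ultimately have "v (w - w') \<le> v (h c - w')"
        by (simp add: f[OF y0d] f[OF c] mult hy0 mult_le_cancel_right del: poly_diff)
      then have "v (w - w') < v (w - h c)"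
        using w' by (simp add: minus_commute)
      then show False
        using dist_trans_less[of w w' _ "h c"] w' by blast
    qed
  qed
qed

lemma poly_lipschitz_on_bounded:
  "\<exists>L\<ge>0. \<forall>x\<in>closed_disk c r. \<forall>y\<in>closed_disk c r.
     v (poly p x) \<le> L \<and> v (poly p x - poly p y) \<le> L * v (x - y)"
proof (induction p)
  case 0
  then show ?case by (intro exI[of _ 0]) simp
next
  case (pCons a p)
  then obtain L where L: "L \<ge> 0"
    "\<And>x y. v (x - c) \<le> r \<Longrightarrow> v (y - c) \<le> r \<Longrightarrow> v (poly p x) \<le> L"
    "\<And>x y. v (x - c) \<le> r \<Longrightarrow> v (y - c) \<le> r \<Longrightarrow> v (poly p x - poly p y) \<le> L * v (x - y)"
    by auto
  define M where "M = max (v c) r"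
  define N where "N = max (v a) (max 1 M * L)"
  have M: "v x \<le> M" if "v (x - c) \<le> r" for x
    using add_le[of "x - c" M c] that by (auto simp: M_def)
  have N: "max 1 M * L \<le> N" "v a \<le> N"
    by (auto simp: N_def)
  have 1: "L \<le> N" and 2: "M * L \<le> N"
    using N(1) L(1) mult_right_mono[of 1 "max 1 M" L] mult_right_mono[of M "max 1 M" L] by linarith+
  show ?case
  proof (intro exI[of _ N] conjI ballI)
    show "0 \<le> N" using L(1) 1 by linarith
    fix x y assume x: "x \<in> closed_disk c r" and y: "y \<in> closed_disk c r"
    have "v x * v (poly p x) \<le> M * L"
      using x y M L by (intro mult_mono nonneg) (auto intro: order_trans[OF nonneg])
    then show "v (poly (pCons a p) x) \<le> N"
      using N 2 by (auto intro!: add_le simp: mult)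
    have "v x * v (poly p x - poly p y) \<le> M * (L * v (x - y))"
      using x y M L by (intro mult_mono nonneg) (auto intro: order_trans[OF nonneg])
    also have "\<dots> \<le> N * v (x - y)"
      using mult_right_mono[OF 2 nonneg] by (simp add: mult.assoc)
    finally have 3: "v (x * (poly p x - poly p y)) \<le> N * v (x - y)"
      by (simp add: mult)
    have "v (x - y) * v (poly p y) \<le> v (x - y) * N"
      using y 1 L(2)[of y y] by (intro mult_left_mono nonneg) auto
    then have 4: "v ((x - y) * poly p y) \<le> N * v (x - y)"
      by (simp add: mult mult_ac)
    show "v (poly (pCons a p) x - poly (pCons a p) y) \<le> N * v (x - y)"
      using add_le[OF 3 4] by (simp add: algebra_simps)
  qed
qed

lemma rational_on_lipschitz:
  assumes "rational_on (open_disk c r) h" "r > 0"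
  obtains L where "L \<ge> 1"
    "\<And>x y. x \<in> open_disk c r \<Longrightarrow> y \<in> open_disk c r \<Longrightarrow> v (h x - h y) \<le> L * v (x - y)"
proof -
  obtain p q where pq: "\<forall>z\<in>open_disk c r. poly q z \<noteq> 0 \<and> h z = poly p z / poly q z"
    using assms(1) unfolding rational_on_def by blast
  have q: "v (poly q x) = v (poly q c)" if "x \<in> open_disk c r" for x
    using pq that by (intro close_imp_eq poly_zero_free_closed_disk[of c "v (x - c)"]) auto
  have qc: "v (poly q c) > 0"
    using pq assms(2) by (simp add: pos_iff)
  obtain L where L: "L \<ge> 0"
    "\<forall>x\<in>closed_disk c r. \<forall>y\<in>closed_disk c r. v (poly p x) \<le> L \<and> v (poly p x - poly p y) \<le> L * v (x - y)"
    using poly_lipschitz_on_bounded[of c r p] by blast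
  obtain M where M: "M \<ge> 0"
    "\<forall>x\<in>closed_disk c r. \<forall>y\<in>closed_disk c r. v (poly q x) \<le> M \<and> v (poly q x - poly q y) \<le> M * v (x - y)"
    using poly_lipschitz_on_bounded[of c r q] by blast
  define N where "N = L * M / (v (poly q c))\<^sup>2"
  have "v (h x - h y) \<le> max 1 N * v (x - y)" if "x \<in> open_disk c r" "y \<in> open_disk c r" for x y
  proof -
    have x: "x \<in> closed_disk c r" and y: "y \<in> closed_disk c r"
      using that by auto
    have "v ((poly p x - poly p y) * poly q y) \<le> (L * v (x - y)) * M"
      unfolding mult using L M x y nonneg[of "x - y"] by (intro mult_mono nonneg) auto
    moreover have "v (poly p y * (poly q x - poly q y)) \<le> L * (M * v (x - y))"
      unfolding mult using L M x y by (intro mult_mono nonneg) auto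
    ultimately have "v ((poly p x - poly p y) * poly q y - poly p y * (poly q x - poly q y))
        \<le> L * M * v (x - y)"
      by (intro diff_le) (simp_all add: mult_ac)
    moreover have "(h x - h y) * (poly q x * poly q y)
        = (poly p x - poly p y) * poly q y - poly p y * (poly q x - poly q y)"
      using pq that by (auto simp: field_simps)
    moreover have "v (h x - h y) * (v (poly q c))\<^sup>2 = v ((h x - h y) * (poly q x * poly q y))"
      using q that by (simp add: mult power2_eq_square)
    ultimately have "v (h x - h y) * (v (poly q c))\<^sup>2 \<le> L * M * v (x - y)"
      by simp
    then have "v (h x - h y) \<le> N * v (x - y)"
      using qc by (simp add: N_def field_simps)
    also have "\<dots> \<le> max 1 N * v (x - y)"
      by (intro mult_right_mono nonneg) auto
    finally show ?thesis .
  qed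
  then show ?thesis using that[of "max 1 N"] by simp
qed

end

section \<open>The quadratic family near its wild critical point\<close>

text \<open>The exponent leaves ample room: multiples of \<open>2\<close> are far below the precision \<open>q\<^sup>2\<close> relative to
  all quantities that occur, none of which is smaller than \<open>q\<^sup>8\<close>.\<close>

locale quadratic_family = alg_closed_nonarch v for v :: "'k::alg_closed_field \<Rightarrow> real" +
  fixes \<pi> :: 'k
  assumes pi_nonzero: "\<pi> \<noteq> 0" and pi_small: "v \<pi> < 1" and two_small: "v 2 \<le> v \<pi> ^ 20"
begin

abbreviation q :: real where "q \<equiv> v \<pi>"

declare eq_0_iff [simp] nonneg [simp] pi_nonzero [simp]

lemma q_pos [simp]: "0 < q"
  using pi_nonzero by (simp add: pos_iff)

lemma q_less_1: "q < 1"
  by (rule pi_small)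

lemma q_power_mono: "i \<le> j \<Longrightarrow> q ^ j \<le> q ^ i"
  using q_pos q_less_1 by (intro power_decreasing) auto

lemma q_power_strict_mono: "i < j \<Longrightarrow> q ^ j < q ^ i"
  using q_pos q_less_1 by (intro power_strict_decreasing) auto

lemma q_less_inverse: "q < 1 / q" and one_less_inverse: "1 < 1 / q"
  using q_pos q_less_1 mult_strict_mono[of q 1 q 1] by (simp_all add: field_simps)

text \<open>The coordinate is scaled so that the wild critical point is the residue class of \<open>1\<close>. The
  points \<open>0\<close> and \<open>1 / \<pi>\<close> are the zeros of the map and \<open>\<pi>\<close> is its finite pole, where division by
  zero assigns the value \<open>0\<close>; all orbits considered below avoid \<open>\<pi>\<close>.\<close>

definition R :: "'k \<Rightarrow> 'k \<Rightarrow> 'k" where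
  "R \<kappa> x = \<kappa> * x * (1 - \<pi> * x) / (\<pi> * (x - \<pi>))"

text \<open>The difference quotient of \<^const>\<open>R\<close>; on the diagonal it is the derivative.\<close>

definition slope :: "'k \<Rightarrow> 'k \<Rightarrow> 'k \<Rightarrow> 'k" where
  "slope \<kappa> x y = - \<kappa> * (1 + x * y - \<pi> * (x + y)) / ((x - \<pi>) * (y - \<pi>))"

lemma R_diff:
  assumes "x \<noteq> \<pi>" "y \<noteq> \<pi>"
  shows "R \<kappa> x - R \<kappa> y = slope \<kappa> x y * (x - y)"
proof -
  have frac: "\<kappa> * m / (\<pi> * a) - \<kappa> * n / (\<pi> * b) = \<kappa> * (m * b - n * a) / (\<pi> * (a * b))"
    if "a \<noteq> 0" "b \<noteq> 0" for a b m n
    using that pi_nonzero by (simp add: field_simps)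
  have cancel: "\<kappa> * (\<pi> * (- a * m)) / (\<pi> * b) = - \<kappa> * m / b * a" for a b m
    by simp
  have "R \<kappa> x - R \<kappa> y
      = \<kappa> * (x * (1 - \<pi> * x) * (y - \<pi>) - y * (1 - \<pi> * y) * (x - \<pi>)) / (\<pi> * ((x - \<pi>) * (y - \<pi>)))"
    using frac[of "x - \<pi>" "y - \<pi>"] assms pi_nonzero by (simp add: R_def mult.assoc)
  also have "x * (1 - \<pi> * x) * (y - \<pi>) - y * (1 - \<pi> * y) * (x - \<pi>)
      = \<pi> * (- (x - y) * (1 + x * y - \<pi> * (x + y)))"
    by (simp add: algebra_simps)
  also have "\<kappa> * (\<pi> * (- (x - y) * (1 + x * y - \<pi> * (x + y)))) / (\<pi> * ((x - \<pi>) * (y - \<pi>)))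
      = slope \<kappa> x y * (x - y)"
    using cancel[of "x - y"] by (simp add: slope_def)
  finally show ?thesis .
qed

lemma R_diff_param:
  assumes "x \<noteq> \<pi>" "y \<noteq> \<pi>" "\<kappa>' \<noteq> 0"
  shows "R \<kappa> x - R \<kappa>' y = slope \<kappa> x y * (x - y) + (\<kappa> - \<kappa>') * (R \<kappa>' y / \<kappa>')"
proof -
  have "R \<kappa> y = \<kappa> * (R \<kappa>' y / \<kappa>')"
    using assms(3) by (simp add: R_def)
  moreover have "R \<kappa>' y = \<kappa>' * (R \<kappa>' y / \<kappa>')"
    using assms(3) by simp
  ultimately have "R \<kappa> y - R \<kappa>' y = (\<kappa> - \<kappa>') * (R \<kappa>' y / \<kappa>')"
    by (metis left_diff_distrib)
  then show ?thesis
    using R_diff[OF assms(1,2), of \<kappa>] by (simp add: algebra_simps)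
qed

lemma R_0 [simp]: "R \<kappa> 0 = 0"
  and R_pole_zero [simp]: "R \<kappa> (1 / \<pi>) = 0"
  using pi_nonzero by (simp_all add: R_def)

lemma R_1: "R \<kappa> 1 = \<kappa> / \<pi>"
  using pi_small by (auto simp: R_def)

lemma R_iterate_0 [simp]: "(R \<kappa> ^^ n) 0 = 0"
  by (induction n) auto

lemma rational_on_R:
  assumes "rational_on A h" "\<And>z. z \<in> A \<Longrightarrow> h z \<noteq> \<pi>"
  shows "rational_on A (\<lambda>z. R z (h z))"
  unfolding R_def
  by (intro rational_on_divide rational_on_mult rational_on_diff rational_on_const
      rational_on_ident assms) (use assms pi_nonzero in auto)

lemma rational_on_R_iterate:
  assumes "rational_on A h" "\<And>z i. z \<in> A \<Longrightarrow> i < n \<Longrightarrow> (R z ^^ i) (h z) \<noteq> \<pi>"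
  shows "rational_on A (\<lambda>z. (R z ^^ n) (h z))"
  using assms(2)
proof (induction n)
  case (Suc n)
  then show ?case
    by (simp add: rational_on_R)
qed (use assms in simp)

subsection \<open>Distances in the regions that an orbit visits\<close>

lemma unit_region:
  assumes "v x = 1"
  shows "v (x - \<pi>) = 1" "x \<noteq> \<pi>" "v \<kappa> = 1 \<Longrightarrow> v (R \<kappa> x) = 1 / q"
    "v (slope \<kappa> x y) = v \<kappa> * v (1 + x * y - \<pi> * (x + y)) / v (y - \<pi>)"
proof -
  show 1: "v (x - \<pi>) = 1"
    using diff_dominant[of \<pi> x] assms pi_small by simp
  show "x \<noteq> \<pi>" using 1 by auto
  have "v (1 - \<pi> * x) = 1"
    using diff_dominant[of "\<pi> * x" 1] assms pi_small by (simp add: mult)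
  then show "v \<kappa> = 1 \<Longrightarrow> v (R \<kappa> x) = 1 / q"
    using 1 assms by (simp add: R_def abs_simps)
  show "v (slope \<kappa> x y) = v \<kappa> * v (1 + x * y - \<pi> * (x + y)) / v (y - \<pi>)"
    using 1 by (simp add: slope_def abs_simps)
qed

lemma slope_unit: "v x = 1 \<Longrightarrow> v y = 1 \<Longrightarrow> v \<kappa> = 1 \<Longrightarrow>
    v (slope \<kappa> x y) = v (1 + x * y - \<pi> * (x + y))"
  using unit_region by simp

text \<open>This exhibits the wild critical point: up to multiples of \<open>2\<close> and of the increment
  \<open>y - x\<close>, the slope is \<open>(x - 1)\<^sup>2\<close>.\<close>

lemma slope_numerator:
  "1 + x * y - \<pi> * (x + y) = (x - 1)\<^sup>2 + 2 * (x * (1 - \<pi>)) + (y - x) * (x - \<pi>)"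
  by (simp add: algebra_simps power2_eq_square)

lemma big_region:
  assumes "v x = 1 / q"
  shows "v (x - \<pi>) = 1 / q" "x \<noteq> \<pi>" "x \<noteq> 0"
proof -
  show 1: "v (x - \<pi>) = 1 / q"
    using diff_dominant[of \<pi> x] assms q_less_inverse by simp
  show "x \<noteq> \<pi>" using 1 pi_nonzero by auto
  show "x \<noteq> 0" using assms pi_nonzero by auto
qed

lemma near_slope_big:
  assumes "v x = 1 / q" "v y = 1 / q"
  shows "near (q\<^sup>2) (slope \<kappa> x y) (- \<kappa>)"
proof -
  have q2: "q\<^sup>2 < 1" "0 \<le> q\<^sup>2"
    using q_power_strict_mono[of 0 2] by auto
  have n: "near (q\<^sup>2) (z - \<pi>) z" if "v z = 1 / q" for z
    using that pi_nonzero by (simp add: near_def power2_eq_square)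
  have d: "near (q\<^sup>2) ((x - \<pi>) * (y - \<pi>)) (x * y)"
    using n assms q2 by (intro near_mult) auto
  have xy: "q\<^sup>2 * v (x * y) = 1"
    using assms pi_nonzero by (simp add: mult power2_eq_square)
  have "q * v (x + y) \<le> q * (1 / q)"
    using add_le[of x "1 / q" y] assms by (intro mult_left_mono) auto
  then have "v (\<pi> * (x + y)) \<le> 1"
    by (simp only: mult) simp
  then have "v (1 - \<pi> * (x + y)) \<le> q\<^sup>2 * v (x * y)"
    unfolding xy by (intro diff_le) auto
  then have "near (q\<^sup>2) (x * y + (1 - \<pi> * (x + y))) (x * y)"
    by (intro near_add_small near_refl q2)
  then have "near (q\<^sup>2) ((x * y + (1 - \<pi> * (x + y))) / ((x - \<pi>) * (y - \<pi>))) (x * y / (x * y))"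
    by (intro near_divide d q2)
  then have "near (q\<^sup>2) (- \<kappa> * ((x * y + (1 - \<pi> * (x + y))) / ((x - \<pi>) * (y - \<pi>)))) (- \<kappa> * (x * y / (x * y)))"
    by (intro near_mult near_refl q2)
  moreover have "x * y / (x * y) = 1"
    using big_region assms by simp
  ultimately show ?thesis
    by (simp add: slope_def algebra_simps)
qed

lemma slope_big: "v x = 1 / q \<Longrightarrow> v y = 1 / q \<Longrightarrow> v \<kappa> = 1 \<Longrightarrow> v (slope \<kappa> x y) = 1"
  using near_abs[OF near_slope_big] q_power_strict_mono[of 0 2] by simp

lemma R_isometry_big:
  assumes "v x = 1 / q" "v y = 1 / q" "v \<kappa> = 1"
  shows "v (R \<kappa> x - R \<kappa> y) = v (x - y)"
  using assms R_diff[of x y \<kappa>] big_region slope_big by (simp add: mult)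

lemma small_region:
  assumes "v x < q"
  shows "v (x - \<pi>) = q" "x \<noteq> \<pi>" "v (1 - \<pi> * x) = 1"
    "v \<kappa> = 1 \<Longrightarrow> v (R \<kappa> x) = v x / q\<^sup>2"
proof -
  show 1: "v (x - \<pi>) = q"
    using diff_dominant'[of x \<pi>] assms by simp
  show "x \<noteq> \<pi>" using 1 pi_nonzero by auto
  have "v (\<pi> * x) < 1"
    using assms pi_small q_pos nonneg[of x] mult_strict_mono[of q 1 "v x" 1] by (simp add: mult)
  then show 2: "v (1 - \<pi> * x) = 1"
    using diff_dominant[of "\<pi> * x" 1] by simp
  show "v \<kappa> = 1 \<Longrightarrow> v (R \<kappa> x) = v x / q\<^sup>2"
    using 1 2 by (simp add: R_def abs_simps power2_eq_square)
qed

lemma slope_small: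
  assumes "v x < q" "v y < q" "v \<kappa> = 1"
  shows "v (slope \<kappa> x y) = 1 / q\<^sup>2"
proof -
  have lt1: "v x < 1" "v y < 1"
    using assms pi_small by auto
  then have "v (x * y) < 1"
    using nonneg[of x] nonneg[of y] mult_strict_mono[of "v x" 1 "v y" 1] by (simp add: mult)
  moreover have "v (\<pi> * (x + y)) < 1"
    using add_less[OF lt1] nonneg[of "x + y"] pi_small q_pos mult_strict_mono[of q 1 "v (x + y)" 1]
    by (simp add: mult)
  ultimately have "v (1 + (x * y - \<pi> * (x + y))) = 1"
    using add_dominant[of "x * y - \<pi> * (x + y)" 1] diff_less by simp
  then have "v (1 + x * y - \<pi> * (x + y)) = 1"
    by (simp add: algebra_simps)
  then show ?thesis
    using small_region(1)[OF assms(1)] small_region(1)[OF assms(2)] assms(3)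
    by (simp add: slope_def abs_simps power2_eq_square)
qed

lemma R_expand_small:
  assumes "v x < q" "v y < q" "v \<kappa> = 1"
  shows "v (R \<kappa> x - R \<kappa> y) = v (x - y) / q\<^sup>2"
  using assms R_diff[of x y \<kappa>] small_region(2) slope_small by (simp add: mult)

lemma R_iterate_small:
  assumes "v \<kappa> = 1" "v x < q ^ (2 * n - 1)" "i \<le> n"
  shows "v ((R \<kappa> ^^ i) x) = v x / q ^ (2 * i)" and "i < n \<Longrightarrow> v ((R \<kappa> ^^ i) x) < q"
proof -
  have lt: "v x / q ^ (2 * i) < q" if "i < n" for i
  proof -
    have "q ^ (2 * n - 1) \<le> q * q ^ (2 * i)"
      using q_power_mono[of "Suc (2 * i)" "2 * n - 1"] that by simp
    then show ?thesis
      using assms(2) q_pos by (simp add: divide_less_eq)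
  qed
  show *: "v ((R \<kappa> ^^ i) x) = v x / q ^ (2 * i)"
    using assms(3)
  proof (induction i)
    case (Suc i)
    then have "v ((R \<kappa> ^^ i) x) = v x / q ^ (2 * i)" "v ((R \<kappa> ^^ i) x) < q"
      using lt[of i] by auto
    then show ?case
      using small_region(4)[OF _ assms(1)]
      by (simp add: power2_eq_square)
  qed simp
  show "i < n \<Longrightarrow> v ((R \<kappa> ^^ i) x) < q"
    using * lt by simp
qed

subsection \<open>Preimages\<close>

lemma R_eq_iff:
  assumes "\<kappa> \<noteq> 0" "x \<noteq> \<pi>"
  shows "R \<kappa> x = w \<longleftrightarrow> x\<^sup>2 - (1 / \<pi> - w / \<kappa>) * x - w * \<pi> / \<kappa> = 0"
proof -
  have "R \<kappa> x = w \<longleftrightarrow> \<kappa> * x * (1 - \<pi> * x) - w * (\<pi> * (x - \<pi>)) = 0"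
    using assms pi_nonzero by (simp add: R_def divide_eq_eq)
  also have "\<kappa> * x * (1 - \<pi> * x) - w * (\<pi> * (x - \<pi>))
      = - (\<kappa> * \<pi>) * (x\<^sup>2 - (1 / \<pi> - w / \<kappa>) * x - w * \<pi> / \<kappa>)"
    using assms pi_nonzero by (simp add: field_simps power2_eq_square)
  finally show ?thesis
    using assms pi_nonzero by simp
qed

lemma R_preimages:
  assumes "\<kappa> \<noteq> 0"
  obtains P Q where "P + Q = 1 / \<pi> - w / \<kappa>" "P * Q = - (w * \<pi> / \<kappa>)" "R \<kappa> P = w" "R \<kappa> Q = w"
    "P \<noteq> \<pi>" "Q \<noteq> \<pi>"
proof -
  define s where "s = 1 / \<pi> - w / \<kappa>"
  obtain P where "poly [:- (w * \<pi> / \<kappa>), - s, 1:] P = 0"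
    using alg_closed_imp_poly_has_root[of "[:- (w * \<pi> / \<kappa>), - s, 1:]"] by auto
  then have P: "P\<^sup>2 - s * P - w * \<pi> / \<kappa> = 0"
    by (simp add: algebra_simps power2_eq_square)
  define Q where "Q = s - P"
  have Q: "Q\<^sup>2 - s * Q - w * \<pi> / \<kappa> = 0"
    using P by (simp add: Q_def algebra_simps power2_eq_square)
  have "\<pi>\<^sup>2 - s * \<pi> - w * \<pi> / \<kappa> = \<pi>\<^sup>2 - 1"
    using pi_nonzero by (simp add: s_def algebra_simps)
  then have eq: "\<pi>\<^sup>2 - s * \<pi> - w * \<pi> / \<kappa> = \<pi>\<^sup>2 - 1" .
  have "\<pi>\<^sup>2 - 1 \<noteq> 0"
    using pi_small power2_eq_1_iff[of \<pi>] by auto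
  then have "\<pi>\<^sup>2 - s * \<pi> - w * \<pi> / \<kappa> \<noteq> 0"
    unfolding eq .
  then have "P \<noteq> \<pi>" "Q \<noteq> \<pi>"
    using P Q by blast+
  moreover have "P * Q = - (w * \<pi> / \<kappa>)"
    using P by (simp add: Q_def algebra_simps power2_eq_square)
  moreover have "R \<kappa> P = w" "R \<kappa> Q = w"
    using P Q R_eq_iff assms \<open>P \<noteq> \<pi>\<close> \<open>Q \<noteq> \<pi>\<close> by (auto simp: s_def)
  ultimately show ?thesis
    using that[of P Q] by (simp add: Q_def s_def)
qed

lemma roots_of_different_size:
  assumes "v (P + Q) = S" "v (P * Q) < S\<^sup>2" "v P \<ge> v Q"
  shows "v P = S" "v Q = v (P * Q) / S"
proof -
  have "v P \<noteq> v Q"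
  proof
    assume "v P = v Q"
    then have "v (P + Q) \<le> v P" using add_le[of P "v P" Q] by simp
    then have "S\<^sup>2 \<le> v P * v Q"
      using \<open>v P = v Q\<close> assms(1) nonneg[of "P + Q"] by (auto simp: power2_eq_square intro: mult_mono)
    then show False using assms(2) by (simp add: mult)
  qed
  then show 1: "v P = S"
    using add_dominant[of Q P] assms by simp
  have "S > 0"
    using 1 \<open>v P \<noteq> v Q\<close> assms(3) nonneg[of Q] by linarith
  then show "v Q = v (P * Q) / S"
    using 1 by (simp add: mult)
qed

text \<open>By Vieta, the product of the distances from \<open>x\<close> to the two preimages of \<open>p\<close> is known. So if
  \<open>p\<close> is close to the image of \<open>x\<close>, one of the preimages is close to \<open>x\<close>.\<close>

lemma R_preimage_distances:
  assumes "v \<kappa> = 1" "x \<noteq> \<pi>"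
  obtains P Q where "R \<kappa> P = p" "R \<kappa> Q = p" "P \<noteq> \<pi>" "Q \<noteq> \<pi>"
    "P + Q = 1 / \<pi> - p / \<kappa>" "P * Q = - (p * \<pi> / \<kappa>)"
    "v (P - x) * v (Q - x) = v (x - \<pi>) * v (p - R \<kappa> x)"
proof -
  have k: "\<kappa> \<noteq> 0" using assms(1) by auto
  obtain P Q where PQ: "P + Q = 1 / \<pi> - p / \<kappa>" "P * Q = - (p * \<pi> / \<kappa>)" "R \<kappa> P = p" "R \<kappa> Q = p"
    "P \<noteq> \<pi>" "Q \<noteq> \<pi>"
    using R_preimages[OF k] by metis
  have "(P - x) * (Q - x) = P * Q - x * (P + Q) + x * x"
    by (simp add: algebra_simps)
  also have "\<dots> = (x - \<pi>) * (p - R \<kappa> x) / \<kappa>"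
    unfolding PQ(1,2) using k pi_nonzero assms(2) by (simp add: R_def field_simps)
  finally have "v (P - x) * v (Q - x) = v (x - \<pi>) * v (p - R \<kappa> x)"
    using assms(1) by (metis abs_divide div_by_1 mult)
  with PQ show ?thesis using that by blast
qed

lemma R_preimage_big:
  assumes "v \<kappa> = 1" "v x = 1 / q" "v (p - R \<kappa> x) \<le> 1"
  obtains P where "R \<kappa> P = p" "P \<noteq> \<pi>" "v P = 1 / q" "v (P - x) = v (p - R \<kappa> x)"
proof -
  obtain P Q where PQ: "R \<kappa> P = p" "R \<kappa> Q = p" "P \<noteq> \<pi>" "Q \<noteq> \<pi>"
    "v (P - x) * v (Q - x) = v (x - \<pi>) * v (p - R \<kappa> x)"
    using R_preimage_distances[OF assms(1) big_region(2)[OF assms(2)]] by metis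
  have "\<not> (v (P - x) \<ge> 1 / q \<and> v (Q - x) \<ge> 1 / q)"
  proof
    assume "v (P - x) \<ge> 1 / q \<and> v (Q - x) \<ge> 1 / q"
    then have "1 / q * (1 / q) \<le> v (P - x) * v (Q - x)"
      using q_pos by (intro mult_mono nonneg) auto
    also have "\<dots> \<le> 1 / q * 1"
      unfolding PQ(5) big_region(1)[OF assms(2)] using assms(3) q_pos
      by (intro mult_left_mono) auto
    finally show False
      using one_less_inverse q_pos by (simp add: field_simps)
  qed
  then obtain S where S: "S = P \<or> S = Q" "v (S - x) < 1 / q"
    by (metis not_le)
  then have "v S = 1 / q"
    using close_imp_eq[of S x] assms(2) by simp
  moreover have "R \<kappa> S = p" "S \<noteq> \<pi>"
    using S PQ by auto
  ultimately show ?thesis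
    using that[of S] R_isometry_big[of S x \<kappa>] assms by simp
qed

lemma R_preimage_small:
  assumes "v \<kappa> = 1" "v x < q" "v (p - R \<kappa> x) \<le> 1"
  obtains P where "R \<kappa> P = p" "P \<noteq> \<pi>" "v P < q" "v (P - x) = q\<^sup>2 * v (p - R \<kappa> x)"
proof -
  have k: "\<kappa> \<noteq> 0" using assms(1) by auto
  have "v (R \<kappa> x) < 1 / q"
    using small_region(4)[OF assms(2,1)] divide_strict_right_mono[OF assms(2), of "q\<^sup>2"]
    by (simp add: power2_eq_square split: if_splits)
  then have p: "v p < 1 / q"
    using add_less[of "p - R \<kappa> x" "1 / q" "R \<kappa> x"] assms(3) one_less_inverse by simp
  obtain P Q where PQ: "P + Q = 1 / \<pi> - p / \<kappa>" "P * Q = - (p * \<pi> / \<kappa>)" "R \<kappa> P = p" "R \<kappa> Q = p"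
    "P \<noteq> \<pi>" "Q \<noteq> \<pi>"
    using R_preimages[OF k] by metis
  have S: "v (P + Q) = 1 / q"
    unfolding PQ(1) using diff_dominant[of "p / \<kappa>" "1 / \<pi>"] p assms(1) by (simp add: abs_divide)
  have M: "v (P * Q) = v p * q"
    unfolding PQ(2) using assms(1) by (simp add: abs_simps)
  have lt1: "v p * q < 1"
    using p q_pos by (simp add: field_simps)
  then have M': "v (P * Q) < (1 / q)\<^sup>2"
    unfolding M using one_less_inverse one_less_power[of "1 / q" 2] by linarith
  have small: "v (P * Q) / (1 / q) < q"
    unfolding M using lt1 q_pos by simp
  obtain B where B: "v B < q" "R \<kappa> B = p" "B \<noteq> \<pi>"
  proof (cases "v P \<ge> v Q")
    case True
    then show ?thesis
      using roots_of_different_size(2)[OF S M'] small PQ that by metis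
  next
    case False
    then have "v P = v (Q * P) / (1 / q)"
      using roots_of_different_size(2)[of Q P "1 / q"] S M' by (simp add: add.commute mult.commute)
    then show ?thesis
      using small PQ that by (metis mult.commute)
  qed
  have "v (p - R \<kappa> x) = v (B - x) / q\<^sup>2"
    using R_expand_small[OF B(1) assms(2,1)] B by simp
  then show ?thesis
    using that[OF B(2,3,1)] q_pos by simp
qed

section \<open>Slow escape from the critical point\<close>

text \<open>For these parameters the critical point \<open>1\<close> goes to \<open>\<kappa> / \<pi>\<close>, then very close to the
  preimage \<open>1 / \<pi>\<close> of the fixed point \<open>0\<close>, and after three further steps it is back near \<open>1\<close>.
  The second condition makes \<open>\<kappa>\<close> close to a primitive sixth root of unity, which is what sends
  \<open>\<kappa> / \<pi>\<close> near \<open>1 / \<pi>\<close>.\<close>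

definition admissible :: "'k \<Rightarrow> bool" where
  "admissible \<kappa> \<longleftrightarrow> v \<kappa> = 1 \<and> v (\<kappa>\<^sup>2 - \<kappa> + 1) \<le> q\<^sup>2 \<and> v (1 / \<pi> - R \<kappa> (\<kappa> / \<pi>)) = q ^ 4 \<and>
     v ((R \<kappa> ^^ 5) 1 - 1) \<le> q ^ 6"

lemma iterate_2: "(R \<kappa> ^^ 2) x = R \<kappa> (R \<kappa> x)"
  and iterate_3: "(R \<kappa> ^^ 3) x = R \<kappa> (R \<kappa> (R \<kappa> x))"
  and iterate_4: "(R \<kappa> ^^ 4) x = R \<kappa> (R \<kappa> (R \<kappa> (R \<kappa> x)))"
  and iterate_5: "(R \<kappa> ^^ 5) x = R \<kappa> (R \<kappa> (R \<kappa> (R \<kappa> (R \<kappa> x))))"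
  by (simp_all add: eval_nat_numeral)

lemma one_minus_parameter:
  assumes "v \<kappa> = 1" "v (\<kappa>\<^sup>2 - \<kappa> + 1) \<le> q\<^sup>2"
  shows "v (1 - \<kappa>) = 1"
proof -
  have "v (\<kappa>\<^sup>2 - \<kappa> + 1) < v (\<kappa>\<^sup>2)"
    using assms q_power_strict_mono[of 0 2] by (simp add: abs_power)
  then have "v ((\<kappa>\<^sup>2 - \<kappa> + 1) - \<kappa>\<^sup>2) = v (\<kappa>\<^sup>2)"
    by (rule diff_dominant')
  then show ?thesis
    using assms by (simp add: abs_power)
qed

lemma abs_square_minus_1:
  shows abs_square_minus_1_eq: "q ^ 20 < v (x - 1) \<Longrightarrow> v (x\<^sup>2 - 1) = (v (x - 1))\<^sup>2"
    and abs_square_minus_1_le: "v (x - 1) \<le> r \<Longrightarrow> q ^ 20 \<le> r \<Longrightarrow> v (x\<^sup>2 - 1) \<le> r\<^sup>2"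
    and abs_square_minus_1_less: "v (x - 1) < r \<Longrightarrow> q ^ 20 < r \<Longrightarrow> v (x\<^sup>2 - 1) < r\<^sup>2"
proof -
  have eq: "v (x\<^sup>2 - 1) = v (x - 1) * v ((x - 1) + 2)"
    by (simp add: power2_eq_square algebra_simps flip: mult)
  show "v (x\<^sup>2 - 1) = (v (x - 1))\<^sup>2" if "q ^ 20 < v (x - 1)"
    using add_dominant[of 2 "x - 1"] two_small that unfolding eq by (simp add: power2_eq_square)
  show "v (x\<^sup>2 - 1) \<le> r\<^sup>2" if "v (x - 1) \<le> r" "q ^ 20 \<le> r"
    unfolding eq power2_eq_square[of r]
    using that two_small add_le[of "x - 1" r 2] order_trans[OF nonneg that(1)]
    by (intro mult_mono) auto
  show "v (x\<^sup>2 - 1) < r\<^sup>2" if "v (x - 1) < r" "q ^ 20 < r"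
    unfolding eq power2_eq_square[of r]
    using that two_small add_less[of "x - 1" r 2] le_less_trans[OF nonneg that(1)]
    by (intro mult_strict_mono) auto
qed

lemma R_near_critical:
  assumes "v \<kappa> = 1" "v (x - 1) < 1"
  shows "v x = 1" "v (R \<kappa> x) = 1 / q" "v (R \<kappa> x - \<kappa> / \<pi>) = v (x\<^sup>2 - 1)"
    "R \<kappa> x - \<kappa> / \<pi> = - \<kappa> * ((x\<^sup>2 - 1) / (x - \<pi>))"
proof -
  show 1: "v x = 1"
    using close_imp_eq[of x 1] assms by simp
  show "v (R \<kappa> x) = 1 / q"
    using unit_region(3)[OF 1 assms(1)] .
  have "1 \<noteq> \<pi>" using pi_small by auto
  have "slope \<kappa> x 1 * (x - 1) = - \<kappa> * ((1 + x) * (1 - \<pi>)) / ((x - \<pi>) * (1 - \<pi>)) * (x - 1)"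
    by (simp add: slope_def algebra_simps)
  also have "\<dots> = - \<kappa> * (((1 + x) * (x - 1)) / (x - \<pi>))"
    using \<open>1 \<noteq> \<pi>\<close> by simp
  also have "(1 + x) * (x - 1) = x\<^sup>2 - 1"
    by (simp add: algebra_simps power2_eq_square)
  finally show 2: "R \<kappa> x - \<kappa> / \<pi> = - \<kappa> * ((x\<^sup>2 - 1) / (x - \<pi>))"
    using R_diff[of x 1 \<kappa>] unit_region(2)[OF 1] \<open>1 \<noteq> \<pi>\<close> by (simp add: R_1)
  show "v (R \<kappa> x - \<kappa> / \<pi>) = v (x\<^sup>2 - 1)"
    unfolding 2 using unit_region(1)[OF 1] assms(1) by (simp add: abs_simps)
qed

lemma critical_orbit:
  assumes "admissible \<kappa>"
  shows "v (\<kappa> / \<pi>) = 1 / q" "v (R \<kappa> (\<kappa> / \<pi>)) = 1 / q" "v (R \<kappa> (R \<kappa> (\<kappa> / \<pi>))) = q ^ 4"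
proof -
  have k: "v \<kappa> = 1" and e: "v (1 / \<pi> - R \<kappa> (\<kappa> / \<pi>)) = q ^ 4"
    using assms by (auto simp: admissible_def)
  show "v (\<kappa> / \<pi>) = 1 / q"
    using k by (simp add: abs_divide)
  have "q ^ 4 < 1 / q"
    using less_trans[OF _ one_less_inverse] q_power_strict_mono[of 0 4] by simp
  then show 2: "v (R \<kappa> (\<kappa> / \<pi>)) = 1 / q"
    using close_imp_eq[of "R \<kappa> (\<kappa> / \<pi>)" "1 / \<pi>"] e by (simp add: minus_commute abs_divide)
  show "v (R \<kappa> (R \<kappa> (\<kappa> / \<pi>))) = q ^ 4"
    using R_isometry_big[OF 2 _ k, of "1 / \<pi>"] e by (simp add: abs_divide minus_commute)
qed

text \<open>Only the first of these steps changes distances: the orbits of \<open>x\<close> and of the critical point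
  then run along the sphere of radius \<open>1 / q\<close>, where the map is an isometry.\<close>

lemma turn_at_critical:
  assumes adm: "admissible \<kappa>" and x: "v (x - 1) < q"
  shows "v x = 1" "v (R \<kappa> x) = 1 / q" "v (R \<kappa> (R \<kappa> x)) = 1 / q"
    "v (R \<kappa> (R \<kappa> (R \<kappa> x)) - R \<kappa> (R \<kappa> (\<kappa> / \<pi>))) = v (x\<^sup>2 - 1)"
    "v (R \<kappa> (R \<kappa> (R \<kappa> x))) < q"
proof -
  have k: "v \<kappa> = 1" using adm by (simp add: admissible_def)
  have x1: "v (x - 1) < 1" using x pi_small by linarith
  note n = R_near_critical[OF k x1]
  note c = critical_orbit[OF adm]
  show "v x = 1" "v (R \<kappa> x) = 1 / q" by (fact n)+
  have "v (x\<^sup>2 - 1) < q\<^sup>2"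
    using abs_square_minus_1_less[OF x] q_power_strict_mono[of 1 20] by simp
  then have T: "v (x\<^sup>2 - 1) < q"
    using q_power_mono[of 1 2] by simp
  have 2: "v (R \<kappa> (R \<kappa> x) - R \<kappa> (\<kappa> / \<pi>)) = v (x\<^sup>2 - 1)"
    using R_isometry_big[OF n(2) c(1) k] n(3) by simp
  then show 3: "v (R \<kappa> (R \<kappa> x)) = 1 / q"
    using close_imp_eq[of "R \<kappa> (R \<kappa> x)" "R \<kappa> (\<kappa> / \<pi>)"] T q_less_inverse c(2) by simp
  show 4: "v (R \<kappa> (R \<kappa> (R \<kappa> x)) - R \<kappa> (R \<kappa> (\<kappa> / \<pi>))) = v (x\<^sup>2 - 1)"
    using R_isometry_big[OF 3 c(2) k] 2 by simp
  have "v (R \<kappa> (R \<kappa> (R \<kappa> x)) - R \<kappa> (R \<kappa> (\<kappa> / \<pi>)) + R \<kappa> (R \<kappa> (\<kappa> / \<pi>))) < q"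
    using 4 T c(3) q_power_strict_mono[of 1 4] by (intro add_less) auto
  then show "v (R \<kappa> (R \<kappa> (R \<kappa> x))) < q"
    by simp
qed

lemma slow_cycle:
  assumes adm: "admissible \<kappa>" and x: "v (x - 1) < q" and T: "v (x\<^sup>2 - 1) < q ^ 3"
  shows "v (R \<kappa> (R \<kappa> (R \<kappa> (R \<kappa> x)))) < q"
    "v ((R \<kappa> ^^ 5) x - (R \<kappa> ^^ 5) 1) = v (x\<^sup>2 - 1) / q ^ 4"
proof -
  have k: "v \<kappa> = 1" using adm by (simp add: admissible_def)
  note c = critical_orbit[OF adm]
  note t = turn_at_critical[OF adm x]
  define y where "y = R \<kappa> (R \<kappa> (R \<kappa> x))"
  define z where "z = R \<kappa> (R \<kappa> (\<kappa> / \<pi>))"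
  have yz: "v (y - z) = v (x\<^sup>2 - 1)" "v y < q" "v z = q ^ 4"
    using t(4,5) c(3) by (simp_all add: y_def z_def)
  have z: "v z < q" using yz(3) q_power_strict_mono[of 1 4] by simp
  have 4: "v (R \<kappa> y - R \<kappa> z) = v (x\<^sup>2 - 1) / q\<^sup>2"
    using R_expand_small[OF yz(2) z k] yz(1) by simp
  have "v (x\<^sup>2 - 1) / q\<^sup>2 < q ^ 3 / q\<^sup>2"
    using T by (intro divide_strict_right_mono) auto
  then have T2: "v (x\<^sup>2 - 1) / q\<^sup>2 < q"
    by (simp add: power_eq_if power2_eq_square)
  have Rz: "v (R \<kappa> z) < q"
    using small_region(4)[OF z k] yz(3) q_power_strict_mono[of 1 2] by (simp add: power_eq_if)
  then show Ry: "v (R \<kappa> (R \<kappa> (R \<kappa> (R \<kappa> x)))) < q"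
    using add_less[of "R \<kappa> y - R \<kappa> z" q "R \<kappa> z"] 4 T2 by (simp add: y_def)
  have "v (R \<kappa> (R \<kappa> y) - R \<kappa> (R \<kappa> z)) = v (x\<^sup>2 - 1) / q\<^sup>2 / q\<^sup>2"
    using R_expand_small[of "R \<kappa> y" "R \<kappa> z" \<kappa>] Ry Rz k 4 by (simp add: y_def)
  then show "v ((R \<kappa> ^^ 5) x - (R \<kappa> ^^ 5) 1) = v (x\<^sup>2 - 1) / q ^ 4"
    by (simp add: iterate_5 R_1 y_def z_def power_eq_if)
qed

lemma slow_cycle_conditions:
  assumes "v (x - 1) \<le> q ^ 4 * B" "q ^ 5 * B\<^sup>2 < 1" "1 \<le> B"
  shows "v (x - 1) < q" "v (x\<^sup>2 - 1) < q ^ 3"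
proof -
  have B: "(q ^ 4 * B)\<^sup>2 < q ^ 3"
    using mult_strict_left_mono[OF assms(2), of "q ^ 3"] by (simp add: power_mult_distrib power_add[symmetric] flip: power_mult mult.assoc)
  also have "q ^ 3 \<le> q\<^sup>2"
    by (rule q_power_mono) simp
  finally have "q ^ 4 * B < q"
    by (rule power2_less_imp_less) simp
  then show "v (x - 1) < q" using assms(1) by linarith
  have "q ^ 20 \<le> q ^ 4 * 1"
    using q_power_mono[of 4 20] by simp
  also have "\<dots> \<le> q ^ 4 * B"
    using assms(3) by (intro mult_left_mono) auto
  finally show "v (x\<^sup>2 - 1) < q ^ 3"
    using abs_square_minus_1_le[OF assms(1)] B by linarith
qed

text \<open>In the scale \<open>v (x - 1) = q ^ 4 * B\<close> a cycle of five steps squares \<open>B\<close>: it is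
  \<open>B \<mapsto> B\<^sup>2\<close> outside the unit disk, so an orbit that starts with \<open>B\<close> slightly above \<open>1\<close>
  lingers for as many cycles as desired. Each of them contracts, as \<open>v (x - 1)\<close> is small.\<close>

lemma slow_cycle_exact:
  assumes adm: "admissible \<kappa>" and x: "v (x - 1) = q ^ 4 * B" and B: "1 \<le> B" "q ^ 5 * B\<^sup>2 < 1"
  shows "v ((R \<kappa> ^^ 5) x - 1) = q ^ 4 * B\<^sup>2"
proof -
  note s = slow_cycle[OF adm slow_cycle_conditions[OF _ B(2,1)]]
  have "q ^ 20 < q ^ 4 * 1"
    using q_power_strict_mono[of 4 20] by simp
  also have "\<dots> \<le> q ^ 4 * B"
    using B by (intro mult_left_mono) auto
  finally have "v (x\<^sup>2 - 1) = (q ^ 4 * B)\<^sup>2"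
    using abs_square_minus_1_eq[of x] x by simp
  then have "v ((R \<kappa> ^^ 5) x - (R \<kappa> ^^ 5) 1) = q ^ 4 * B\<^sup>2"
    using s(2) x by (simp add: power_mult_distrib power_add[symmetric] flip: power_mult)
      (simp add: field_simps power_add[symmetric])
  moreover have "v ((R \<kappa> ^^ 5) 1 - 1) < q ^ 4 * B\<^sup>2"
  proof -
    have "v ((R \<kappa> ^^ 5) 1 - 1) \<le> q ^ 6" using adm by (simp add: admissible_def)
    also have "\<dots> < q ^ 4 * 1" using q_power_strict_mono[of 4 6] by simp
    also have "\<dots> \<le> q ^ 4 * B\<^sup>2"
      using B by (intro mult_left_mono) (auto simp: one_le_power)
    finally show ?thesis .
  qed
  ultimately show ?thesis
    using add_dominant[of "(R \<kappa> ^^ 5) 1 - 1" "(R \<kappa> ^^ 5) x - (R \<kappa> ^^ 5) 1"] by simp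
qed

lemma slow_cycle_le:
  assumes adm: "admissible \<kappa>" and x: "v (x - 1) < q ^ 4 * B" and B: "1 \<le> B" "q ^ 5 * B\<^sup>2 < 1"
  shows "v ((R \<kappa> ^^ 5) x - 1) < q ^ 4 * B\<^sup>2"
proof -
  note s = slow_cycle[OF adm slow_cycle_conditions[OF _ B(2,1)]]
  have "q ^ 20 < q ^ 4 * 1"
    using q_power_strict_mono[of 4 20] by simp
  also have "\<dots> \<le> q ^ 4 * B"
    using B by (intro mult_left_mono) auto
  finally have "v (x\<^sup>2 - 1) < (q ^ 4 * B)\<^sup>2"
    using abs_square_minus_1_less x by blast
  then have "v (x\<^sup>2 - 1) / q ^ 4 < (q ^ 4 * B)\<^sup>2 / q ^ 4"
    by (intro divide_strict_right_mono) auto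
  then have 1: "v ((R \<kappa> ^^ 5) x - (R \<kappa> ^^ 5) 1) < q ^ 4 * B\<^sup>2"
    using s(2) x by (simp add: power_mult_distrib power_add[symmetric] flip: power_mult)
      (simp add: field_simps power_add[symmetric])
  have "v ((R \<kappa> ^^ 5) 1 - 1) \<le> q ^ 6" using adm by (simp add: admissible_def)
  also have "\<dots> < q ^ 4 * 1" using q_power_strict_mono[of 4 6] by simp
  also have "\<dots> \<le> q ^ 4 * B\<^sup>2"
    using B by (intro mult_left_mono) (auto simp: one_le_power)
  finally show ?thesis
    using add_less[OF 1] by fastforce
qed

lemma slow_cycle_critical:
  assumes adm: "admissible \<kappa>" and x: "v (x - 1) \<le> q ^ 6"
  shows "v ((R \<kappa> ^^ 5) x - 1) \<le> q ^ 6"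
proof -
  have T: "v (x\<^sup>2 - 1) \<le> q ^ 12"
    using abs_square_minus_1_le[OF x] q_power_mono[of 6 20] by (simp flip: power_mult)
  have "v ((R \<kappa> ^^ 5) x - (R \<kappa> ^^ 5) 1) = v (x\<^sup>2 - 1) / q ^ 4"
    using T x q_power_strict_mono[of 3 12] q_power_strict_mono[of 1 6]
    by (intro slow_cycle(2) adm) auto
  also have "\<dots> \<le> q ^ 12 / q ^ 4"
    using T by (intro divide_right_mono) auto
  also have "\<dots> = q ^ 8"
    by (simp add: power_diff[symmetric])
  also have "\<dots> \<le> q ^ 6"
    by (rule q_power_mono) simp
  finally show ?thesis
    using adm unfolding admissible_def by (blast intro: dist_trans_le)
qed

lemma iterate_5_Suc: "(R \<kappa> ^^ (5 * Suc i)) x = (R \<kappa> ^^ 5) ((R \<kappa> ^^ (5 * i)) x)"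
  by (metis add.commute funpow_add comp_apply mult_Suc_right)

lemma power_power_2_Suc: "(B::real) ^ 2 ^ Suc i = (B ^ 2 ^ i)\<^sup>2"
  by (simp add: power_mult[symmetric] mult.commute)

lemma power_power_2_bound:
  assumes "1 \<le> B" "q ^ 5 * B ^ 2 ^ l < 1" "i < l"
  shows "q ^ 5 * (B ^ 2 ^ i)\<^sup>2 < 1" "1 \<le> B ^ 2 ^ i"
proof -
  have "B ^ 2 ^ Suc i \<le> B ^ 2 ^ l"
    using assms by (intro power_increasing) auto
  then have "q ^ 5 * (B ^ 2 ^ i)\<^sup>2 \<le> q ^ 5 * B ^ 2 ^ l"
    unfolding power_power_2_Suc by (intro mult_left_mono) auto
  then show "q ^ 5 * (B ^ 2 ^ i)\<^sup>2 < 1"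
    using assms by linarith
  show "1 \<le> B ^ 2 ^ i"
    using assms by (simp add: one_le_power)
qed

lemma slow_orbit_exact:
  assumes adm: "admissible \<kappa>" and x: "v (x - 1) = q ^ 4 * B" and B: "1 \<le> B" "q ^ 5 * B ^ 2 ^ l < 1"
  shows "i \<le> l \<Longrightarrow> v ((R \<kappa> ^^ (5 * i)) x - 1) = q ^ 4 * B ^ 2 ^ i"
proof (induction i)
  case (Suc i)
  then show ?case
    using slow_cycle_exact[OF adm] power_power_2_bound[OF B, of i]
    by (simp add: iterate_5_Suc power_power_2_Suc del: mult_Suc_right power_Suc)
qed (use x in simp)

lemma slow_orbit_le:
  assumes adm: "admissible \<kappa>" and x: "v (x - 1) < q ^ 4 * B" and B: "1 \<le> B" "q ^ 5 * B ^ 2 ^ l < 1"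
  shows "i \<le> l \<Longrightarrow> v ((R \<kappa> ^^ (5 * i)) x - 1) < q ^ 4 * B ^ 2 ^ i"
proof (induction i)
  case (Suc i)
  then show ?case
    using slow_cycle_le[OF adm] power_power_2_bound[OF B, of i]
    by (simp add: iterate_5_Suc power_power_2_Suc del: mult_Suc_right power_Suc)
qed (use x in simp)

lemma slow_orbit_critical:
  assumes "admissible \<kappa>"
  shows "v ((R \<kappa> ^^ (5 * i)) 1 - 1) \<le> q ^ 6"
  by (induction i) (simp_all add: iterate_5_Suc slow_cycle_critical[OF assms] del: mult_Suc_right)

text \<open>Squaring can be undone: the scale at the end of the slow cycles determines the scale at
  their beginning. This is how the itinerary of a parameter found by a covering argument is
  recovered from its last part.\<close>

lemma slow_orbit_backward:
  assumes adm: "admissible \<kappa>" and x: "v (x - 1) < q ^ 4 * C" and C: "1 \<le> C" "q ^ 5 * C ^ 2 ^ l < 1"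
    and B: "1 \<le> B" and xl: "v ((R \<kappa> ^^ (5 * l)) x - 1) = q ^ 4 * B ^ 2 ^ l"
  shows "v (x - 1) = q ^ 4 * B"
proof -
  have "v ((R \<kappa> ^^ (5 * (l - j))) x - 1) = q ^ 4 * B ^ 2 ^ (l - j)" if "j \<le> l" for j
    using that
  proof (induction j)
    case (Suc j)
    define i where "i = l - Suc j"
    have i: "l - j = Suc i" "i < l" using Suc.prems by (auto simp: i_def)
    define y where "y = (R \<kappa> ^^ (5 * i)) x"
    have y: "v (y - 1) < q ^ 4 * C ^ 2 ^ i"
      unfolding y_def using i by (intro slow_orbit_le[OF adm x C]) auto
    have c: "v (y - 1) < q" "v (y\<^sup>2 - 1) < q ^ 3"
      using slow_cycle_conditions[of y "C ^ 2 ^ i"] y power_power_2_bound[OF C i(2)] by auto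
    define b where "b = B ^ 2 ^ i"
    have b: "b \<ge> 1" using B by (simp add: b_def one_le_power)
    have "v ((R \<kappa> ^^ 5) y - 1) = q ^ 4 * b\<^sup>2"
      using Suc i by (simp add: iterate_5_Suc power_power_2_Suc y_def b_def del: mult_Suc_right power_Suc)
    moreover have "v ((R \<kappa> ^^ 5) 1 - 1) < q ^ 4 * b\<^sup>2"
    proof -
      have "v ((R \<kappa> ^^ 5) 1 - 1) \<le> q ^ 6" using adm by (simp add: admissible_def)
      also have "\<dots> < q ^ 4 * 1" using q_power_strict_mono[of 4 6] by simp
      also have "\<dots> \<le> q ^ 4 * b\<^sup>2"
        using b by (intro mult_left_mono) (auto simp: one_le_power)
      finally show ?thesis .
    qed
    ultimately have "v ((R \<kappa> ^^ 5) y - (R \<kappa> ^^ 5) 1) = q ^ 4 * b\<^sup>2"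
      using diff_dominant[of "(R \<kappa> ^^ 5) 1 - 1" "(R \<kappa> ^^ 5) y - 1"] by simp
    then have sq: "v (y\<^sup>2 - 1) = (q ^ 4 * b)\<^sup>2"
      using slow_cycle(2)[OF adm c] by (simp add: field_simps power_mult_distrib flip: power_add power_mult)
    have "\<not> v (y - 1) \<le> q ^ 20"
    proof
      assume "v (y - 1) \<le> q ^ 20"
      then have "(q ^ 4 * b)\<^sup>2 \<le> (q ^ 20)\<^sup>2"
        using abs_square_minus_1_le[of y "q ^ 20"] sq by simp
      then have "q ^ 4 * b \<le> q ^ 20"
        by (rule power2_le_imp_le) simp
      moreover have "q ^ 4 * 1 \<le> q ^ 4 * b" using b by (intro mult_left_mono) auto
      moreover have "q ^ 20 < q ^ 4" by (rule q_power_strict_mono) simp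
      ultimately show False by linarith
    qed
    then have "(v (y - 1))\<^sup>2 = (q ^ 4 * b)\<^sup>2"
      using abs_square_minus_1_eq[of y] sq by simp
    then have "v (y - 1) = q ^ 4 * b"
      using b by (simp add: power2_eq_iff_nonneg)
    then show ?case by (simp add: y_def b_def i_def)
  qed (use xl in simp)
  from this[of l] show ?thesis by simp
qed

section \<open>Dependence on the parameter\<close>

lemma R_diff_param_le:
  assumes "x \<noteq> \<pi>" "y \<noteq> \<pi>" "v \<kappa>' = 1"
    and "v (slope \<kappa> x y) * v (x - y) \<le> r" "v (\<kappa> - \<kappa>') * v (R \<kappa>' y) \<le> r"
  shows "v (R \<kappa> x - R \<kappa>' y) \<le> r"
proof -
  have "\<kappa>' \<noteq> 0" using assms(3) by auto
  then show ?thesis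
    unfolding R_diff_param[OF assms(1,2) \<open>\<kappa>' \<noteq> 0\<close>]
    using assms by (intro add_le) (simp_all add: abs_simps)
qed

text \<open>The parameter around which the construction takes place: for it the critical point is
  periodic of period five.\<close>

definition centre :: "'k \<Rightarrow> bool" where
  "centre \<kappa> \<longleftrightarrow> v \<kappa> = 1 \<and> v (\<kappa>\<^sup>2 - \<kappa> + 1) \<le> q\<^sup>2 \<and> v (1 / \<pi> - R \<kappa> (\<kappa> / \<pi>)) = q ^ 4 \<and>
     (R \<kappa> ^^ 5) 1 = 1"

lemma centre_imp_admissible: "centre \<kappa> \<Longrightarrow> admissible \<kappa>"
  by (auto simp: centre_def admissible_def)

lemma param_condition_perturb:
  assumes "v \<kappa>' = 1" "v (\<kappa>'\<^sup>2 - \<kappa>' + 1) \<le> q\<^sup>2" "v (\<kappa> - \<kappa>') \<le> q\<^sup>2"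
  shows "v \<kappa> = 1" "v (\<kappa>\<^sup>2 - \<kappa> + 1) \<le> q\<^sup>2"
proof -
  have q2: "q\<^sup>2 < 1" using q_power_strict_mono[of 0 2] by simp
  show k: "v \<kappa> = 1"
    using close_imp_eq[of \<kappa> \<kappa>'] assms q2 by simp
  have "\<kappa>\<^sup>2 - \<kappa> + 1 = (\<kappa> - \<kappa>') * (\<kappa> + \<kappa>' - 1) + (\<kappa>'\<^sup>2 - \<kappa>' + 1)"
    by (simp add: algebra_simps power2_eq_square)
  moreover have "v (\<kappa> + \<kappa>' - 1) \<le> 1"
    using k assms(1) by (intro diff_le add_le) auto
  then have "v (\<kappa> - \<kappa>') * v (\<kappa> + \<kappa>' - 1) \<le> q\<^sup>2 * 1"
    using assms(3) by (intro mult_mono) auto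
  ultimately show "v (\<kappa>\<^sup>2 - \<kappa> + 1) \<le> q\<^sup>2"
    using add_le[of "(\<kappa> - \<kappa>') * (\<kappa> + \<kappa>' - 1)" "q\<^sup>2" "\<kappa>'\<^sup>2 - \<kappa>' + 1"] assms(2)
    by (simp only: mult mult_1_right)
qed

text \<open>Every parameter at distance at most \<open>q ^ 12\<close> from the centre is admissible: in five steps a
  change of the parameter is magnified by at most \<open>1 / q ^ 5\<close>.\<close>

lemma critical_orbit_perturb:
  assumes c: "centre \<kappa>'" and d: "v (\<kappa> - \<kappa>') \<le> d" "d \<le> q ^ 12"
  shows "v (R \<kappa> (\<kappa> / \<pi>) - R \<kappa>' (\<kappa>' / \<pi>)) \<le> d / q"
    "v (R \<kappa> (R \<kappa> (\<kappa> / \<pi>)) - R \<kappa>' (R \<kappa>' (\<kappa>' / \<pi>))) \<le> d / q"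
    "admissible \<kappa>"
proof -
  note adm' = centre_imp_admissible[OF c]
  note c' = critical_orbit[OF adm']
  have k': "v \<kappa>' = 1" "v (\<kappa>'\<^sup>2 - \<kappa>' + 1) \<le> q\<^sup>2" "v (1 / \<pi> - R \<kappa>' (\<kappa>' / \<pi>)) = q ^ 4"
    "(R \<kappa>' ^^ 5) 1 = 1"
    using c by (auto simp: centre_def)
  have d2: "v (\<kappa> - \<kappa>') \<le> q\<^sup>2" using d q_power_mono[of 2 12] by simp
  note k = param_condition_perturb[OF k'(1,2) d2]
  have d0: "0 \<le> d" using d nonneg[of "\<kappa> - \<kappa>'"] by linarith
  have dq: "d / q ^ i \<le> q ^ (12 - i)" if "i \<le> 12" for i
    using divide_right_mono[OF d(2), of "q ^ i"] that by (simp add: power_diff)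
  have dmono: "d / q ^ i \<le> d / q ^ j" if "i \<le> j" for i j
    using d0 q_power_mono[OF that] by (intro divide_left_mono) auto
  have step: "v (\<kappa> - \<kappa>') * s \<le> d / q ^ j" if "0 \<le> s" "s \<le> 1 / q ^ j" for s j
    using mult_mono[OF d(1) that(2)] d0 that by simp
  define x1 where "x1 = \<kappa> / \<pi>"
  define y1 where "y1 = \<kappa>' / \<pi>"
  have 1: "v (x1 - y1) \<le> d / q"
    using d by (simp add: x1_def y1_def abs_divide divide_right_mono flip: diff_divide_distrib)
  have x1: "v x1 = 1 / q" and y1: "v y1 = 1 / q"
    using k(1) k'(1) by (simp_all add: x1_def y1_def abs_divide)
  define x2 where "x2 = R \<kappa> x1"
  define y2 where "y2 = R \<kappa>' y1"
  have y2: "v y2 = 1 / q" using c'(2) by (simp add: y2_def y1_def)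
  have 2: "v (x2 - y2) \<le> d / q"
    unfolding x2_def y2_def
    using big_region(2)[OF x1] big_region(2)[OF y1] k'(1) slope_big[OF x1 y1 k(1)] 1 y2 step[of "1 / q" 1]
    by (intro R_diff_param_le) (auto simp: y2_def)
  then show "v (R \<kappa> (\<kappa> / \<pi>) - R \<kappa>' (\<kappa>' / \<pi>)) \<le> d / q"
    by (simp add: x1_def y1_def x2_def y2_def)
  have b2: "v (x2 - y2) \<le> q ^ 11"
    using 2 dq[of 1] by simp
  have lt: "q ^ i < 1 / q" if "i > 0" for i
    using less_trans[OF _ one_less_inverse] q_power_strict_mono[of 0 i] that by simp
  have x2: "v x2 = 1 / q"
    using close_imp_eq[of x2 y2] y2 le_less_trans[OF b2 lt] by simp
  define x3 where "x3 = R \<kappa> x2"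
  define y3 where "y3 = R \<kappa>' y2"
  have y3: "v y3 = q ^ 4" using c'(3) by (simp add: y3_def y2_def y1_def)
  have qle: "q ^ i \<le> 1 / q ^ j" for i j
    using q_power_mono[of 0 "i + j"] by (simp add: field_simps power_add)
  have 3: "v (x3 - y3) \<le> d / q"
    unfolding x3_def y3_def
    using big_region(2)[OF x2] big_region(2)[OF y2] k'(1) slope_big[OF x2 y2 k(1)] 2 y3 step[of "q ^ 4" 1] qle[of 4 1]
    by (intro R_diff_param_le) (auto simp: y3_def)
  then show "v (R \<kappa> (R \<kappa> (\<kappa> / \<pi>)) - R \<kappa>' (R \<kappa>' (\<kappa>' / \<pi>))) \<le> d / q"
    by (simp add: x1_def y1_def x2_def y2_def x3_def y3_def)
  have b3: "v (x3 - y3) \<le> q ^ 11"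
    using 3 dq[of 1] by simp
  have y3s: "v y3 < q" using y3 q_power_strict_mono[of 1 4] by simp
  have x3: "v x3 < q"
    using add_less[of "x3 - y3" q y3] y3s le_less_trans[OF b3] q_power_strict_mono[of 1 11] by simp
  define x4 where "x4 = R \<kappa> x3"
  define y4 where "y4 = R \<kappa>' y3"
  have y4: "v y4 = q\<^sup>2" using small_region(4)[OF y3s k'(1)] y3 by (simp add: y4_def power_eq_if)
  have 4: "v (x4 - y4) \<le> d / q ^ 3"
    unfolding x4_def y4_def
  proof (rule R_diff_param_le[OF small_region(2)[OF x3] small_region(2)[OF y3s] k'(1)])
    show "v (slope \<kappa> x3 y3) * v (x3 - y3) \<le> d / q ^ 3"
      using divide_right_mono[OF 3, of "q\<^sup>2"] slope_small[OF x3 y3s k(1)] by (simp add: power_eq_if)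
    show "v (\<kappa> - \<kappa>') * v (R \<kappa>' y3) \<le> d / q ^ 3"
      using step[of "q\<^sup>2" 3] y4 qle[of 2 3] by (simp add: y4_def)
  qed
  have b4: "v (x4 - y4) \<le> q ^ 9"
    using 4 dq[of 3] by simp
  have y4s: "v y4 < q" using y4 q_power_strict_mono[of 1 2] by simp
  have x4: "v x4 < q"
    using add_less[of "x4 - y4" q y4] y4s le_less_trans[OF b4] q_power_strict_mono[of 1 9] by simp
  have y5: "R \<kappa>' y4 = 1"
    using k'(4) by (simp add: iterate_5 R_1 y1_def y2_def y3_def y4_def)
  have 5: "v (R \<kappa> x4 - R \<kappa>' y4) \<le> d / q ^ 5"
  proof (rule R_diff_param_le[OF small_region(2)[OF x4] small_region(2)[OF y4s] k'(1)])
    show "v (slope \<kappa> x4 y4) * v (x4 - y4) \<le> d / q ^ 5"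
      using divide_right_mono[OF 4, of "q\<^sup>2"] slope_small[OF x4 y4s k(1)]
      by (simp add: power_add[symmetric])
    show "v (\<kappa> - \<kappa>') * v (R \<kappa>' y4) \<le> d / q ^ 5"
      using step[of 1 5] y5 qle[of 0 5] by simp
  qed
  have "v ((R \<kappa> ^^ 5) 1 - 1) \<le> q ^ 6"
    using 5 y5 dq[of 5] q_power_mono[of 6 7]
    by (simp add: iterate_5 R_1 x1_def[symmetric] x2_def[symmetric] x3_def[symmetric] x4_def[symmetric])
  moreover have "v (1 / \<pi> - x2) = q ^ 4"
  proof -
    have "v (x2 - y2) < q ^ 4" using b2 q_power_strict_mono[of 4 11] by simp
    then show ?thesis
      using diff_dominant[of "x2 - y2" "1 / \<pi> - y2"] k'(3) by (simp add: y2_def y1_def)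
  qed
  ultimately show "admissible \<kappa>"
    using k by (simp add: admissible_def x1_def x2_def)
qed

lemma q2_bounds: "0 \<le> q\<^sup>2" "q\<^sup>2 < 1"
  using q_power_strict_mono[of 0 2] by auto

lemmas near_intros = near_mult[OF _ _ q2_bounds] near_divide[OF _ _ q2_bounds]
  near_refl[OF q2_bounds(1)] near_minus near_power[OF _ q2_bounds]

text \<open>Since the critical point of the centre has period five, the distance of its second image
  beyond \<open>\<kappa> / \<pi>\<close> to \<open>1 / \<pi>\<close> is known to relative precision \<open>\<pi>\<^sup>2\<close>. The correction term of
  order \<open>\<pi>\<close> comes from the second coefficient of the linearisation at the repelling fixed point,
  and is decisive below.\<close>

lemma critical_offset_centre:
  assumes "centre \<kappa>"
  shows "near (q\<^sup>2) (1 / \<pi> - R \<kappa> (\<kappa> / \<pi>)) (\<pi> ^ 4 / \<kappa> ^ 3 * (1 + \<pi> / \<kappa>))"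
proof -
  note adm = centre_imp_admissible[OF assms]
  note c = critical_orbit[OF adm]
  have k: "v \<kappa> = 1" "\<kappa> \<noteq> 0" and per: "(R \<kappa> ^^ 5) 1 = 1" and e: "v (1 / \<pi> - R \<kappa> (\<kappa> / \<pi>)) = q ^ 4"
    using assms by (auto simp: centre_def)
  define s where "s = 1 / \<pi> - R \<kappa> (\<kappa> / \<pi>)"
  define x3 where "x3 = R \<kappa> (R \<kappa> (\<kappa> / \<pi>))"
  define x4 where "x4 = R \<kappa> x3"
  have x3: "v x3 = q ^ 4" "v x3 < q"
    using c(3) q_power_strict_mono[of 1 4] by (simp_all add: x3_def)
  have x4: "v x4 = q\<^sup>2" "v x4 < q"
    using small_region(4)[OF x3(2) k(1)] x3(1) q_power_strict_mono[of 1 2]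
    by (simp_all add: x4_def power_eq_if)
  have x5: "R \<kappa> x4 = 1"
    using per by (simp add: iterate_5 R_1 x3_def x4_def)
  have n1: "near (q\<^sup>2) (1 + z) 1" if "v z \<le> q\<^sup>2" for z
    using that by (simp add: near_def)
  have n1': "near (q\<^sup>2) (1 - z) 1" if "v z \<le> q\<^sup>2" for z
    using n1[of "- z"] that by simp
  have k3: "near (q\<^sup>2) (1 - \<pi> * x3) 1" "near (q\<^sup>2) (1 - x3 / \<pi>) 1"
  proof -
    have "v (\<pi> * x3) = q ^ 5" "v (x3 / \<pi>) = q ^ 3"
      using x3(1) by (simp_all add: abs_simps power_eq_if)
    then show "near (q\<^sup>2) (1 - \<pi> * x3) 1" "near (q\<^sup>2) (1 - x3 / \<pi>) 1"
      using q_power_mono[of 2 5] q_power_mono[of 2 3] by (auto intro!: n1')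
  qed
  have k4: "near (q\<^sup>2) (1 - \<pi> * x4) 1"
    using x4(1) q_power_mono[of 2 3] by (intro n1') (auto simp: abs_simps power_eq_if)
  have Rx: "R \<kappa> x = - \<kappa> * x * (1 - \<pi> * x) / (\<pi>\<^sup>2 * (1 - x / \<pi>))" for x
  proof -
    have "\<pi>\<^sup>2 * (1 - x / \<pi>) = - (\<pi> * (x - \<pi>))"
      by (simp add: field_simps power2_eq_square)
    then show ?thesis by (simp add: R_def)
  qed
  have ne4: "1 - x4 / \<pi> \<noteq> 0" "1 - \<pi> * x4 \<noteq> 0"
    using small_region(2,3)[OF x4(2)] by (auto simp: field_simps)
  have solve: "x = - m * w / (k * a)" if "- k * x * a = m * w" "k * a \<noteq> 0" for k x a m w :: 'k
  proof -
    have "x * (k * a) = - (- k * x * a)" by (simp add: mult_ac)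
    also have "\<dots> = - m * w" unfolding that(1) by simp
    finally show ?thesis using nonzero_eq_divide_eq[OF that(2), of x "- m * w"] by blast
  qed
  have x4eq: "x4 = - \<pi>\<^sup>2 * (1 - x4 / \<pi>) / (\<kappa> * (1 - \<pi> * x4))"
  proof -
    have "- \<kappa> * x4 * (1 - \<pi> * x4) = \<pi>\<^sup>2 * (1 - x4 / \<pi>)"
      using x5 unfolding Rx divide_eq_1_iff by simp
    then show ?thesis
      using solve[of \<kappa> x4 "1 - \<pi> * x4"] k(2) ne4 by simp
  qed
  have u: "near (q\<^sup>2) (1 - x4 / \<pi>) (1 + \<pi> / \<kappa>)"
  proof -
    \<comment> \<open>to first order \<open>x4\<close> is \<open>- \<pi>\<^sup>2 / \<kappa>\<close>; substituting this into the exact equation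
      yields one more order\<close>
    have p: "v (1 + \<pi> / \<kappa>) = 1"
      using add_dominant[of "\<pi> / \<kappa>" 1] k pi_small by (simp add: abs_simps)
    have "near (q\<^sup>2) (- \<pi> * (1 - x4 / \<pi>) / (\<kappa> * (1 - \<pi> * x4))) (- \<pi> * (1 - x4 / \<pi>) / (\<kappa> * 1))"
      by (intro near_intros k4)
    moreover have "x4 / \<pi> = - \<pi> * (1 - x4 / \<pi>) / (\<kappa> * (1 - \<pi> * x4))"
      by (subst x4eq) (simp add: power2_eq_square)
    ultimately have "near (q\<^sup>2) (x4 / \<pi>) (- \<pi> * (1 - x4 / \<pi>) / (\<kappa> * 1))"
      by metis
    then have "v (x4 / \<pi> + \<pi> * (1 - x4 / \<pi>) / \<kappa>) \<le> q\<^sup>2 * v (- \<pi> * (1 - x4 / \<pi>) / \<kappa>)"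
      by (simp add: near_def)
    moreover have "v (1 - x4 / \<pi>) = 1"
      using diff_dominant[of "x4 / \<pi>" 1] x4 pi_small by (simp add: abs_simps power2_eq_square)
    ultimately have "v (x4 / \<pi> + \<pi> * (1 - x4 / \<pi>) / \<kappa>) \<le> q\<^sup>2 * q"
      using k by (simp add: abs_simps)
    moreover have "q\<^sup>2 * q \<le> q\<^sup>2" by (rule mult_left_le) (use pi_small in auto)
    ultimately have 1: "v (x4 / \<pi> + \<pi> * (1 - x4 / \<pi>) / \<kappa>) \<le> q\<^sup>2"
      by linarith
    have "v (\<pi> * (x4 / \<pi>) / \<kappa>) \<le> q\<^sup>2"
      using x4 k by (simp add: abs_simps)
    from add_le[OF 1 this] have "v (x4 / \<pi> + \<pi> / \<kappa>) \<le> q\<^sup>2"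
      using k by (simp add: field_simps)
    then show ?thesis
      unfolding near_def p by (simp add: minus_commute algebra_simps)
  qed
  have x4n: "near (q\<^sup>2) x4 (- \<pi>\<^sup>2 * (1 + \<pi> / \<kappa>) / (\<kappa> * 1))"
    by (subst x4eq) (intro near_intros u k4)
  have x3n: "near (q\<^sup>2) x3 (\<pi> ^ 4 / \<kappa>\<^sup>2 * (1 + \<pi> / \<kappa>))"
  proof -
    have ne3: "1 - x3 / \<pi> \<noteq> 0" "1 - \<pi> * x3 \<noteq> 0"
      using small_region(2,3)[OF x3(2)] by (auto simp: field_simps)
    have "x4 * (\<pi>\<^sup>2 * (1 - x3 / \<pi>)) = - \<kappa> * x3 * (1 - \<pi> * x3)"
      using ne3 unfolding x4_def Rx by simp
    then have "x3 = x4 * (\<pi>\<^sup>2 * (1 - x3 / \<pi>)) / (- \<kappa> * (1 - \<pi> * x3))"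
      using ne3 k by (simp add: eq_divide_eq)
    also have "near (q\<^sup>2) \<dots> ((- \<pi>\<^sup>2 * (1 + \<pi> / \<kappa>) / (\<kappa> * 1)) * (\<pi>\<^sup>2 * 1) / (- \<kappa> * 1))"
      by (intro near_intros x4n k3)
    finally show ?thesis
      using k by (simp add: power_eq_if mult_ac)
  qed
  have R2: "R \<kappa> (\<kappa> / \<pi>) = 1 / \<pi> - s" by (simp add: s_def)
  have x2: "v (1 / \<pi> - s) = 1 / q" using c(2) R2 by simp
  have "x3 = \<kappa> * s * ((1 / \<pi> - s) / (1 / \<pi> - s - \<pi>))"
  proof -
    have "1 - \<pi> * (1 / \<pi> - s) = \<pi> * s"
      by (simp add: algebra_simps)
    then show ?thesis
      unfolding x3_def R2 R_def[of \<kappa> "1 / \<pi> - s"] by simp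
  qed
  moreover have "near (q\<^sup>2) (1 / \<pi> - s - \<pi>) (1 / \<pi> - s)"
    unfolding near_def x2 by (simp add: power2_eq_square)
  then have "near (q\<^sup>2) ((1 / \<pi> - s) / (1 / \<pi> - s - \<pi>)) ((1 / \<pi> - s) / (1 / \<pi> - s))"
    by (intro near_intros)
  then have "near (q\<^sup>2) ((1 / \<pi> - s) / (1 / \<pi> - s - \<pi>)) 1"
    using big_region(3)[OF x2] by simp
  then have "near (q\<^sup>2) (\<kappa> * s * ((1 / \<pi> - s) / (1 / \<pi> - s - \<pi>))) (\<kappa> * s * 1)"
    by (intro near_intros)
  ultimately have "near (q\<^sup>2) (\<kappa> * s) x3"
    using near_sym[OF _ q2_bounds(2)] by simp
  then have "near (q\<^sup>2) (\<kappa> * s) (\<pi> ^ 4 / \<kappa>\<^sup>2 * (1 + \<pi> / \<kappa>))"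
    using near_trans[OF _ x3n q2_bounds(2)] by blast
  then have "near (q\<^sup>2) (\<kappa> * s / \<kappa>) (\<pi> ^ 4 / \<kappa>\<^sup>2 * (1 + \<pi> / \<kappa>) / \<kappa>)"
    by (rule near_divide[OF _ near_refl[OF q2_bounds(1)] q2_bounds])
  then show ?thesis
    using k by (simp add: s_def power_eq_if mult_ac)
qed

lemma critical_offset:
  assumes c: "centre \<kappa>'" and d: "v (\<kappa> - \<kappa>') \<le> q ^ 12"
  shows "near (q\<^sup>2) (1 / \<pi> - R \<kappa> (\<kappa> / \<pi>)) (\<pi> ^ 4 / \<kappa> ^ 3 * (1 + \<pi> / \<kappa>))"
proof -
  note p = critical_orbit_perturb[OF c d order_refl]
  have k': "v \<kappa>' = 1" and e': "v (1 / \<pi> - R \<kappa>' (\<kappa>' / \<pi>)) = q ^ 4"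
    using c by (auto simp: centre_def)
  have k: "v \<kappa> = 1" using p(3) by (simp add: admissible_def)
  have "near (q\<^sup>2) (1 / \<pi> - R \<kappa> (\<kappa> / \<pi>)) (1 / \<pi> - R \<kappa>' (\<kappa>' / \<pi>))"
  proof -
    have "v (R \<kappa> (\<kappa> / \<pi>) - R \<kappa>' (\<kappa>' / \<pi>)) \<le> q ^ 6"
    proof -
      have "q ^ 12 / q = q ^ 11" by (simp add: power_eq_if)
      then show ?thesis using p(1) q_power_mono[of 6 11] by linarith
    qed
    then show ?thesis
      unfolding near_def e' by (simp add: minus_commute power_add[symmetric])
  qed
  moreover have kk: "near (q\<^sup>2) \<kappa> \<kappa>'"
    using d k' q_power_mono[of 2 12] by (simp add: near_def)
  have "near (q\<^sup>2) (1 + \<pi> / \<kappa>) (1 + \<pi> / \<kappa>')"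
  proof -
    have 1: "v (1 + \<pi> / \<kappa>') = 1"
      using add_dominant[of "\<pi> / \<kappa>'" 1] k' pi_small by (simp add: abs_simps)
    have "near (q\<^sup>2) (\<pi> / \<kappa>) (\<pi> / \<kappa>')"
      by (intro near_intros kk)
    then have "v (\<pi> / \<kappa> - \<pi> / \<kappa>') \<le> q\<^sup>2"
    proof -
      have "q\<^sup>2 * q \<le> q\<^sup>2" by (rule mult_left_le) (use pi_small in auto)
      moreover have "v (\<pi> / \<kappa>') = q" using k' by (simp add: abs_simps)
      moreover have "v (\<pi> / \<kappa> - \<pi> / \<kappa>') \<le> q\<^sup>2 * q"
        using \<open>near _ (\<pi> / \<kappa>) (\<pi> / \<kappa>')\<close> \<open>v (\<pi> / \<kappa>') = q\<close> by (simp add: near_def)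
      ultimately show ?thesis by linarith
    qed
    then show ?thesis using 1 by (simp add: near_def)
  qed
  then have "near (q\<^sup>2) (\<pi> ^ 4 / \<kappa> ^ 3 * (1 + \<pi> / \<kappa>)) (\<pi> ^ 4 / \<kappa>' ^ 3 * (1 + \<pi> / \<kappa>'))"
    by (intro near_intros kk)
  then have "near (q\<^sup>2) (\<pi> ^ 4 / \<kappa>' ^ 3 * (1 + \<pi> / \<kappa>')) (\<pi> ^ 4 / \<kappa> ^ 3 * (1 + \<pi> / \<kappa>))"
    by (rule near_sym[OF _ q2_bounds(2)])
  ultimately show ?thesis
    using critical_offset_centre[OF c] near_trans[OF _ _ q2_bounds(2)] by blast
qed

section \<open>Transversality\<close>

lemma two_le: "i \<le> 20 \<Longrightarrow> v 2 \<le> q ^ i"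
  by (rule order_trans[OF two_small q_power_mono])

lemma near_slope_small:
  assumes y: "v y \<le> q\<^sup>2" and d: "v (x - y) \<le> q ^ 5"
  shows "near (q\<^sup>2) (slope \<kappa> x y) (- \<kappa> / \<pi>\<^sup>2)"
proof -
  have "q ^ 5 \<le> q\<^sup>2" by (rule q_power_mono) simp
  then have x: "v x \<le> q\<^sup>2"
    using add_le[of "x - y" "q\<^sup>2" y] d y by simp
  have xy: "v (x * y) \<le> q ^ 4"
    using mult_mono[OF x y] by (simp add: mult power_add[symmetric])
  have "v (2 * y) \<le> q ^ 5"
    using mult_mono[OF two_small y] q_power_mono[of 5 22] by (simp add: mult power_add[symmetric])
  then have s: "v (x + y) \<le> q ^ 5"
    using add_le[OF d, of "2 * y"] by (simp add: algebra_simps)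
  have "v (\<pi> * (x + y)) \<le> q ^ 6"
    using mult_left_mono[OF s, of q] by (simp only: mult) (simp add: power_eq_if)
  then have "v (x * y - \<pi> * (x + y)) \<le> q ^ 4"
    using xy q_power_mono[of 4 6] by (intro diff_le) auto
  then have "v (x * y - \<pi> * (x + y)) \<le> q\<^sup>2"
    using q_power_mono[of 2 4] by simp
  then have num: "near (q\<^sup>2) (1 + x * y - \<pi> * (x + y)) 1"
    by (simp add: near_def add_diff_eq[symmetric])
  have "v (x * y / \<pi>\<^sup>2) \<le> q ^ 4 / q\<^sup>2"
    unfolding abs_divide abs_power using xy by (intro divide_right_mono) auto
  moreover have "v ((x + y) / \<pi>) \<le> q ^ 5 / q"
    unfolding abs_divide using s by (intro divide_right_mono) auto
  ultimately have "v (x * y / \<pi>\<^sup>2) \<le> q\<^sup>2" "v ((x + y) / \<pi>) \<le> q\<^sup>2"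
  proof -
    assume a: "v (x * y / \<pi>\<^sup>2) \<le> q ^ 4 / q\<^sup>2" "v ((x + y) / \<pi>) \<le> q ^ 5 / q"
    have "q ^ 4 / q\<^sup>2 = q\<^sup>2" "q ^ 5 / q = q ^ 4"
      by (simp_all add: power_eq_if)
    moreover have "q ^ 4 \<le> q\<^sup>2" by (rule q_power_mono) simp
    ultimately show "v (x * y / \<pi>\<^sup>2) \<le> q\<^sup>2" "v ((x + y) / \<pi>) \<le> q\<^sup>2"
      using a by linarith+
  qed
  then have "v (x * y / \<pi>\<^sup>2 - (x + y) / \<pi>) \<le> q\<^sup>2"
    by (rule diff_le)
  then have "near (q\<^sup>2) (1 + (x * y / \<pi>\<^sup>2 - (x + y) / \<pi>)) 1"
    by (simp add: near_def)
  then have "near (q\<^sup>2) (\<pi>\<^sup>2 * (1 + (x * y / \<pi>\<^sup>2 - (x + y) / \<pi>))) (\<pi>\<^sup>2 * 1)"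
    by (intro near_intros)
  moreover have "\<pi>\<^sup>2 * (1 + (x * y / \<pi>\<^sup>2 - (x + y) / \<pi>)) = (x - \<pi>) * (y - \<pi>)"
    by (simp add: field_simps power2_eq_square)
  ultimately have den: "near (q\<^sup>2) ((x - \<pi>) * (y - \<pi>)) (\<pi>\<^sup>2)"
    by simp
  have "near (q\<^sup>2) (- \<kappa> * (1 + x * y - \<pi> * (x + y)) / ((x - \<pi>) * (y - \<pi>))) (- \<kappa> * 1 / \<pi>\<^sup>2)"
    by (intro near_intros num den)
  then show ?thesis
    by (simp add: slope_def)
qed

lemma increment_step:
  assumes "x - y = t * e" "t = \<kappa> - \<kappa>'" "x \<noteq> \<pi>" "y \<noteq> \<pi>" "\<kappa>' \<noteq> 0"
  shows "R \<kappa> x - R \<kappa>' y = t * (slope \<kappa> x y * e + R \<kappa>' y / \<kappa>')"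
  unfolding R_diff_param[OF assms(3-5)] assms(1) assms(2)[symmetric] by (simp add: algebra_simps)

lemma iterate_8: "(R \<kappa> ^^ 8) x = (R \<kappa> ^^ 3) ((R \<kappa> ^^ 5) x)"
  by (simp add: eval_nat_numeral)

text \<open>The orbits of \<open>x\<close> and \<open>y\<close> under the two parameters go through the last slow cycle (five
  steps) and the turn that makes \<open>y\<close> land on \<open>0\<close> (three steps). In the proof, \<open>e0\<close> to \<open>e7\<close> are their
  differences divided by the difference \<open>t\<close> of the parameters. The direct effect of \<open>t\<close> on the
  second cycle meets its effect through the first one. Modulo \<open>2\<close> and to leading order in \<open>\<pi>\<close> the
  return map is an odd function, whose derivative agrees with the quotient of value and
  argument; since the landing makes two contributions to the value cancel, the two effects
  of \<open>t\<close> cancel as well, to leading order. What survives is smaller by a factor \<open>\<pi>\<close>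
  and has two sources: the slope near the critical point contributes \<open>1\<close>, and the linearisation at
  \<open>0\<close>, through \<open>critical_offset\<close>, contributes \<open>1 / \<kappa>\<close>. As \<open>\<kappa>\<close> is not close to \<open>1\<close>, the sum
  \<open>1 + 1 / \<kappa>\<close> is a unit.\<close>

lemma transversality:
  assumes c: "centre \<kappa>0" and k0: "v (\<kappa> - \<kappa>0) \<le> q ^ 12" and k0': "v (\<kappa>' - \<kappa>0) \<le> q ^ 12"
    and t: "t = \<kappa> - \<kappa>'" "t \<noteq> 0" "v t \<le> q ^ 20"
    and y0: "v (y - 1) = q ^ 3" and d0: "v (x - y) \<le> v t / q ^ 5"
    and land: "(R \<kappa>' ^^ 8) y = 0"
  shows "v ((R \<kappa> ^^ 8) x) = v t"
proof -
  note adm' = critical_orbit_perturb(3)[OF c k0' order_refl]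
  note adm = critical_orbit_perturb(3)[OF c k0 order_refl]
  have k: "v \<kappa> = 1" and k': "v \<kappa>' = 1" and k'0: "\<kappa>' \<noteq> 0" and k2': "v (\<kappa>'\<^sup>2 - \<kappa>' + 1) \<le> q\<^sup>2"
    using adm adm' by (auto simp: admissible_def)
  define g where "g = 1 / \<pi>"
  have g: "v g = 1 / q" "q\<^sup>2 * v g = q"
    by (simp_all add: g_def abs_divide power2_eq_square)
  have tt: "v t > 0" using t by (simp add: pos_iff)
  have te: "v (t * e) \<le> q ^ 15" if "v e \<le> 1 / q ^ 5" for e
  proof -
    have "v t * v e \<le> q ^ 20 * (1 / q ^ 5)"
      using t that by (intro mult_mono) auto
    also have "\<dots> = q ^ 15" by (simp add: power_diff[symmetric])
    finally show ?thesis by (simp add: mult)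
  qed
  have inv: "1 / q ^ i \<le> 1 / q ^ j" if "i \<le> j" for i j
    using q_power_mono[OF that] by (intro divide_left_mono) auto
  have lt: "q ^ i < 1 / q" if "i > 0" for i
    using less_trans[OF _ one_less_inverse] q_power_strict_mono[of 0 i] that by simp

  \<comment> \<open>sizes along the reference orbit\<close>
  define y1 where "y1 = R \<kappa>' y"
  define y2 where "y2 = R \<kappa>' y1"
  define y3 where "y3 = R \<kappa>' y2"
  define y4 where "y4 = R \<kappa>' y3"
  define y5 where "y5 = R \<kappa>' y4"
  define y6 where "y6 = R \<kappa>' y5"
  define y7 where "y7 = R \<kappa>' y6"
  have yq: "v (y - 1) < q" using y0 q_power_strict_mono[of 1 3] by simp
  have y1': "v (y - 1) < 1" using yq pi_small by linarith
  have ysq: "v (y\<^sup>2 - 1) = q ^ 6"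
    using abs_square_minus_1_eq[of y] y0 q_power_strict_mono[of 3 20] by (simp flip: power_mult)
  note ty = turn_at_critical[OF adm' yq]
  have vy: "v y = 1" "v y1 = 1 / q" "v y2 = 1 / q"
    using ty by (simp_all add: y1_def y2_def)
  have y3q: "v y3 = q ^ 4"
  proof -
    have "v (y3 - R \<kappa>' (R \<kappa>' (\<kappa>' / \<pi>))) = q ^ 6"
      using ty(4) ysq by (simp add: y1_def y2_def y3_def)
    then show ?thesis
      using close_imp_eq[of y3 "R \<kappa>' (R \<kappa>' (\<kappa>' / \<pi>))"] critical_orbit(3)[OF adm'] q_power_strict_mono[of 4 6]
      by simp
  qed
  then have y3s: "v y3 < q" using q_power_strict_mono[of 1 4] by simp
  have y2g: "v (y2 - g) = q ^ 4"
    using R_isometry_big[OF vy(3) _ k', of g] y3q g by (simp add: y3_def g_def)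
  have y4q: "v y4 = q\<^sup>2"
    using small_region(4)[OF y3s k'] y3q by (simp add: y4_def power_eq_if)
  then have y4s: "v y4 < q" using q_power_strict_mono[of 1 2] by simp
  have y5q: "v (y5 - 1) = q\<^sup>2"
  proof -
    have "v (y - 1) = q ^ 4 * (1 / q)" using y0 by (simp add: power_eq_if)
    moreover have "q ^ 5 * (1 / q)\<^sup>2 < 1"
      using q_power_strict_mono[of 0 3] by (simp add: power_eq_if)
    ultimately have "v ((R \<kappa>' ^^ 5) y - 1) = q ^ 4 * (1 / q)\<^sup>2"
      using one_less_inverse by (intro slow_cycle_exact adm') auto
    then show ?thesis
      by (simp add: iterate_5 y1_def y2_def y3_def y4_def y5_def power_eq_if)
  qed
  have y5s: "v (y5 - 1) < q" using y5q q_power_strict_mono[of 1 2] by simp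
  then have y5l: "v (y5 - 1) < 1" using pi_small by linarith
  have y5sq: "v (y5\<^sup>2 - 1) = q ^ 4"
    using abs_square_minus_1_eq[of y5] y5q q_power_strict_mono[of 2 20] by (simp flip: power_mult)
  note t5 = turn_at_critical[OF adm' y5s]
  have vy5: "v y5 = 1" "v y6 = 1 / q" "v y7 = 1 / q"
    using t5 by (simp_all add: y6_def y7_def)
  have y8: "R \<kappa>' y7 = 0"
    using land by (simp add: iterate_8 iterate_5 iterate_3 y1_def y2_def y3_def y4_def y5_def y6_def y7_def)
  have y7: "y7 = g"
  proof -
    have "v (y7 - g) = v (R \<kappa>' y7 - R \<kappa>' g)"
      using R_isometry_big[OF vy5(3) g(1) k'] by simp
    also have "\<dots> = 0" using y8 by (simp add: g_def)
    finally show ?thesis by simp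
  qed

  \<comment> \<open>the last slow cycle\<close>
  define e0 where "e0 = (x - y) / t"
  have e0: "x - y = t * e0" "v e0 \<le> 1 / q ^ 5"
    using t d0 tt by (simp_all add: e0_def abs_divide divide_le_eq mult.commute)
  have xy0: "v (x - y) \<le> q ^ 15" using te[OF e0(2)] e0 by simp
  have lt15: "q ^ 15 < q ^ i" if "i < 15" for i
    using q_power_strict_mono[OF that] .
  have x: "v x = 1"
    using close_imp_eq[of x y] vy xy0 lt15[of 0] by simp
  define e1 where "e1 = slope \<kappa> x y * e0 + y1 / \<kappa>'"
  define x1 where "x1 = R \<kappa> x"
  have e1: "x1 - y1 = t * e1"
    unfolding x1_def e1_def y1_def
    using unit_region(2)[OF x] unit_region(2)[OF vy(1)] by (intro increment_step e0 t k'0)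
  have sl: "v (slope \<kappa> x y) \<le> q ^ 6"
  proof -
    have "v ((y - 1)\<^sup>2) \<le> q ^ 6" by (simp add: abs_power y0 flip: power_mult)
    moreover have "v (2 * (y * (1 - \<pi>))) \<le> q ^ 6"
      using two_le[of 6] vy diff_dominant[of \<pi> 1] pi_small by (simp add: mult)
    moreover have "v ((x - y) * (y - \<pi>)) \<le> q ^ 6"
      using xy0 lt15[of 6] unit_region(1)[OF vy(1)] by (simp add: mult)
    ultimately have "v ((y - 1)\<^sup>2 + 2 * (y * (1 - \<pi>)) + (x - y) * (y - \<pi>)) \<le> q ^ 6"
      by (intro add_le)
    then show ?thesis
      unfolding slope_unit[OF x vy(1) k] using slope_numerator[of y x]
      by (simp add: mult.commute add.commute)
  qed
  have ne1: "near (q\<^sup>2) e1 g"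
  proof -
    have "v (slope \<kappa> x y * e0) \<le> q ^ 6 * (1 / q ^ 5)"
      unfolding mult using sl e0 by (intro mult_mono) auto
    then have 1: "v (slope \<kappa> x y * e0) \<le> q"
      by (simp add: power_eq_if)
    define w where "w = (y\<^sup>2 - 1) / (y - \<pi>)"
    have "y1 - \<kappa>' / \<pi> = - \<kappa>' * w"
      using R_near_critical(4)[OF k' y1'] by (simp add: y1_def w_def)
    then have "y1 = \<kappa>' * (g - w)"
      by (simp add: g_def algebra_simps)
    then have "y1 / \<kappa>' - g = - ((y\<^sup>2 - 1) / (y - \<pi>))"
      using k'0 by (simp add: w_def)
    then have "v (y1 / \<kappa>' - g) = q ^ 6"
      using ysq unit_region(1)[OF vy(1)] by (simp add: abs_divide)
    then have "v (y1 / \<kappa>' - g) \<le> q"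
      using q_power_mono[of 1 6] by simp
    from add_le[OF 1 this] show ?thesis
      unfolding near_def g(2) by (simp add: e1_def algebra_simps)
  qed
  have ve: "v e \<le> 1 / q ^ 5" if "v e = 1 / q ^ i" "i \<le> 5" for e i
    using inv[of i 5] that by simp
  have ve1: "v e1 = 1 / q ^ 1" using near_abs[OF ne1 q2_bounds(2)] g by simp
  have xy1: "v (x1 - y1) \<le> q ^ 15" using te[OF ve[OF ve1]] e1 by simp
  have x1: "v x1 = 1 / q"
    using close_imp_eq[of x1 y1] le_less_trans[OF xy1 lt] vy by simp

  have kk: "v (1 / \<kappa>' - \<kappa> - 1) \<le> q\<^sup>2"
  proof -
    have "v (2 - 2 * \<kappa>') \<le> q ^ 20"
      using two_small k' by (intro diff_le) (auto simp: mult)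
    then have a: "v (2 - 2 * \<kappa>') \<le> q\<^sup>2" using q_power_mono[of 2 20] by simp
    have b: "v (t * \<kappa>') \<le> q\<^sup>2" using t k' q_power_mono[of 2 20] by (simp add: mult)
    have "v ((2 - 2 * \<kappa>') - (\<kappa>'\<^sup>2 - \<kappa>' + 1) - t * \<kappa>') \<le> q\<^sup>2"
      by (intro diff_le a b k2')
    also have "(2 - 2 * \<kappa>') - (\<kappa>'\<^sup>2 - \<kappa>' + 1) - t * \<kappa>' = (1 / \<kappa>' - \<kappa> - 1) * \<kappa>'"
      using k'0 by (simp add: t(1) field_simps power2_eq_square)
    finally show ?thesis using k' by (simp add: mult)
  qed
  have gkk: "v (g * (1 / \<kappa>' - \<kappa> - 1)) \<le> q"
    using mult_left_mono[OF kk, of "v g"] g by (simp add: mult mult.commute)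

  define e2 where "e2 = slope \<kappa> x1 y1 * e1 + y2 / \<kappa>'"
  define x2 where "x2 = R \<kappa> x1"
  have e2: "x2 - y2 = t * e2"
    unfolding x2_def e2_def y2_def
    using big_region(2)[OF x1] big_region(2)[OF vy(2)] by (intro increment_step e1 t k'0)
  have ne2: "near (q\<^sup>2) e2 g"
  proof -
    have "near (q\<^sup>2) (slope \<kappa> x1 y1 * e1) (- \<kappa> * g)"
      by (intro near_intros near_slope_big x1 vy ne1)
    then have a: "v (slope \<kappa> x1 y1 * e1 + \<kappa> * g) \<le> q"
      using k g(2) by (simp add: near_def mult)
    have "v (y2 / \<kappa>' - g / \<kappa>') = q ^ 4"
      using y2g k' by (simp add: abs_divide flip: diff_divide_distrib)
    then have b: "v (y2 / \<kappa>' - g / \<kappa>') \<le> q" using q_power_mono[of 1 4] by simp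
    have "e2 - g = (slope \<kappa> x1 y1 * e1 + \<kappa> * g) + (y2 / \<kappa>' - g / \<kappa>') + g * (1 / \<kappa>' - \<kappa> - 1)"
      by (simp add: e2_def algebra_simps)
    then have "v (e2 - g) \<le> q"
      using add_le[OF add_le[OF a b] gkk] by simp
    then show ?thesis unfolding near_def g(2) .
  qed
  have ve2: "v e2 = 1 / q ^ 1" using near_abs[OF ne2 q2_bounds(2)] g by simp
  have xy2: "v (x2 - y2) \<le> q ^ 15" using te[OF ve[OF ve2]] e2 by simp
  have x2: "v x2 = 1 / q"
    using close_imp_eq[of x2 y2] le_less_trans[OF xy2 lt] vy by simp

  define e3 where "e3 = slope \<kappa> x2 y2 * e2 + y3 / \<kappa>'"
  define x3 where "x3 = R \<kappa> x2"
  have e3: "x3 - y3 = t * e3"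
    unfolding x3_def e3_def y3_def
    using big_region(2)[OF x2] big_region(2)[OF vy(3)] by (intro increment_step e2 t k'0)
  have ne3: "near (q\<^sup>2) e3 (- \<kappa> * g)"
    unfolding e3_def
  proof (rule near_add_small)
    show "near (q\<^sup>2) (slope \<kappa> x2 y2 * e2) (- \<kappa> * g)"
      by (intro near_intros near_slope_big x2 vy ne2)
    show "v (y3 / \<kappa>') \<le> q\<^sup>2 * v (- \<kappa> * g)"
      using y3q k k' q_power_mono[of 1 4] by (simp add: mult abs_divide g(2))
  qed
  have ve3: "v e3 = 1 / q ^ 1" using near_abs[OF ne3 q2_bounds(2)] g k by (simp add: mult)
  have xy3: "v (x3 - y3) \<le> q ^ 15" using te[OF ve[OF ve3]] e3 by simp
  have x3: "v x3 < q"
    using add_less[of "x3 - y3" q y3] y3s xy3 lt15[of 1] by simp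

  define e4 where "e4 = slope \<kappa> x3 y3 * e3 + y4 / \<kappa>'"
  define x4 where "x4 = R \<kappa> x3"
  have e4: "x4 - y4 = t * e4"
    unfolding x4_def e4_def y4_def
    using small_region(2)[OF x3] small_region(2)[OF y3s] by (intro increment_step e3 t k'0)
  have ne4: "near (q\<^sup>2) e4 (\<kappa>\<^sup>2 / \<pi> ^ 3)"
    unfolding e4_def
  proof (rule near_add_small)
    have "near (q\<^sup>2) (slope \<kappa> x3 y3 * e3) (- \<kappa> / \<pi>\<^sup>2 * (- \<kappa> * g))"
      using y3q q_power_mono[of 2 4] xy3 lt15[of 5] by (intro near_intros near_slope_small ne3) auto
    then show "near (q\<^sup>2) (slope \<kappa> x3 y3 * e3) (\<kappa>\<^sup>2 / \<pi> ^ 3)"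
    proof -
      have eq: "- \<kappa> / \<pi>\<^sup>2 * (- \<kappa> * g) = \<kappa>\<^sup>2 / \<pi> ^ 3"
        by (simp add: g_def power_eq_if mult_ac)
      show "near (q\<^sup>2) (slope \<kappa> x3 y3 * e3) (- \<kappa> / \<pi>\<^sup>2 * (- \<kappa> * g)) \<Longrightarrow> ?thesis"
        unfolding eq .
    qed
    have "q\<^sup>2 \<le> q\<^sup>2 * (1 / q ^ 3)"
      using inv[of 0 3] mult_left_mono[of 1 "1 / q ^ 3" "q\<^sup>2"] by simp
    then show "v (y4 / \<kappa>') \<le> q\<^sup>2 * v (\<kappa>\<^sup>2 / \<pi> ^ 3)"
      using y4q k k' by (simp add: abs_simps)
  qed
  have ve4: "v e4 = 1 / q ^ 3" using near_abs[OF ne4 q2_bounds(2)] k by (simp add: abs_simps)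
  have xy4: "v (x4 - y4) \<le> q ^ 15" using te[OF ve[OF ve4]] e4 by simp
  have x4: "v x4 < q"
    using add_less[of "x4 - y4" q y4] y4s xy4 lt15[of 1] by simp

  define e5 where "e5 = slope \<kappa> x4 y4 * e4 + y5 / \<kappa>'"
  define x5 where "x5 = R \<kappa> x4"
  have e5: "x5 - y5 = t * e5"
    unfolding x5_def e5_def y5_def
    using small_region(2)[OF x4] small_region(2)[OF y4s] by (intro increment_step e4 t k'0)
  have ne5: "near (q\<^sup>2) e5 (- (\<kappa> ^ 3 / \<pi> ^ 5))"
    unfolding e5_def
  proof (rule near_add_small)
    have "near (q\<^sup>2) (slope \<kappa> x4 y4 * e4) (- \<kappa> / \<pi>\<^sup>2 * (\<kappa>\<^sup>2 / \<pi> ^ 3))"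
      using y4q xy4 lt15[of 5] by (intro near_intros near_slope_small ne4) auto
    then show "near (q\<^sup>2) (slope \<kappa> x4 y4 * e4) (- (\<kappa> ^ 3 / \<pi> ^ 5))"
    proof -
      have eq: "- \<kappa> / \<pi>\<^sup>2 * (\<kappa>\<^sup>2 / \<pi> ^ 3) = - (\<kappa> ^ 3 / \<pi> ^ 5)"
        by (simp add: power_eq_if mult_ac)
      show "near (q\<^sup>2) (slope \<kappa> x4 y4 * e4) (- \<kappa> / \<pi>\<^sup>2 * (\<kappa>\<^sup>2 / \<pi> ^ 3)) \<Longrightarrow> ?thesis"
        unfolding eq .
    qed
    have "1 \<le> q\<^sup>2 * (1 / q ^ 5)"
      using inv[of 0 3] by (simp add: power_eq_if)
    then show "v (y5 / \<kappa>') \<le> q\<^sup>2 * v (- (\<kappa> ^ 3 / \<pi> ^ 5))"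
      using vy5 k k' by (simp add: abs_simps)
  qed
  have ve5: "v e5 = 1 / q ^ 5" using near_abs[OF ne5 q2_bounds(2)] k by (simp add: abs_simps)
  have xy5: "v (x5 - y5) \<le> q ^ 15" using te[OF ve[OF ve5]] e5 by simp
  have x5: "v x5 = 1"
    using close_imp_eq[of x5 y5] vy5 xy5 lt15[of 0] by simp

  \<comment> \<open>the jump\<close>
  define G where "G = (y5\<^sup>2 - 1) / (y5 - \<pi>)"
  have G: "v G = q ^ 4"
    using y5sq unit_region(1)[OF vy5(1)] by (simp add: G_def abs_divide)
  have y6G: "y6 - \<kappa>' / \<pi> = - \<kappa>' * G"
    using R_near_critical(4)[OF k' y5l] by (simp add: y6_def G_def)
  have nG: "near (q\<^sup>2) G (\<pi> ^ 4 / \<kappa>' ^ 5 * (1 + \<pi> / \<kappa>'))"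
  proof -
    have b: "v (\<kappa>' / \<pi>) = 1 / q" using k' by (simp add: abs_divide)
    have "1 / \<pi> - R \<kappa>' (\<kappa>' / \<pi>) = slope \<kappa>' y6 (\<kappa>' / \<pi>) * (- \<kappa>' * G)"
      using R_diff[OF big_region(2)[OF vy5(2)] big_region(2)[OF b], of \<kappa>'] y7 y6G
      by (simp add: y7_def g_def)
    moreover have "near (q\<^sup>2) (slope \<kappa>' y6 (\<kappa>' / \<pi>) * (- \<kappa>' * G)) (- \<kappa>' * (- \<kappa>' * G))"
      by (intro near_intros near_slope_big vy5 b)
    ultimately have "near (q\<^sup>2) (- \<kappa>' * (- \<kappa>' * G)) (1 / \<pi> - R \<kappa>' (\<kappa>' / \<pi>))"
      using near_sym[OF _ q2_bounds(2)] by simp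
    then have "near (q\<^sup>2) (- \<kappa>' * (- \<kappa>' * G)) (\<pi> ^ 4 / \<kappa>' ^ 3 * (1 + \<pi> / \<kappa>'))"
      using near_trans[OF _ critical_offset[OF c k0'] q2_bounds(2)] by blast
    then have "near (q\<^sup>2) (- \<kappa>' * (- \<kappa>' * G) / \<kappa>'\<^sup>2) (\<pi> ^ 4 / \<kappa>' ^ 3 * (1 + \<pi> / \<kappa>') / \<kappa>'\<^sup>2)"
      by (rule near_divide[OF _ near_refl[OF q2_bounds(1)] q2_bounds])
    moreover have "- \<kappa>' * (- \<kappa>' * G) / \<kappa>'\<^sup>2 = G"
      using k'0 by (simp add: power2_eq_square)
    moreover have "\<pi> ^ 4 / \<kappa>' ^ 3 * (1 + \<pi> / \<kappa>') / \<kappa>'\<^sup>2 = \<pi> ^ 4 / \<kappa>' ^ 5 * (1 + \<pi> / \<kappa>')"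
      by (simp add: power_eq_if)
    ultimately show ?thesis by simp
  qed
  have sl5: "near (q\<^sup>2) (slope \<kappa> x5 y5) (- \<kappa> * (G * (1 + \<pi>)))"
  proof -
    have num: "near (q\<^sup>2) (1 + x5 * y5 - \<pi> * (x5 + y5)) (y5\<^sup>2 - 1)"
    proof -
      have a: "v (2 - 2 * (\<pi> * y5)) \<le> q ^ 6"
        using two_le[of 6] vy5 pi_small
        by (intro diff_le) (auto simp: mult intro: order_trans[OF mult_left_le])
      have b: "v ((x5 - y5) * (y5 - \<pi>)) \<le> q ^ 6"
        using xy5 lt15[of 6] unit_region(1)[OF vy5(1)] by (simp add: mult)
      have "1 + x5 * y5 - \<pi> * (x5 + y5) - (y5\<^sup>2 - 1) = (2 - 2 * (\<pi> * y5)) + (x5 - y5) * (y5 - \<pi>)"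
        by (simp add: algebra_simps power2_eq_square)
      then have "v (1 + x5 * y5 - \<pi> * (x5 + y5) - (y5\<^sup>2 - 1)) \<le> q ^ 6"
        using add_le[OF a b] by (simp only:)
      then show ?thesis
        unfolding near_def y5sq by (simp add: power_add[symmetric])
    qed
    have den: "near (q\<^sup>2) (x5 - \<pi>) (y5 - \<pi>)"
      using xy5 lt15[of 2] unit_region(1)[OF vy5(1)] by (simp add: near_def)
    have nn: "near (q\<^sup>2) ((y5 - \<pi>) * (1 + \<pi>)) 1"
    proof -
      have a: "v ((y5 - 1) * (1 + \<pi>)) \<le> q\<^sup>2"
        using y5q add_dominant[of \<pi> 1] pi_small by (simp add: mult)
      have b: "v (\<pi> ^ 2) \<le> q\<^sup>2" by (simp add: abs_power)
      have "(y5 - \<pi>) * (1 + \<pi>) - 1 = (y5 - 1) * (1 + \<pi>) - \<pi> ^ 2"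
        by (simp add: algebra_simps power2_eq_square)
      then show ?thesis using diff_le[OF a b] by (simp add: near_def)
    qed
    have "near (q\<^sup>2) ((y5 - \<pi>) * (1 + \<pi>) / (y5 - \<pi>)) (1 / (y5 - \<pi>))"
      by (intro near_intros nn)
    then have n1: "near (q\<^sup>2) (1 / (y5 - \<pi>)) (1 + \<pi>)"
      using unit_region(2)[OF vy5(1)] near_sym[OF _ q2_bounds(2)] by simp
    have "near (q\<^sup>2) (- \<kappa> * (1 + x5 * y5 - \<pi> * (x5 + y5)) / ((x5 - \<pi>) * (y5 - \<pi>)))
        (- \<kappa> * (y5\<^sup>2 - 1) / ((y5 - \<pi>) * (y5 - \<pi>)))"
      by (intro near_intros num den)
    moreover have "- \<kappa> * (y5\<^sup>2 - 1) / ((y5 - \<pi>) * (y5 - \<pi>)) = - \<kappa> * (G * (1 / (y5 - \<pi>)))"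
      by (simp add: G_def)
    moreover have "near (q\<^sup>2) (- \<kappa> * (G * (1 / (y5 - \<pi>)))) (- \<kappa> * (G * (1 + \<pi>)))"
      by (intro near_intros n1)
    ultimately show ?thesis
      unfolding slope_def using near_trans[OF _ _ q2_bounds(2)] by simp
  qed
  define E where "E = slope \<kappa> x5 y5 * e5"
  have nkk: "near (q\<^sup>2) \<kappa> \<kappa>'"
    using t k' q_power_mono[of 2 20] by (simp add: near_def)
  have E: "near (q\<^sup>2) (\<kappa> * E) (g * ((1 + \<pi>) * (1 + \<pi> / \<kappa>')))"
  proof -
    have "near (q\<^sup>2) (\<kappa> * E) (\<kappa>' * (- \<kappa>' * (\<pi> ^ 4 / \<kappa>' ^ 5 * (1 + \<pi> / \<kappa>') * (1 + \<pi>)) * (- (\<kappa>' ^ 3 / \<pi> ^ 5))))"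
    proof -
      have "near (q\<^sup>2) (- \<kappa> * (G * (1 + \<pi>))) (- \<kappa>' * (\<pi> ^ 4 / \<kappa>' ^ 5 * (1 + \<pi> / \<kappa>') * (1 + \<pi>)))"
        by (intro near_intros nkk nG)
      then have a: "near (q\<^sup>2) (slope \<kappa> x5 y5) (- \<kappa>' * (\<pi> ^ 4 / \<kappa>' ^ 5 * (1 + \<pi> / \<kappa>') * (1 + \<pi>)))"
        by (rule near_trans[OF sl5 _ q2_bounds(2)])
      have "near (q\<^sup>2) (- (\<kappa> ^ 3 / \<pi> ^ 5)) (- (\<kappa>' ^ 3 / \<pi> ^ 5))"
        by (intro near_intros nkk)
      then have b: "near (q\<^sup>2) e5 (- (\<kappa>' ^ 3 / \<pi> ^ 5))"
        by (rule near_trans[OF ne5 _ q2_bounds(2)])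
      show ?thesis
        unfolding E_def by (intro near_intros nkk a b)
    qed
    also have "\<kappa>' * (- \<kappa>' * (\<pi> ^ 4 / \<kappa>' ^ 5 * (1 + \<pi> / \<kappa>') * (1 + \<pi>)) * (- (\<kappa>' ^ 3 / \<pi> ^ 5)))
        = (\<kappa>' ^ 5 / \<kappa>' ^ 5) * (\<pi> ^ 4 / \<pi> ^ 5) * ((1 + \<pi>) * (1 + \<pi> / \<kappa>'))"
      by (simp add: power_eq_if)
    also have "\<dots> = g * ((1 + \<pi>) * (1 + \<pi> / \<kappa>'))"
      using k'0 by (simp add: g_def power_eq_if)
    finally show ?thesis .
  qed
  have u1: "v ((1 + \<pi>) * (1 + \<pi> / \<kappa>')) = 1"
    using add_dominant[of \<pi> 1] add_dominant[of "\<pi> / \<kappa>'" 1] k' pi_small by (simp add: abs_simps)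
  have E': "v (\<kappa> * E - g * ((1 + \<pi>) * (1 + \<pi> / \<kappa>'))) \<le> q"
    using E u1 g unfolding near_def mult[of g] by simp
  have vE: "v E = 1 / q"
    using near_abs[OF E q2_bounds(2)] u1 g k unfolding mult[of g] mult[of \<kappa>] by simp
  define e6 where "e6 = E + y6 / \<kappa>'"
  define x6 where "x6 = R \<kappa> x5"
  have e6: "x6 - y6 = t * e6"
    unfolding x6_def e6_def y6_def E_def
    using unit_region(2)[OF x5] unit_region(2)[OF vy5(1)] by (intro increment_step e5 t k'0)
  have ve6: "v e6 \<le> 1 / q"
    unfolding e6_def using vE vy5 k' by (intro add_le) (auto simp: abs_divide)
  have xy6: "v (x6 - y6) \<le> q ^ 15"
    using te[of e6] ve6 inv[of 1 5] e6 by simp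
  have x6: "v x6 = 1 / q"
    using close_imp_eq[of x6 y6] le_less_trans[OF xy6 lt] vy5 by simp

  define e7 where "e7 = slope \<kappa> x6 y6 * e6 + y7 / \<kappa>'"
  define x7 where "x7 = R \<kappa> x6"
  have e7: "x7 - y7 = t * e7"
    unfolding x7_def e7_def y7_def
    using big_region(2)[OF x6] big_region(2)[OF vy5(2)] by (intro increment_step e6 t k'0)
  have ve7: "v e7 = 1"
  proof -
    have "v (slope \<kappa> x6 y6 - - \<kappa>) \<le> q\<^sup>2"
      using near_slope_big[OF x6 vy5(2), of \<kappa>] k by (simp add: near_def)
    then have "v (slope \<kappa> x6 y6 - - \<kappa>) * v e6 \<le> q\<^sup>2 * (1 / q)"
      using ve6 by (intro mult_mono) auto
    then have a: "v ((slope \<kappa> x6 y6 + \<kappa>) * e6) \<le> q"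
      by (simp add: mult power2_eq_square)
    have b: "v (\<kappa> * G) \<le> q"
      using G k q_power_mono[of 1 4] by (simp add: mult)
    have d: "v (\<pi> / \<kappa>') \<le> q"
      using k' by (simp add: abs_divide)
    have "y6 = \<kappa>' * (g - G)"
      using y6G by (simp add: g_def algebra_simps)
    then have y6k: "y6 / \<kappa>' = g - G"
      using k'0 by simp
    have gp: "g * ((1 + \<pi>) * (1 + \<pi> / \<kappa>')) = g + 1 + 1 / \<kappa>' + \<pi> / \<kappa>'"
      by (simp add: g_def algebra_simps add_divide_distrib)
    have "e7 + (1 + 1 / \<kappa>') = (slope \<kappa> x6 y6 + \<kappa>) * e6 - (\<kappa> * E - g * ((1 + \<pi>) * (1 + \<pi> / \<kappa>')))
        + \<kappa> * G + g * (1 / \<kappa>' - \<kappa> - 1) - \<pi> / \<kappa>'"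
      unfolding gp e7_def e6_def y7 y6k by (simp add: algebra_simps)
    moreover have "v ((slope \<kappa> x6 y6 + \<kappa>) * e6 - (\<kappa> * E - g * ((1 + \<pi>) * (1 + \<pi> / \<kappa>')))
        + \<kappa> * G + g * (1 / \<kappa>' - \<kappa> - 1) - \<pi> / \<kappa>') \<le> q"
      by (intro diff_le add_le a b d gkk E')
    ultimately have f: "v (e7 + (1 + 1 / \<kappa>')) \<le> q"
      by simp
    have "v (1 - \<kappa>' + 2 * \<kappa>') = 1"
      using one_minus_parameter[OF k' k2'] two_small k' q_power_strict_mono[of 0 20]
        add_dominant[of "2 * \<kappa>'" "1 - \<kappa>'"] by (simp add: mult)
    moreover have "1 - \<kappa>' + 2 * \<kappa>' = (1 + 1 / \<kappa>') * \<kappa>'"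
      using k'0 by (simp add: algebra_simps)
    ultimately have "v (1 + 1 / \<kappa>') = 1"
      using k' by (simp only: mult mult_1_right)
    then show ?thesis
      using diff_dominant'[of "e7 + (1 + 1 / \<kappa>')" "1 + 1 / \<kappa>'"] f pi_small by simp
  qed
  have xy7: "v (x7 - y7) \<le> q ^ 15"
    using te[of e7] ve7 inv[of 0 5] e7 by simp
  have x7: "v x7 = 1 / q"
    using close_imp_eq[of x7 y7] le_less_trans[OF xy7 lt] vy5 by simp
  have "R \<kappa> x7 - R \<kappa>' y7 = t * (slope \<kappa> x7 y7 * e7 + R \<kappa>' y7 / \<kappa>')"
    using big_region(2)[OF x7] big_region(2)[OF vy5(3)] by (intro increment_step e7 t k'0)
  then have "v (R \<kappa> x7) = v t"
    using y8 slope_big[OF x7 vy5(3) k] ve7 by (simp add: mult)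
  then show ?thesis
    by (simp add: iterate_8 iterate_5 iterate_3 x1_def x2_def x3_def x4_def x5_def x6_def x7_def)
qed

section \<open>Prescribed itineraries\<close>

text \<open>The orbits of interest meet three regions: the disk around the critical point \<open>1\<close>, the sphere
  through \<open>1 / \<pi>\<close>, and the linearisation disk of the repelling fixed point \<open>0\<close>. The rate is the
  factor by which distances close to \<open>x\<close> are scaled.\<close>

definition rate :: "'k \<Rightarrow> real" where
  "rate x = (if v (x - 1) < 1 then (v (x - 1))\<^sup>2 else if v x < q then 1 / q\<^sup>2 else 1)"

text \<open>The last condition excludes that the step from the sphere through \<open>1 / \<pi>\<close> leads directly back
  to the unit sphere. So a ball around such a point that is mapped onto a ball of radius at most
  \<open>1\<close> has itself radius less than \<open>1\<close> when the unit sphere is reached later.\<close>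

definition in_zone :: "'k \<Rightarrow> 'k \<Rightarrow> bool" where
  "in_zone \<kappa> x \<longleftrightarrow> q ^ 4 \<le> v (x - 1) \<and> v (x - 1) < 1 \<or> v x < q \<or> v x = 1 / q \<and> v (R \<kappa> x) \<noteq> 1"

definition growth :: "'k \<Rightarrow> 'k \<Rightarrow> nat \<Rightarrow> real" where
  "growth \<kappa> x n = (\<Prod>j<n. rate ((R \<kappa> ^^ j) x))"

definition tame :: "real \<Rightarrow> 'k \<Rightarrow> 'k \<Rightarrow> nat \<Rightarrow> bool" where
  "tame K \<kappa> x n \<longleftrightarrow> (\<forall>i<n. in_zone \<kappa> ((R \<kappa> ^^ i) x)) \<and> (\<forall>i\<le>n. growth \<kappa> x i \<le> K)"

lemma rate_nonneg: "0 \<le> rate x"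
  by (simp add: rate_def)

lemma growth_nonneg: "0 \<le> growth \<kappa> x n"
  unfolding growth_def by (intro prod_nonneg ballI rate_nonneg)

lemma growth_0 [simp]: "growth \<kappa> x 0 = 1"
  by (simp add: growth_def)

lemma growth_Suc: "growth \<kappa> x (Suc n) = growth \<kappa> x n * rate ((R \<kappa> ^^ n) x)"
  by (simp add: growth_def)

lemma growth_add: "growth \<kappa> x (m + n) = growth \<kappa> x m * growth \<kappa> ((R \<kappa> ^^ m) x) n"
proof (induction n)
  case (Suc n)
  have "(R \<kappa> ^^ (m + n)) x = (R \<kappa> ^^ n) ((R \<kappa> ^^ m) x)"
    by (metis add.commute funpow_add comp_apply)
  with Suc show ?case
    by (simp add: growth_Suc)
qed simp

lemma tame_append:
  assumes "tame K \<kappa> x m" "tame M \<kappa> ((R \<kappa> ^^ m) x) n" "growth \<kappa> x m * M \<le> K"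
  shows "tame K \<kappa> x (m + n)"
  unfolding tame_def
proof (intro conjI allI impI)
  have shift: "(R \<kappa> ^^ i) x = (R \<kappa> ^^ (i - m)) ((R \<kappa> ^^ m) x)" if "m \<le> i" for i
    using that by (metis funpow_add comp_apply le_add_diff_inverse2)
  show "in_zone \<kappa> ((R \<kappa> ^^ i) x)" if "i < m + n" for i
    using assms(1,2) that shift[of i] unfolding tame_def by (cases "i < m") auto
  show "growth \<kappa> x i \<le> K" if "i \<le> m + n" for i
  proof (cases "i \<le> m")
    case False
    then have "growth \<kappa> x i = growth \<kappa> x m * growth \<kappa> ((R \<kappa> ^^ m) x) (i - m)"
      using growth_add[of \<kappa> x m "i - m"] by simp
    also have "\<dots> \<le> growth \<kappa> x m * M"
      using assms(2) that False unfolding tame_def by (intro mult_left_mono growth_nonneg) auto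
    finally show ?thesis using assms(3) by linarith
  qed (use assms(1) in \<open>auto simp: tame_def\<close>)
qed

lemma rate_critical: "v (x - 1) < 1 \<Longrightarrow> rate x = (v (x - 1))\<^sup>2"
  by (simp add: rate_def)

lemma rate_big: "v x = 1 / q \<Longrightarrow> rate x = 1"
  using diff_dominant[of 1 x] one_less_inverse q_less_inverse by (simp add: rate_def)

lemma rate_small: "v x < q \<Longrightarrow> rate x = 1 / q\<^sup>2"
  using diff_dominant'[of x 1] pi_small by (simp add: rate_def)

lemma all_less_5: "(\<forall>i<(5::nat). P i) \<longleftrightarrow> P 0 \<and> P 1 \<and> P 2 \<and> P 3 \<and> P 4"
  by (simp add: numeral_eq_Suc All_less_Suc conj_ac)

lemma all_le_5: "(\<forall>i\<le>(5::nat). P i) \<longleftrightarrow> P 0 \<and> P 1 \<and> P 2 \<and> P 3 \<and> P 4 \<and> P 5"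
  unfolding less_Suc_eq_le[symmetric] by (simp add: numeral_eq_Suc All_less_Suc conj_ac)

lemma all_less_3: "(\<forall>i<(3::nat). P i) \<longleftrightarrow> P 0 \<and> P 1 \<and> P 2"
  by (simp add: numeral_eq_Suc All_less_Suc conj_ac)

lemma all_le_3: "(\<forall>i\<le>(3::nat). P i) \<longleftrightarrow> P 0 \<and> P 1 \<and> P 2 \<and> P 3"
  unfolding less_Suc_eq_le[symmetric] by (simp add: numeral_eq_Suc All_less_Suc conj_ac)

lemma tame_turn:
  assumes adm: "admissible \<kappa>" and x: "q ^ 4 \<le> v (x - 1)" "v (x - 1) \<le> q\<^sup>2"
  shows "tame 1 \<kappa> x 3" "growth \<kappa> x 3 \<le> 1"
proof -
  have xq: "v (x - 1) < q" using x(2) q_power_strict_mono[of 1 2] by simp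
  then have x1: "v (x - 1) < 1" using pi_small by linarith
  note t = turn_at_critical[OF adm xq]
  have r0: "rate x \<le> 1" using x1 by (simp add: rate_critical power_le_one)
  have g: "growth \<kappa> x 0 = 1" "growth \<kappa> x 1 = rate x" "growth \<kappa> x 2 = rate x" "growth \<kappa> x 3 = rate x"
    using rate_big[OF t(2)] rate_big[OF t(3)] by (simp_all add: growth_def eval_nat_numeral)
  show "growth \<kappa> x 3 \<le> 1" using g r0 by simp
  show "tame 1 \<kappa> x 3"
    unfolding tame_def all_less_3 all_le_3 g iterate_2
    using r0 t x x1 pi_small q_less_1 by (auto simp: in_zone_def)
qed

lemma tame_slow_cycle:
  assumes adm: "admissible \<kappa>" and x: "q ^ 4 \<le> v (x - 1)" "v (x - 1) \<le> q ^ 3"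
  shows "tame 1 \<kappa> x 5" "growth \<kappa> x 5 \<le> q\<^sup>2"
proof -
  have xq: "v (x - 1) < q" using x(2) q_power_strict_mono[of 1 3] by simp
  then have x1: "v (x - 1) < 1" using pi_small by linarith
  have "v (x\<^sup>2 - 1) \<le> (q ^ 3)\<^sup>2"
    using x q_power_mono[of 3 20] by (intro abs_square_minus_1_le) auto
  also have "\<dots> < q ^ 3"
    using q_power_strict_mono[of 3 6] by (simp flip: power_mult)
  finally have T: "v (x\<^sup>2 - 1) < q ^ 3" .
  note t = turn_at_critical[OF adm xq] slow_cycle(1)[OF adm xq T]
  have "rate x \<le> (q ^ 3)\<^sup>2"
    unfolding rate_critical[OF x1] using x by (intro power_mono) auto
  then have r: "rate x \<le> q ^ 6" by (simp flip: power_mult)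
  have r0: "rate x \<le> 1" using r q_power_mono[of 0 6] by simp
  have r3: "rate x * (1 / q\<^sup>2) \<le> q ^ 4"
    using mult_right_mono[OF r, of "1 / q\<^sup>2"] by (simp add: power_eq_if)
  have r4: "rate x * (1 / q\<^sup>2) * (1 / q\<^sup>2) \<le> q\<^sup>2"
    using mult_right_mono[OF r3, of "1 / q\<^sup>2"] by (simp add: power_eq_if)
  have g: "growth \<kappa> x 0 = 1" "growth \<kappa> x 1 = rate x" "growth \<kappa> x 2 = rate x" "growth \<kappa> x 3 = rate x"
    "growth \<kappa> x 4 = rate x * (1 / q\<^sup>2)" "growth \<kappa> x 5 = rate x * (1 / q\<^sup>2) * (1 / q\<^sup>2)"
    using rate_big[OF t(2)] rate_big[OF t(3)] rate_small[OF t(5)] rate_small[OF t(6)]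
    by (simp_all add: growth_def eval_nat_numeral)
  show "growth \<kappa> x 5 \<le> q\<^sup>2" using g r4 by simp
  have le1: "q ^ i \<le> 1" for i using q_power_mono[of 0 i] by simp
  have r3': "rate x * (1 / q\<^sup>2) \<le> 1" and r4': "rate x * (1 / q\<^sup>2) * (1 / q\<^sup>2) \<le> 1"
    using r3 r4 le1[of 4] le1[of 2] by linarith+
  show "tame 1 \<kappa> x 5"
    unfolding tame_def all_less_5 all_le_5 g iterate_2 iterate_3 iterate_4
    using r0 r3' r4' t x x1 pi_small q_less_1 by (auto simp: in_zone_def)
qed

lemma tame_slow_orbit:
  assumes adm: "admissible \<kappa>"
    and x: "\<And>i. i < l \<Longrightarrow> q ^ 4 \<le> v ((R \<kappa> ^^ (5 * i)) x - 1) \<and> v ((R \<kappa> ^^ (5 * i)) x - 1) \<le> q ^ 3"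
  shows "tame 1 \<kappa> x (5 * l) \<and> growth \<kappa> x (5 * l) \<le> q ^ (2 * l)"
  using x
proof (induction l)
  case 0
  show ?case by (simp add: tame_def)
next
  case (Suc l)
  then have IH: "tame 1 \<kappa> x (5 * l)" "growth \<kappa> x (5 * l) \<le> q ^ (2 * l)"
    by auto
  define y where "y = (R \<kappa> ^^ (5 * l)) x"
  have y: "tame 1 \<kappa> y 5" "growth \<kappa> y 5 \<le> q\<^sup>2"
    using Suc.prems[of l] tame_slow_cycle[OF adm] by (auto simp: y_def)
  have "growth \<kappa> x (5 * l) * 1 \<le> 1"
    using IH(2) q_power_mono[of 0 "2 * l"] by simp
  then have "tame 1 \<kappa> x (5 * l + 5)"
    using tame_append[OF IH(1), of 1 5] y by (simp add: y_def)
  moreover have "growth \<kappa> x (5 * l) * growth \<kappa> y 5 \<le> q ^ (2 * l) * q\<^sup>2"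
    using IH y growth_nonneg by (intro mult_mono) auto
  then have "growth \<kappa> x (5 * l + 5) \<le> q ^ (2 * l + 2)"
    unfolding growth_add power_add y_def by simp
  ultimately show ?case
    by (simp add: add.commute)
qed

lemma tame_small:
  assumes "v \<kappa> = 1" "v x < q ^ (2 * n - 1)"
  shows "tame (1 / q ^ (2 * n)) \<kappa> x n"
proof -
  have small: "v ((R \<kappa> ^^ i) x) < q" if "i < n" for i
    using R_iterate_small(2)[OF assms, of i] that by simp
  have g: "growth \<kappa> x i = 1 / q ^ (2 * i)" if "i \<le> n" for i
    using that
  proof (induction i)
    case (Suc i)
    then show ?case
      using rate_small[OF small[of i]] by (simp add: growth_Suc power2_eq_square)
  qed simp
  have "1 / q ^ (2 * i) \<le> 1 / q ^ (2 * n)" if "i \<le> n" for i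
    using q_power_mono[of "2 * i" "2 * n"] that by (intro divide_left_mono) auto
  then show ?thesis
    using small g by (auto simp: tame_def in_zone_def)
qed

text \<open>Here \<open>h\<close> is the position of an orbit as a function of the parameter, and \<open>c\<close> a parameter for
  which it has landed on the repelling fixed point. The values of \<open>h\<close> near \<open>c\<close> fill a small disk
  around \<open>0\<close>, which the expansion at \<open>0\<close> blows up to the unit disk.\<close>

lemma blow_up:
  assumes h: "rational_on (closed_disk c d) h" and hc: "h c = 0"
    and z: "z \<in> closed_disk c d" "q ^ (2 * n - 1) \<le> v (h z)" and n: "n \<ge> 1"
    and unit: "\<And>\<kappa>. \<kappa> \<in> closed_disk c d \<Longrightarrow> v \<kappa> = 1"
  obtains r where "0 < r" "r \<le> d" "\<And>\<kappa>. \<kappa> \<in> open_disk c r \<Longrightarrow> v (h \<kappa>) < q ^ (2 * n - 1)"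
    "rational_on (open_disk c r) (\<lambda>\<kappa>. (R \<kappa> ^^ n) (h \<kappa>))"
    "\<And>w. v w \<le> 1 \<Longrightarrow> \<exists>\<kappa>\<in>open_disk c r. (R \<kappa> ^^ n) (h \<kappa>) = w"
proof -
  define w1 where "w1 = \<pi> ^ (2 * n - 1)"
  have w1: "v w1 = q ^ (2 * n - 1)" "w1 \<noteq> h c"
    by (simp_all add: w1_def abs_power hc)
  have "\<exists>y\<in>closed_disk c d. h y = w1"
    using z w1 hc by (intro rational_covers_closed_disk[OF h z(1)]) simp
  then obtain z1 where z1: "z1 \<in> closed_disk c d" "h z1 = w1"
    by blast
  obtain r where r: "0 < r" "r \<le> d"
    "\<And>y. y \<in> open_disk c r \<Longrightarrow> v (h y - h c) < v (w1 - h c)"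
    "\<And>w'. v (w' - h c) < v (w1 - h c) \<Longrightarrow> \<exists>y\<in>open_disk c r. h y = w'"
    using rational_disk_onto_disk[OF h z1 w1(2)] by metis
  have unit': "v \<kappa> = 1" if "\<kappa> \<in> open_disk c r" for \<kappa>
    using unit[of \<kappa>] that r(2) by auto
  have lt: "v (h \<kappa>) < q ^ (2 * n - 1)" if "\<kappa> \<in> open_disk c r" for \<kappa>
    using r(3)[OF that] by (simp add: hc w1)
  have rat: "rational_on (open_disk c r) (\<lambda>\<kappa>. (R \<kappa> ^^ n) (h \<kappa>))"
  proof (rule rational_on_R_iterate)
    show "rational_on (open_disk c r) h"
      using r(2) by (intro rational_on_subset[OF h]) auto
    show "(R \<kappa> ^^ i) (h \<kappa>) \<noteq> \<pi>" if "\<kappa> \<in> open_disk c r" "i < n" for \<kappa> i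
      using R_iterate_small(2)[OF unit'[OF that(1)] lt[OF that(1)], of i] that(2) by auto
  qed
  have "v (\<pi> ^ (2 * n) - h c) < v (w1 - h c)"
    using q_power_strict_mono[of "2 * n - 1" "2 * n"] n by (simp add: hc w1 abs_power)
  then obtain z2 where z2: "z2 \<in> open_disk c r" "h z2 = \<pi> ^ (2 * n)"
    using r(4) by blast
  have onto: "\<exists>\<kappa>\<in>open_disk c r. (R \<kappa> ^^ n) (h \<kappa>) = w" if "v w \<le> 1" for w
  proof -
    have sub: "closed_disk c (v (z2 - c)) \<subseteq> open_disk c r"
      using z2 by auto
    have "v ((R z2 ^^ n) (h z2)) = 1"
      using R_iterate_small(1)[OF unit'[OF z2(1)] lt[OF z2(1)], of n] z2(2) by (simp add: abs_power)
    then have "\<exists>y\<in>closed_disk c (v (z2 - c)). (R y ^^ n) (h y) = w"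
      using that hc
      by (intro rational_covers_closed_disk[where z = z2] rational_on_subset[OF rat sub]) auto
    then show ?thesis using sub by blast
  qed
  show ?thesis
    using that[OF r(1,2) lt rat onto] by blast
qed

text \<open>Along slow cycles the dependence on earlier positions is contracted away, and only the direct
  effect of the parameter during a single cycle remains.\<close>

lemma param_cycle:
  assumes adm: "admissible \<kappa>" and adm': "admissible \<kappa>'" and t: "v (\<kappa> - \<kappa>') \<le> \<delta>"
    and y: "q ^ 4 \<le> v (y - 1)" "v (y - 1) \<le> q ^ 3" and d: "v (x - y) \<le> d" "d \<le> q ^ 10"
  shows "v ((R \<kappa> ^^ 5) x - (R \<kappa>' ^^ 5) y) \<le> max (\<delta> / q ^ 5) (q\<^sup>2 * d)"
proof -
  have k: "v \<kappa> = 1" and k': "v \<kappa>' = 1"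
    using adm adm' by (auto simp: admissible_def)
  have d0: "0 \<le> d" "0 \<le> \<delta>" using d t by (meson nonneg order_trans)+
  have lt: "q ^ 10 < q ^ 4" by (rule q_power_strict_mono) simp
  have x: "v (x - 1) = v (y - 1)"
    using add_dominant[of "x - y" "y - 1"] d y lt by simp
  have conds: "v (u - 1) < q" "v (u\<^sup>2 - 1) < q ^ 3" if "v (u - 1) \<le> q ^ 3" for u
  proof -
    show "v (u - 1) < q" using that q_power_strict_mono[of 1 3] by simp
    have "v (u\<^sup>2 - 1) \<le> (q ^ 3)\<^sup>2"
      using that q_power_mono[of 3 20] by (intro abs_square_minus_1_le) auto
    then show "v (u\<^sup>2 - 1) < q ^ 3"
      using q_power_strict_mono[of 3 6] by (simp flip: power_mult)
  qed
  have cy: "v (y - 1) < q" "v (y\<^sup>2 - 1) < q ^ 3" and cx: "v (x - 1) < q" "v (x\<^sup>2 - 1) < q ^ 3"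
    using conds[of y] conds[of x] x y by auto
  note sx = turn_at_critical[OF adm cx(1)] slow_cycle(1)[OF adm cx]
  note sy = turn_at_critical[OF adm' cy(1)] slow_cycle(1)[OF adm' cy]
  define D where "D = max (\<delta> / q ^ 5) (q\<^sup>2 * d)"
  have D: "\<delta> / q ^ 5 \<le> D" "q\<^sup>2 * d \<le> D" by (simp_all add: D_def)
  have D1: "\<delta> \<le> q ^ 5 * D"
    using D(1) by (simp add: divide_le_eq mult.commute)
  have D0: "0 \<le> D" using D(2) d0 by (meson mult_nonneg_nonneg order_trans zero_le_power2)
  have tq: "v (\<kappa> - \<kappa>') * s \<le> q ^ i * D" if "s * q ^ 5 \<le> q ^ i" "0 \<le> s" for s i
  proof -
    have "v (\<kappa> - \<kappa>') * s \<le> (q ^ 5 * D) * s"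
      using t D1 that by (intro mult_right_mono) auto
    also have "\<dots> = (s * q ^ 5) * D" by simp
    also have "\<dots> \<le> q ^ i * D" using that D0 by (intro mult_right_mono) auto
    finally show ?thesis .
  qed
  have q54: "1 / q * q ^ 5 \<le> q ^ 4" by (simp add: power_eq_if)
  define x1 where "x1 = R \<kappa> x"
  define y1 where "y1 = R \<kappa>' y"
  define x2 where "x2 = R \<kappa> x1"
  define y2 where "y2 = R \<kappa>' y1"
  define x3 where "x3 = R \<kappa> x2"
  define y3 where "y3 = R \<kappa>' y2"
  define x4 where "x4 = R \<kappa> x3"
  define y4 where "y4 = R \<kappa>' y3"
  have vx: "v x = 1" "v x1 = 1 / q" "v x2 = 1 / q" "v x3 < q" "v x4 < q"
    using sx by (simp_all add: x1_def x2_def x3_def x4_def)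
  have vy: "v y = 1" "v y1 = 1 / q" "v y2 = 1 / q" "v y3 < q" "v y4 < q"
    using sy by (simp_all add: y1_def y2_def y3_def y4_def)
  have sl: "v (slope \<kappa> x y) \<le> q ^ 6"
  proof -
    have "(v (y - 1))\<^sup>2 \<le> (q ^ 3)\<^sup>2" using y by (intro power_mono) auto
    then have "v ((y - 1)\<^sup>2) \<le> q ^ 6" by (simp add: abs_power flip: power_mult)
    moreover have "v (2 * (y * (1 - \<pi>))) \<le> q ^ 6"
      using two_le[of 6] vy diff_dominant[of \<pi> 1] pi_small by (simp add: mult)
    moreover have "v ((x - y) * (y - \<pi>)) \<le> q ^ 6"
      using d q_power_mono[of 6 10] unit_region(1)[OF vy(1)] by (simp add: mult)
    ultimately have "v ((y - 1)\<^sup>2 + 2 * (y * (1 - \<pi>)) + (x - y) * (y - \<pi>)) \<le> q ^ 6"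
      by (intro add_le)
    then show ?thesis
      unfolding slope_unit[OF vx(1) vy(1) k] using slope_numerator[of y x]
      by (simp add: mult.commute add.commute)
  qed
  have 1: "v (x1 - y1) \<le> q ^ 4 * D"
    unfolding x1_def y1_def
  proof (rule R_diff_param_le[OF unit_region(2)[OF vx(1)] unit_region(2)[OF vy(1)] k'])
    have "v (slope \<kappa> x y) * v (x - y) \<le> q ^ 6 * d"
      using sl d by (intro mult_mono) auto
    also have "\<dots> = q ^ 4 * (q\<^sup>2 * d)" by (simp add: power_eq_if)
    also have "\<dots> \<le> q ^ 4 * D" using D by (intro mult_left_mono) auto
    finally show "v (slope \<kappa> x y) * v (x - y) \<le> q ^ 4 * D" .
    show "v (\<kappa> - \<kappa>') * v (R \<kappa>' y) \<le> q ^ 4 * D"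
      using vy q54 by (intro tq) (auto simp: y1_def)
  qed
  have 2: "v (x2 - y2) \<le> q ^ 4 * D"
    unfolding x2_def y2_def
  proof (rule R_diff_param_le[OF big_region(2)[OF vx(2)] big_region(2)[OF vy(2)] k'])
    show "v (slope \<kappa> x1 y1) * v (x1 - y1) \<le> q ^ 4 * D"
      using 1 slope_big[OF vx(2) vy(2) k] by simp
    show "v (\<kappa> - \<kappa>') * v (R \<kappa>' y1) \<le> q ^ 4 * D"
      using vy q54 by (intro tq) (auto simp: y2_def)
  qed
  have q5: "s * q ^ 5 \<le> q ^ 4" if "s \<le> 1" "0 \<le> s" for s
  proof -
    have "s * q ^ 5 \<le> 1 * q ^ 5" using that by (intro mult_right_mono) auto
    moreover have "q ^ 5 \<le> q ^ 4" by (rule q_power_mono) simp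
    ultimately show ?thesis by linarith
  qed
  have 3: "v (x3 - y3) \<le> q ^ 4 * D"
    unfolding x3_def y3_def
  proof (rule R_diff_param_le[OF big_region(2)[OF vx(3)] big_region(2)[OF vy(3)] k'])
    show "v (slope \<kappa> x2 y2) * v (x2 - y2) \<le> q ^ 4 * D"
      using 2 slope_big[OF vx(3) vy(3) k] by simp
    show "v (\<kappa> - \<kappa>') * v (R \<kappa>' y2) \<le> q ^ 4 * D"
      using vy pi_small by (intro tq q5) (auto simp: y3_def)
  qed
  have 4: "v (x4 - y4) \<le> q\<^sup>2 * D"
    unfolding x4_def y4_def
  proof (rule R_diff_param_le[OF small_region(2)[OF vx(4)] small_region(2)[OF vy(4)] k'])
    show "v (slope \<kappa> x3 y3) * v (x3 - y3) \<le> q\<^sup>2 * D"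
      using mult_left_mono[OF 3, of "1 / q\<^sup>2"] slope_small[OF vx(4) vy(4) k] by (simp add: power_eq_if)
    have "v (R \<kappa>' y3) * q ^ 5 \<le> q\<^sup>2"
    proof (rule order_trans[OF q5])
      show "v (R \<kappa>' y3) \<le> 1" using vy pi_small by (simp add: y4_def)
      show "q ^ 4 \<le> q\<^sup>2" by (rule q_power_mono) simp
    qed simp
    then show "v (\<kappa> - \<kappa>') * v (R \<kappa>' y3) \<le> q\<^sup>2 * D"
      by (intro tq) auto
  qed
  have 5: "v (R \<kappa> x4 - R \<kappa>' y4) \<le> q ^ 0 * D"
  proof (rule R_diff_param_le[OF small_region(2)[OF vx(5)] small_region(2)[OF vy(5)] k'])
    show "v (slope \<kappa> x4 y4) * v (x4 - y4) \<le> q ^ 0 * D"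
      using mult_left_mono[OF 4, of "1 / q\<^sup>2"] slope_small[OF vx(5) vy(5) k] by simp
    have "v (R \<kappa>' y4) \<le> 1 / q"
      using small_region(4)[OF vy(5) k'] divide_right_mono[of "v y4" q "q\<^sup>2"] vy(5)
      by (simp add: power2_eq_square)
    then have "v (R \<kappa>' y4) * q ^ 5 \<le> 1 / q * q ^ 5"
      by (intro mult_right_mono) auto
    also have "\<dots> \<le> q ^ 0"
      using q54 q_power_mono[of 0 4] by linarith
    finally show "v (\<kappa> - \<kappa>') * v (R \<kappa>' y4) \<le> q ^ 0 * D"
      by (intro tq) auto
  qed
  then show ?thesis
    by (simp add: iterate_5 D_def x1_def y1_def x2_def y2_def x3_def y3_def x4_def y4_def)
qed

lemma param_slow_orbit:
  assumes adm: "admissible \<kappa>" and adm': "admissible \<kappa>'" and t: "v (\<kappa> - \<kappa>') \<le> \<delta>" "\<delta> \<le> q ^ 15"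
    and y: "\<And>i. i < l \<Longrightarrow> q ^ 4 \<le> v ((R \<kappa>' ^^ (5 * i)) y - 1) \<and> v ((R \<kappa>' ^^ (5 * i)) y - 1) \<le> q ^ 3"
    and d: "v (x - y) \<le> d" "d \<le> q ^ 10"
  shows "v ((R \<kappa> ^^ (5 * l)) x - (R \<kappa>' ^^ (5 * l)) y) \<le> max (\<delta> / q ^ 5) (q ^ (2 * l) * d)"
  using y
proof (induction l)
  case 0
  then show ?case using d by simp
next
  case (Suc l)
  define D where "D = max (\<delta> / q ^ 5) (q ^ (2 * l) * d)"
  have d0: "0 \<le> d" "0 \<le> \<delta>" using d t by (meson nonneg order_trans)+
  have "\<delta> / q ^ 5 \<le> q ^ 15 / q ^ 5"
    using t by (intro divide_right_mono) auto
  moreover have "q ^ (2 * l) * d \<le> 1 * d"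
    using q_power_mono[of 0 "2 * l"] d0 by (intro mult_right_mono) auto
  ultimately have D: "D \<le> q ^ 10"
    using d unfolding D_def by (simp add: power_diff[symmetric])
  have "v ((R \<kappa> ^^ (5 * Suc l)) x - (R \<kappa>' ^^ (5 * Suc l)) y) \<le> max (\<delta> / q ^ 5) (q\<^sup>2 * D)"
    unfolding iterate_5_Suc
    using Suc.prems[of l] Suc.IH Suc.prems D by (intro param_cycle adm adm' t) (auto simp: D_def)
  also have "\<dots> \<le> max (\<delta> / q ^ 5) (q ^ (2 * Suc l) * d)"
  proof -
    have a: "q\<^sup>2 * (\<delta> / q ^ 5) \<le> 1 * (\<delta> / q ^ 5)"
      using q2_bounds d0 by (intro mult_right_mono) auto
    have b: "q\<^sup>2 * (q ^ (2 * l) * d) = q ^ (2 * Suc l) * d"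
      by (simp add: power2_eq_square)
    consider "D = \<delta> / q ^ 5" | "D = q ^ (2 * l) * d"
      unfolding D_def by linarith
    then have "q\<^sup>2 * D \<le> max (\<delta> / q ^ 5) (q ^ (2 * Suc l) * d)"
    proof cases
      case 1
      then show ?thesis using a by simp
    next
      case 2
      then show ?thesis using b by (simp only: max.cobounded2)
    qed
    then show ?thesis by simp
  qed
  finally show ?case .
qed

lemma slow_orbit_no_pole:
  assumes adm: "admissible \<kappa>" and x: "v (x - 1) < q ^ 4 * B" and B: "1 \<le> B" "q ^ 3 * B ^ 2 ^ l \<le> 1"
    and i: "i < 5 * l + 3"
  shows "(R \<kappa> ^^ i) x \<noteq> \<pi>"
proof -
  have "q ^ 5 * B ^ 2 ^ l < q ^ 3 * B ^ 2 ^ l"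
    using q_power_strict_mono[of 3 5] B by (intro mult_strict_right_mono) (auto intro: less_le_trans[OF zero_less_one one_le_power])
  then have B5: "q ^ 5 * B ^ 2 ^ l < 1" using B by linarith
  define a where "a = i div 5"
  define b where "b = i mod 5"
  have ab: "i = 5 * a + b" "b < 5" by (simp_all add: a_def b_def)
  have al: "a \<le> l" using ab i by linarith
  define y where "y = (R \<kappa> ^^ (5 * a)) x"
  have y: "v (y - 1) < q ^ 4 * B ^ 2 ^ a"
    unfolding y_def by (rule slow_orbit_le[OF adm x B(1) B5 al])
  have eq: "(R \<kappa> ^^ i) x = (R \<kappa> ^^ b) y"
    unfolding y_def ab by (metis add.commute funpow_add comp_apply)
  have yq: "v (y - 1) < q"
  proof (cases "a = l")
    case True
    have "q * (q ^ 3 * B ^ 2 ^ l) \<le> q * 1" using B by (intro mult_left_mono) auto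
    moreover have "q * (q ^ 3 * B ^ 2 ^ l) = q ^ 4 * B ^ 2 ^ l"
      by (simp only: mult.assoc[symmetric] power_Suc[symmetric]) simp
    ultimately show ?thesis using y True by simp
  next
    case False
    then show ?thesis
      using slow_cycle_conditions(1)[of y "B ^ 2 ^ a"] y power_power_2_bound[OF B(1) B5, of a] al by simp
  qed
  note t = turn_at_critical[OF adm yq]
  show ?thesis
  proof (cases "b < 3")
    case True
    then consider "b = 0" | "b = 1" | "b = 2" by linarith
    then show ?thesis
      using unit_region(2)[OF t(1)] big_region(2)[OF t(2)] big_region(2)[OF t(3)]
      unfolding eq by cases (simp_all add: iterate_2)
  next
    case False
    then have a: "a < l" using i ab by linarith
    have s: "v (R \<kappa> (R \<kappa> (R \<kappa> (R \<kappa> y)))) < q"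
      using slow_cycle_conditions[of y "B ^ 2 ^ a"] y power_power_2_bound[OF B(1) B5 a]
      by (intro slow_cycle(1) adm) auto
    consider "b = 3" | "b = 4" using False ab by linarith
    then show ?thesis
      using small_region(2)[OF t(5)] small_region(2)[OF s]
      unfolding eq by cases (simp_all add: iterate_3 iterate_4)
  qed
qed

text \<open>A stage of the construction of the parameter: up to time \<open>T\<close> the orbit of \<open>x\<close> is under control
  for all parameters of the disk, and what it does next is completely free.\<close>

definition stage :: "'k \<Rightarrow> 'k \<Rightarrow> real \<Rightarrow> 'k \<Rightarrow> real \<Rightarrow> nat \<Rightarrow> bool" where
  "stage \<kappa>0 x K c r T \<longleftrightarrow> 0 < r \<and> open_disk c r \<subseteq> closed_disk \<kappa>0 (q ^ 12) \<and>
     rational_on (open_disk c r) (\<lambda>\<kappa>. (R \<kappa> ^^ T) x) \<and>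
     (\<forall>w. v w \<le> 1 \<longrightarrow> (\<exists>\<kappa>\<in>open_disk c r. (R \<kappa> ^^ T) x = w)) \<and>
     (\<forall>\<kappa>\<in>open_disk c r. tame K \<kappa> x T)"

lemma ex_q_power_less: "0 < e \<Longrightarrow> \<exists>j. q ^ j < e"
  using real_arch_pow_inv[OF _ pi_small] by blast

lemma power_swap: "((x::real) ^ m) ^ n = (x ^ n) ^ m"
  by (metis mult.commute power_mult)

lemma q4_divide: "q ^ 4 * (1 / q) = q ^ 3" "q ^ 4 * (1 / q\<^sup>2) = q\<^sup>2" "q ^ 4 * (1 / q ^ 3) = q"
  "q ^ 4 / q = q ^ 3" "q ^ 4 / q\<^sup>2 = q\<^sup>2" "q ^ 4 / q ^ 3 = q"
  by (simp_all add: power_eq_if)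

lemma funpow_add_apply: "(f ^^ (m + n)) x = (f ^^ n) ((f ^^ m) x)"
  by (metis add.commute funpow_add comp_apply)

text \<open>Take a parameter whose orbit hits the critical point exactly, and the disk around it where the
  distance from \<open>1\<close> stays below \<open>q\<^sup>4 \<mu>\<^sup>3\<close>. After \<open>l\<close> slow cycles and a turn, the orbit of the
  parameter itself is at distance \<open>q\<^sup>4\<close> from \<open>0\<close>; a parameter with initial distance \<open>q\<^sup>4 \<mu>\<^sup>2\<close> has
  moved away from that position by \<open>q\<^sup>4\<close> as well. So the fixed point \<open>0\<close> is among the values that
  have to be taken in between.\<close>

lemma exists_landing:
  assumes c0: "centre \<kappa>0" and sub0: "open_disk c r \<subseteq> closed_disk \<kappa>0 (q ^ 12)"
    and h: "rational_on (open_disk c r) h"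
    and onto: "\<And>w. v w \<le> 1 \<Longrightarrow> \<exists>\<kappa>\<in>open_disk c r. h \<kappa> = w"
    and mu: "1 \<le> \<mu>" "\<mu> = v g" "\<mu> ^ 2 ^ l = 1 / q"
  obtains \<kappa>' where "\<kappa>' \<in> open_disk c r" "(R \<kappa>' ^^ (5 * l + 3)) (h \<kappa>') = 0"
    "v (h \<kappa>' - 1) = q ^ 4 * \<mu>\<^sup>2"
proof -
  have adm: "admissible \<kappa>" if "\<kappa> \<in> open_disk c r" for \<kappa>
    using critical_orbit_perturb(3)[OF c0 _ order_refl, of \<kappa>] sub0 that by auto
  have mu2: "(\<mu>\<^sup>2) ^ 2 ^ l = 1 / q\<^sup>2" and mu3: "(\<mu> ^ 3) ^ 2 ^ l = 1 / q ^ 3"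
    unfolding power_swap[of \<mu> _ "2 ^ l"] mu(3) by (simp_all add: power_one_over)
  have mu1: "1 \<le> \<mu>\<^sup>2" "1 \<le> \<mu> ^ 3" using mu(1) by (simp_all add: one_le_power)
  have b3: "q ^ 5 * (\<mu> ^ 3) ^ 2 ^ l < 1" "q ^ 3 * (\<mu> ^ 3) ^ 2 ^ l \<le> 1"
    unfolding mu3 using q_power_strict_mono[of 3 5] by (simp_all add: divide_less_eq)
  have b2: "q ^ 5 * (\<mu>\<^sup>2) ^ 2 ^ l < 1"
    unfolding mu2 using q_power_strict_mono[of 2 5] by (simp add: divide_less_eq)
  define \<rho>2 where "\<rho>2 = \<pi> ^ 4 * g\<^sup>2"
  define \<rho>3 where "\<rho>3 = \<pi> ^ 4 * g ^ 3"
  have r2: "v \<rho>2 = q ^ 4 * \<mu>\<^sup>2" and r3: "v \<rho>3 = q ^ 4 * \<mu> ^ 3"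
    by (simp_all add: \<rho>2_def \<rho>3_def abs_simps mu(2))
  have "\<mu> ^ 3 \<le> (\<mu> ^ 3) ^ 2 ^ l"
    using mu1 by (intro self_le_power) auto
  then have "q ^ 4 * \<mu> ^ 3 \<le> q ^ 4 * (1 / q ^ 3)"
    unfolding mu3 by (intro mult_left_mono) auto
  then have r3le: "v \<rho>3 \<le> q" by (simp add: r3 q4_divide)
  obtain \<kappa>1 where k1: "\<kappa>1 \<in> open_disk c r" "h \<kappa>1 = 1"
    using onto[of 1] by auto
  have "v (1 + \<rho>3) \<le> 1"
    using r3le pi_small by (intro add_le) auto
  then obtain z3 where z3: "z3 \<in> open_disk c r" "h z3 = 1 + \<rho>3"
    using onto by blast
  define d where "d = v (z3 - \<kappa>1)"
  have sub1: "closed_disk \<kappa>1 d \<subseteq> open_disk c r"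
  proof
    fix z assume "z \<in> closed_disk \<kappa>1 d"
    moreover have "d < r"
      using z3 k1 dist_trans_less[of z3 c r \<kappa>1] by (simp add: d_def minus_commute)
    ultimately show "z \<in> open_disk c r"
      using k1 dist_trans_less[of z \<kappa>1 r c] by auto
  qed
  have ne: "1 + \<rho>3 \<noteq> h \<kappa>1"
  proof -
    have "v \<rho>3 \<noteq> 0" using r3 mu(1) by simp
    then show ?thesis using k1 by auto
  qed
  have z3d: "z3 \<in> closed_disk \<kappa>1 d" by (simp add: d_def)
  obtain r' where r': "0 < r'" "r' \<le> d"
    "\<And>y. y \<in> open_disk \<kappa>1 r' \<Longrightarrow> v (h y - h \<kappa>1) < v (1 + \<rho>3 - h \<kappa>1)"
    "\<And>w'. v (w' - h \<kappa>1) < v (1 + \<rho>3 - h \<kappa>1) \<Longrightarrow> \<exists>y\<in>open_disk \<kappa>1 r'. h y = w'"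
    using rational_disk_onto_disk[OF rational_on_subset[OF h sub1] z3d z3(2) ne] by metis
  have sub2: "open_disk \<kappa>1 r' \<subseteq> open_disk c r"
  proof -
    have "open_disk \<kappa>1 r' \<subseteq> closed_disk \<kappa>1 d" using r'(2) by auto
    then show ?thesis using sub1 by blast
  qed
  have hlt: "v (h \<kappa> - 1) < q ^ 4 * \<mu> ^ 3" if "\<kappa> \<in> open_disk \<kappa>1 r'" for \<kappa>
    using r'(3)[OF that] by (simp add: k1 r3)
  have "v (1 + \<rho>2 - h \<kappa>1) < v (1 + \<rho>3 - h \<kappa>1)"
  proof -
    have "\<mu> > 1"
    proof (rule ccontr)
      assume "\<not> \<mu> > 1"
      then have "\<mu> ^ 2 ^ l \<le> 1" using mu(1) by (simp add: power_le_one)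
      then show False using mu(3) one_less_inverse by simp
    qed
    then have "\<mu>\<^sup>2 < \<mu> ^ 3" by (intro power_strict_increasing) auto
    then show ?thesis by (simp add: k1 r2 r3)
  qed
  then obtain z2 where z2: "z2 \<in> open_disk \<kappa>1 r'" "h z2 = 1 + \<rho>2"
    using r'(4) by blast
  have sub3: "closed_disk \<kappa>1 (v (z2 - \<kappa>1)) \<subseteq> open_disk \<kappa>1 r'"
    using z2 by auto
  define X where "X = (\<lambda>\<kappa>. (R \<kappa> ^^ (5 * l + 3)) (h \<kappa>))"
  define Y where "Y = (\<lambda>\<kappa>. (R \<kappa> ^^ (5 * l)) (h \<kappa>))"
  define C where "C = (\<lambda>\<kappa>. R \<kappa> (R \<kappa> (\<kappa> / \<pi>)))"
  have X: "X \<kappa> = R \<kappa> (R \<kappa> (R \<kappa> (Y \<kappa>)))" for \<kappa>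
    by (simp only: X_def Y_def funpow_add_apply iterate_3)
  have rat: "rational_on (open_disk \<kappa>1 r') X"
    unfolding X_def
  proof (rule rational_on_R_iterate[OF rational_on_subset[OF h sub2]])
    fix \<kappa> i assume "\<kappa> \<in> open_disk \<kappa>1 r'" "i < 5 * l + 3"
    then show "(R \<kappa> ^^ i) (h \<kappa>) \<noteq> \<pi>"
      using sub2 by (intro slow_orbit_no_pole[OF adm hlt mu1(2) b3(2)]) auto
  qed
  have XC: "v (X \<kappa> - C \<kappa>) = v ((Y \<kappa>)\<^sup>2 - 1)" if "\<kappa> \<in> open_disk c r" "v (Y \<kappa> - 1) < q" for \<kappa>
    using turn_at_critical(4)[OF adm[OF that(1)] that(2)] by (simp add: X C_def)
  have vC: "v (C \<kappa>) = q ^ 4" if "\<kappa> \<in> open_disk c r" for \<kappa>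
    using critical_orbit(3)[OF adm[OF that]] by (simp add: C_def)
  have k1A: "\<kappa>1 \<in> open_disk c r" and z2A: "z2 \<in> open_disk c r"
    using k1 z2 sub2 by auto
  have lt: "q ^ i < q ^ j" if "j < i" for i j
    using q_power_strict_mono[OF that] .
  have Y1: "v (Y \<kappa>1 - 1) \<le> q ^ 6"
    using slow_orbit_critical[OF adm[OF k1A], of l] by (simp add: Y_def k1)
  have XC1: "v (X \<kappa>1 - C \<kappa>1) \<le> q ^ 11"
  proof -
    have "v (X \<kappa>1 - C \<kappa>1) = v ((Y \<kappa>1)\<^sup>2 - 1)"
      using Y1 lt[of 1 6] by (intro XC k1A) auto
    also have "\<dots> \<le> (q ^ 6)\<^sup>2"
      using Y1 q_power_mono[of 6 20] by (intro abs_square_minus_1_le) auto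
    also have "\<dots> \<le> q ^ 11"
      using q_power_mono[of 11 12] by (simp flip: power_mult)
    finally show ?thesis .
  qed
  have X1: "v (X \<kappa>1) = q ^ 4"
    using close_imp_eq[of "X \<kappa>1" "C \<kappa>1"] XC1 vC[OF k1A] lt[of 4 11] by simp
  have Y2: "v (Y z2 - 1) = q\<^sup>2"
    using slow_orbit_exact[OF adm[OF z2A] _ mu1(1) b2, of "h z2" l] z2(2)
    by (simp add: Y_def r2 mu2 q4_divide)
  have XC2: "v (X z2 - C z2) = q ^ 4"
  proof -
    have "v (X z2 - C z2) = v ((Y z2)\<^sup>2 - 1)"
      using Y2 lt[of 1 2] by (intro XC z2A) auto
    also have "\<dots> = (q\<^sup>2)\<^sup>2"
      using abs_square_minus_1_eq[of "Y z2"] Y2 lt[of 2 20] by simp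
    finally show ?thesis by (simp flip: power_mult)
  qed
  have CC: "v (C z2 - C \<kappa>1) \<le> q ^ 11"
  proof -
    have "v (C \<kappa> - C \<kappa>0) \<le> q ^ 11" if "\<kappa> \<in> open_disk c r" for \<kappa>
      using critical_orbit_perturb(2)[OF c0 _ order_refl, of \<kappa>] sub0 that
      by (auto simp: C_def power_eq_if)
    then show ?thesis
      using k1A z2A dist_trans_le[of "C z2" "C \<kappa>0" "q ^ 11" "C \<kappa>1"]
        minus_commute[of "C \<kappa>0" "C \<kappa>1"] by metis
  qed
  have "v (X z2 - X \<kappa>1) = q ^ 4"
  proof -
    have "X z2 - X \<kappa>1 = (X z2 - C z2) + ((C z2 - C \<kappa>1) - (X \<kappa>1 - C \<kappa>1))"
      by simp
    moreover have "v ((C z2 - C \<kappa>1) - (X \<kappa>1 - C \<kappa>1)) < v (X z2 - C z2)"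
      using diff_le[OF CC XC1] XC2 lt[of 4 11] by (simp del: diff_diff_eq2)
    ultimately show ?thesis
      using add_dominant XC2 by metis
  qed
  then have "\<exists>y\<in>closed_disk \<kappa>1 (v (z2 - \<kappa>1)). X y = 0"
    using X1 by (intro rational_covers_closed_disk[OF rational_on_subset[OF rat sub3], of z2]) auto
  then obtain \<kappa>' where k': "\<kappa>' \<in> open_disk \<kappa>1 r'" "X \<kappa>' = 0"
    using sub3 by blast
  have k'A: "\<kappa>' \<in> open_disk c r" using k' sub2 by blast
  have "v (Y \<kappa>' - 1) < q ^ 4 * (\<mu> ^ 3) ^ 2 ^ l"
    unfolding Y_def by (intro slow_orbit_le[OF adm[OF k'A] hlt[OF k'(1)] mu1(2) b3(1)]) simp
  then have Yq: "v (Y \<kappa>' - 1) < q"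
    unfolding mu3 q4_divide .
  have sq: "v ((Y \<kappa>')\<^sup>2 - 1) = q ^ 4"
    using XC[OF k'A Yq] vC[OF k'A] k'(2) by simp
  have "\<not> v (Y \<kappa>' - 1) \<le> q ^ 20"
  proof
    assume "v (Y \<kappa>' - 1) \<le> q ^ 20"
    then have "q ^ 4 \<le> (q ^ 20)\<^sup>2"
      using abs_square_minus_1_le[of "Y \<kappa>'" "q ^ 20"] sq by simp
    then show False using lt[of 4 40] by (simp flip: power_mult)
  qed
  then have "(v (Y \<kappa>' - 1))\<^sup>2 = (q\<^sup>2)\<^sup>2"
    using abs_square_minus_1_eq[of "Y \<kappa>'"] sq by (simp flip: power_mult)
  then have "v (Y \<kappa>' - 1) = q\<^sup>2"
    by (rule power2_eq_imp_eq) auto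
  then have "v ((R \<kappa>' ^^ (5 * l)) (h \<kappa>') - 1) = q ^ 4 * (\<mu>\<^sup>2) ^ 2 ^ l"
    unfolding mu2 q4_divide by (simp only: Y_def)
  then have "v (h \<kappa>' - 1) = q ^ 4 * \<mu>\<^sup>2"
    by (intro slow_orbit_backward[OF adm[OF k'A] hlt[OF k'(1)] mu1(2) b3(1) mu1(1)])
  then show ?thesis
    using that[OF k'A] k'(2) by (simp add: X_def)
qed

text \<open>A landing parameter as above, a slow escape before it that is long enough, and a jump after it.
  By transversality, on a disk of radius \<open>\<delta>\<close> around the landing parameter the position reaches
  distance \<open>\<delta>\<close> from \<open>0\<close>, which is what \<open>blow_up\<close> needs.\<close>

lemma stage_extend:
  assumes c0: "centre \<kappa>0" and st: "stage \<kappa>0 x K c r T" and K: "0 \<le> K"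
  obtains c' r' T' where "stage \<kappa>0 x K c' r' T'" "open_disk c' r' \<subseteq> open_disk c r"
    "r' \<le> q ^ N" "T + N \<le> T'"
    "\<And>\<kappa>. \<kappa> \<in> open_disk c' r' \<Longrightarrow> v ((R \<kappa> ^^ T) x - 1) < 1"
    "\<And>\<kappa> i. \<kappa> \<in> open_disk c' r' \<Longrightarrow> T' - N \<le> i \<Longrightarrow> i < T' \<Longrightarrow> v ((R \<kappa> ^^ i) x) < q"
proof -
  define h where "h = (\<lambda>\<kappa>. (R \<kappa> ^^ T) x)"
  have r: "0 < r" and sub0: "open_disk c r \<subseteq> closed_disk \<kappa>0 (q ^ 12)"
    and rat: "rational_on (open_disk c r) h"
    and onto: "\<And>w. v w \<le> 1 \<Longrightarrow> \<exists>\<kappa>\<in>open_disk c r. h \<kappa> = w"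
    and tameT: "\<And>\<kappa>. \<kappa> \<in> open_disk c r \<Longrightarrow> tame K \<kappa> x T"
    using st by (auto simp: stage_def h_def)
  have adm: "admissible \<kappa>" if "\<kappa> \<in> open_disk c r" for \<kappa>
    using critical_orbit_perturb(3)[OF c0 _ order_refl, of \<kappa>] sub0 that by auto
  obtain L where L: "L \<ge> 1"
    "\<And>y z. y \<in> open_disk c r \<Longrightarrow> z \<in> open_disk c r \<Longrightarrow> v (h y - h z) \<le> L * v (y - z)"
    using rational_on_lipschitz[OF rat r] by metis

  \<comment> \<open>The radius of the new parameter disk and the length of the jump are fixed before the length
    of the slow escape, which has to compensate for the expansion during the jump.\<close>
  obtain j1 where j1: "q ^ j1 < min r (q ^ 10 / L)"
    using ex_q_power_less[of "min r (q ^ 10 / L)"] r L(1) by auto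
  define j where "j = j1 + 20 + N"
  define \<theta> where "\<theta> = \<pi> ^ j"
  define \<delta> where "\<delta> = q ^ j"
  have th: "v \<theta> = \<delta>" "\<theta> \<noteq> 0" by (simp_all add: \<theta>_def \<delta>_def abs_power)
  have dj1: "\<delta> \<le> q ^ j1" and d20: "\<delta> \<le> q ^ 20" and dN: "\<delta> \<le> q ^ N"
    unfolding \<delta>_def by (intro q_power_mono; simp add: j_def)+
  have dr: "\<delta> < r" using dj1 j1 by simp
  have dL: "L * \<delta> \<le> q ^ 10"
  proof -
    have "L * \<delta> \<le> L * q ^ j1" using dj1 L(1) by (intro mult_left_mono) auto
    moreover have "L * q ^ j1 \<le> q ^ 10" using j1 L(1) by (simp add: field_simps)
    ultimately show ?thesis by linarith
  qed
  have dpos: "0 < \<delta>" by (simp add: \<delta>_def)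
  define n where "n = j + N + 1"
  have n: "q ^ (2 * n - 1) \<le> \<delta>" "n \<ge> 1" "N \<le> n"
  proof -
    show "q ^ (2 * n - 1) \<le> \<delta>"
      unfolding \<delta>_def by (rule q_power_mono) (simp add: n_def)
  qed (simp_all add: n_def)
  obtain l1 where l1: "q ^ l1 < 1 / L"
    using ex_q_power_less[of "1 / L"] L(1) by auto
  define l where "l = Suc (l1 + n)"
  have l: "n \<le> l" "L * q ^ (2 * (l - 1)) \<le> 1"
  proof -
    show "n \<le> l" by (simp add: l_def)
    have "q ^ (2 * (l - 1)) \<le> q ^ l1" by (intro q_power_mono) (simp add: l_def)
    then have "q ^ (2 * (l - 1)) \<le> 1 / L" using l1 by linarith
    then show "L * q ^ (2 * (l - 1)) \<le> 1" using L(1) by (simp add: field_simps)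
  qed
  obtain g where g: "g ^ 2 ^ l = 1 / \<pi>"
    using nth_root_exists[of "2 ^ l" "1 / \<pi>"] by auto
  define \<mu> where "\<mu> = v g"
  have mul: "\<mu> ^ 2 ^ l = 1 / q"
    unfolding \<mu>_def abs_power[symmetric] g by (simp add: abs_divide)
  have mu: "1 \<le> \<mu>"
  proof (rule ccontr)
    assume "\<not> 1 \<le> \<mu>"
    then have "\<mu> ^ 2 ^ l \<le> 1" by (intro power_le_one) (auto simp: \<mu>_def)
    then show False using mul one_less_inverse by simp
  qed
  obtain \<kappa>' where k': "\<kappa>' \<in> open_disk c r" "(R \<kappa>' ^^ (5 * l + 3)) (h \<kappa>') = 0"
    "v (h \<kappa>' - 1) = q ^ 4 * \<mu>\<^sup>2"
    using exists_landing[OF c0 sub0 rat onto mu \<mu>_def mul] by metis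

  have mu2l: "(\<mu>\<^sup>2) ^ 2 ^ l = 1 / q\<^sup>2"
    unfolding power_swap[of \<mu> _ "2 ^ l"] mul by (simp add: power_one_over)
  have mu2: "1 \<le> \<mu>\<^sup>2" using mu by (simp add: one_le_power)
  have b2: "q ^ 5 * (\<mu>\<^sup>2) ^ 2 ^ l < 1" "q ^ 3 * (\<mu> ^ 3) ^ 2 ^ l \<le> 1"
  proof -
    show "q ^ 5 * (\<mu>\<^sup>2) ^ 2 ^ l < 1"
      unfolding mu2l using q_power_strict_mono[of 2 5] by (simp add: divide_less_eq)
    have "(\<mu> ^ 3) ^ 2 ^ l = 1 / q ^ 3"
      unfolding power_swap[of \<mu> _ "2 ^ l"] mul by (simp add: power_one_over)
    then show "q ^ 3 * (\<mu> ^ 3) ^ 2 ^ l \<le> 1" by simp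
  qed
  have half: "(\<mu>\<^sup>2) ^ 2 ^ (l - 1) = 1 / q"
  proof -
    have "(\<mu>\<^sup>2) ^ 2 ^ (l - 1) = \<mu> ^ (2 ^ Suc (l - 1))"
      by (simp add: power_mult[symmetric])
    then show ?thesis using mul by (simp add: l_def)
  qed

  define B where "B = closed_disk \<kappa>' \<delta>"
  have BA: "B \<subseteq> open_disk c r"
    using k'(1) dr dist_trans_less[of _ \<kappa>' r c] unfolding B_def by auto
  have hB: "v (h \<kappa> - h \<kappa>') \<le> L * v (\<kappa> - \<kappa>')" if "\<kappa> \<in> B" for \<kappa>
    using L(2)[of \<kappa> \<kappa>'] that BA k'(1) by blast
  have hB10: "v (h \<kappa> - h \<kappa>') \<le> q ^ 10" if "\<kappa> \<in> B" for \<kappa>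
  proof -
    have "L * v (\<kappa> - \<kappa>') \<le> L * \<delta>"
      using that L(1) by (intro mult_left_mono) (auto simp: B_def)
    then show ?thesis using hB[OF that] dL by linarith
  qed
  have h1: "v (h \<kappa> - 1) = q ^ 4 * \<mu>\<^sup>2" if "\<kappa> \<in> B" for \<kappa>
  proof -
    have "q ^ 10 < q ^ 4 * 1" using q_power_strict_mono[of 4 10] by simp
    also have "\<dots> \<le> q ^ 4 * \<mu>\<^sup>2" using mu2 by (intro mult_left_mono) auto
    finally have "v (h \<kappa> - h \<kappa>') < v (h \<kappa>' - 1)" using hB10[OF that] k'(3) by linarith
    then show ?thesis using add_dominant[of "h \<kappa> - h \<kappa>'" "h \<kappa>' - 1"] k'(3) by simp
  qed
  have slow: "v ((R \<kappa> ^^ (5 * i)) (h \<kappa>) - 1) = q ^ 4 * (\<mu>\<^sup>2) ^ 2 ^ i" if "\<kappa> \<in> B" "i \<le> l" for \<kappa> i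
    using that BA by (intro slow_orbit_exact[OF adm h1 mu2 b2(1)]) auto
  have slow_bounds: "q ^ 4 \<le> v ((R \<kappa> ^^ (5 * i)) (h \<kappa>) - 1) \<and> v ((R \<kappa> ^^ (5 * i)) (h \<kappa>) - 1) \<le> q ^ 3"
    if "\<kappa> \<in> B" "i < l" for \<kappa> i
  proof -
    have 1: "1 \<le> (\<mu>\<^sup>2) ^ 2 ^ i" using mu2 by (simp add: one_le_power)
    have "(\<mu>\<^sup>2) ^ 2 ^ i \<le> (\<mu>\<^sup>2) ^ 2 ^ (l - 1)"
      using mu2 that by (intro power_increasing) auto
    then have 2: "(\<mu>\<^sup>2) ^ 2 ^ i \<le> 1 / q" by (simp only: half)
    show ?thesis
      using slow[of \<kappa> i] that mult_left_mono[OF 1, of "q ^ 4"] mult_left_mono[OF 2, of "q ^ 4"]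
      by (simp add: q4_divide)
  qed
  have slow_end: "v ((R \<kappa> ^^ (5 * l)) (h \<kappa>) - 1) = q\<^sup>2" if "\<kappa> \<in> B" for \<kappa>
    using slow[OF that, of l] by (simp only: mu2l q4_divide)
  define X where "X = (\<lambda>\<kappa>. (R \<kappa> ^^ (5 * l + 3)) (h \<kappa>))"
  have ratX: "rational_on B X"
    unfolding X_def
  proof (rule rational_on_R_iterate[OF rational_on_subset[OF rat BA]])
    fix \<kappa> i assume k: "\<kappa> \<in> B" and i: "i < 5 * l + 3"
    have "\<mu>\<^sup>2 < \<mu> ^ 3"
    proof -
      have "\<mu> \<noteq> 1" using mul one_less_inverse by auto
      then show ?thesis using mu by (intro power_strict_increasing) auto
    qed
    then have "v (h \<kappa> - 1) < q ^ 4 * \<mu> ^ 3" using h1[OF k] by simp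
    then show "(R \<kappa> ^^ i) (h \<kappa>) \<noteq> \<pi>"
      using mu b2(2) k BA i by (intro slow_orbit_no_pole[where l = l and B = "\<mu> ^ 3"] adm)
        (auto simp: one_le_power)
  qed
  have tameX: "tame K \<kappa> x (T + (5 * l + 3)) \<and> growth \<kappa> x (T + (5 * l + 3)) * (1 / q ^ (2 * n)) \<le> K"
    if "\<kappa> \<in> B" for \<kappa>
  proof -
    have a: "admissible \<kappa>" using that BA adm by blast
    have 1: "tame 1 \<kappa> (h \<kappa>) (5 * l)" "growth \<kappa> (h \<kappa>) (5 * l) \<le> q ^ (2 * l)"
      using tame_slow_orbit[OF a slow_bounds[OF that]] by auto
    define y where "y = (R \<kappa> ^^ (5 * l)) (h \<kappa>)"
    have y: "v (y - 1) = q\<^sup>2" using slow_end[OF that] by (simp add: y_def)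
    have 2: "tame 1 \<kappa> y 3" "growth \<kappa> y 3 \<le> 1"
      using tame_turn[OF a, of y] y q_power_mono[of 2 4] by auto
    have g1: "growth \<kappa> (h \<kappa>) (5 * l) * 1 \<le> 1"
      using 1(2) q_power_mono[of 0 "2 * l"] by simp
    have 3: "tame 1 \<kappa> (h \<kappa>) (5 * l + 3)"
      using tame_append[OF 1(1) _ g1] 2 by (simp add: y_def)
    have "growth \<kappa> (h \<kappa>) (5 * l) * growth \<kappa> y 3 \<le> q ^ (2 * l) * 1"
      using 1 2 growth_nonneg by (intro mult_mono) auto
    then have 4: "growth \<kappa> (h \<kappa>) (5 * l + 3) \<le> q ^ (2 * l)"
      by (simp add: growth_add y_def)
    have T: "tame K \<kappa> x T" using tameT that BA by blast
    then have gT: "growth \<kappa> x T \<le> K" by (simp add: tame_def)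
    have "tame K \<kappa> x (T + (5 * l + 3))"
      using tame_append[OF T, of 1] 3 gT by (simp add: h_def)
    moreover have "growth \<kappa> x (T + (5 * l + 3)) * (1 / q ^ (2 * n)) \<le> K"
    proof -
      have "growth \<kappa> x (T + (5 * l + 3)) \<le> K * q ^ (2 * l)"
        unfolding growth_add[of \<kappa> x T] using gT 4 K growth_nonneg
        by (intro mult_mono) (auto simp: h_def)
      also have "\<dots> \<le> K * q ^ (2 * n)"
        using l(1) K by (intro mult_left_mono q_power_mono) auto
      finally show ?thesis by (simp add: divide_le_eq)
    qed
    ultimately show ?thesis by blast
  qed

  define z where "z = \<kappa>' + \<theta>"
  have zB: "z \<in> B" and k'B: "\<kappa>' \<in> B"
    using dpos by (simp_all add: z_def B_def th)
  have vXz: "v (X z) = \<delta>"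
  proof -
    define x' where "x' = (R z ^^ (5 * (l - 1))) (h z)"
    define y' where "y' = (R \<kappa>' ^^ (5 * (l - 1))) (h \<kappa>')"
    have lS: "l = Suc (l - 1)" by (simp add: l_def)
    have shift: "(R \<kappa> ^^ (5 * l + 3)) w = (R \<kappa> ^^ 8) ((R \<kappa> ^^ (5 * (l - 1))) w)" for \<kappa> w
    proof -
      have "5 * l + 3 = 5 * (l - 1) + 8" using lS by linarith
      then show ?thesis by (simp only: funpow_add_apply)
    qed
    have az: "admissible z" "admissible \<kappa>'"
      using adm zB k'B BA by auto
    have "v (h z - h \<kappa>') \<le> L * \<delta>"
      using hB[OF zB] by (simp add: z_def th)
    then have "v (x' - y') \<le> max (\<delta> / q ^ 5) (q ^ (2 * (l - 1)) * (L * \<delta>))"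
      unfolding x'_def y'_def using d20 q_power_mono[of 15 20] slow_bounds[OF k'B] dL
      by (intro param_slow_orbit az) (auto simp: z_def th)
    also have "\<dots> \<le> \<delta> / q ^ 5"
    proof -
      have "(L * q ^ (2 * (l - 1))) * \<delta> \<le> 1 * \<delta>"
        using l(2) dpos by (intro mult_right_mono) auto
      moreover have "\<delta> \<le> \<delta> / q ^ 5"
        using q_power_mono[of 0 5] dpos by (simp add: le_divide_eq)
      ultimately show ?thesis by (simp add: mult_ac)
    qed
    finally have dist: "v (x' - y') \<le> v \<theta> / q ^ 5" by (simp add: th)
    have "v (y' - 1) = q ^ 4 * (1 / q)"
      unfolding y'_def half[symmetric] by (rule slow[OF k'B]) simp
    then have y3: "v (y' - 1) = q ^ 3" by (simp only: q4_divide)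
    have "v ((R z ^^ 8) x') = v \<theta>"
    proof (rule transversality[OF c0 _ _ _ th(2) _ y3 dist])
      show "v (z - \<kappa>0) \<le> q ^ 12" "v (\<kappa>' - \<kappa>0) \<le> q ^ 12"
        using zB k'B BA sub0 by auto
      show "\<theta> = z - \<kappa>'" by (simp add: z_def)
      show "v \<theta> \<le> q ^ 20" using d20 th by simp
      show "(R \<kappa>' ^^ 8) y' = 0"
        using k'(2) unfolding shift y'_def .
    qed
    then show ?thesis
      unfolding X_def shift x'_def using th by simp
  qed
  have unit: "v \<kappa> = 1" if "\<kappa> \<in> B" for \<kappa>
    using adm that BA by (auto simp: admissible_def)
  obtain r' where r': "0 < r'" "r' \<le> \<delta>" "\<And>\<kappa>. \<kappa> \<in> open_disk \<kappa>' r' \<Longrightarrow> v (X \<kappa>) < q ^ (2 * n - 1)"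
    "rational_on (open_disk \<kappa>' r') (\<lambda>\<kappa>. (R \<kappa> ^^ n) (X \<kappa>))"
    "\<And>w. v w \<le> 1 \<Longrightarrow> \<exists>\<kappa>\<in>open_disk \<kappa>' r'. (R \<kappa> ^^ n) (X \<kappa>) = w"
  proof (rule blow_up[of \<kappa>' \<delta> X z n])
    show "rational_on (closed_disk \<kappa>' \<delta>) X" using ratX by (simp add: B_def)
    show "X \<kappa>' = 0" using k'(2) by (simp add: X_def)
    show "z \<in> closed_disk \<kappa>' \<delta>" using zB by (simp add: B_def)
    show "q ^ (2 * n - 1) \<le> v (X z)" using n(1) vXz by simp
    show "1 \<le> n" by (rule n(2))
    show "v \<kappa> = 1" if "\<kappa> \<in> closed_disk \<kappa>' \<delta>" for \<kappa> using unit that by (simp add: B_def)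
  qed (use that in blast)
  have sub': "open_disk \<kappa>' r' \<subseteq> B"
    using r'(2) by (auto simp: B_def)
  define T1 where "T1 = T + (5 * l + 3)"
  have XT: "X \<kappa> = (R \<kappa> ^^ T1) x" for \<kappa>
    by (simp only: X_def h_def T1_def funpow_add_apply)
  have XTn: "(R \<kappa> ^^ i) (X \<kappa>) = (R \<kappa> ^^ (T1 + i)) x" for \<kappa> i
    by (simp only: XT funpow_add_apply)
  show ?thesis
  proof (rule that[of \<kappa>' r' "T1 + n"])
    show "open_disk \<kappa>' r' \<subseteq> open_disk c r"
      using sub' BA by blast
    show "stage \<kappa>0 x K \<kappa>' r' (T1 + n)"
      unfolding stage_def
    proof (intro conjI ballI)
      show "0 < r'" by (rule r'(1))
      show "open_disk \<kappa>' r' \<subseteq> closed_disk \<kappa>0 (q ^ 12)"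
        using sub' BA sub0 by blast
      show "rational_on (open_disk \<kappa>' r') (\<lambda>\<kappa>. (R \<kappa> ^^ (T1 + n)) x)"
        using r'(4) by (simp only: XTn)
      show "\<forall>w. v w \<le> 1 \<longrightarrow> (\<exists>\<kappa>\<in>open_disk \<kappa>' r'. (R \<kappa> ^^ (T1 + n)) x = w)"
        using r'(5) by (simp only: XTn) blast
      fix \<kappa> assume k: "\<kappa> \<in> open_disk \<kappa>' r'"
      then have kB: "\<kappa> \<in> B" using sub' by blast
      show "tame K \<kappa> x (T1 + n)"
      proof (rule tame_append)
        show "tame K \<kappa> x T1" "growth \<kappa> x T1 * (1 / q ^ (2 * n)) \<le> K"
          using tameX[OF kB] by (simp_all add: T1_def)
        show "tame (1 / q ^ (2 * n)) \<kappa> ((R \<kappa> ^^ T1) x) n"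
          using tame_small[OF unit[OF kB] r'(3)[OF k]] by (simp only: XT)
      qed
    qed
    show "r' \<le> q ^ N" using r'(2) dN by linarith
    show "T + N \<le> T1 + n" using n(3) by (simp add: T1_def)
    show "v ((R \<kappa> ^^ T) x - 1) < 1" if "\<kappa> \<in> open_disk \<kappa>' r'" for \<kappa>
    proof -
      have "\<kappa> \<in> B" using that sub' by blast
      then have "v (h \<kappa> - 1) \<le> q ^ 3"
        using slow_bounds[of \<kappa> 0] by (simp add: l_def)
      then show ?thesis using q_power_strict_mono[of 0 3] by (simp add: h_def)
    qed
    show "v ((R \<kappa> ^^ i) x) < q" if "\<kappa> \<in> open_disk \<kappa>' r'" "T1 + n - N \<le> i" "i < T1 + n" for \<kappa> i
    proof -
      have "T1 \<le> i" using that(2) n(3) by linarith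
      then have "(R \<kappa> ^^ i) x = (R \<kappa> ^^ (i - T1)) (X \<kappa>)"
        using XTn[where i = "i - T1"] by simp
      moreover have "v ((R \<kappa> ^^ (i - T1)) (X \<kappa>)) < q"
        using unit[of \<kappa>] sub' r'(3)[of \<kappa>] that \<open>T1 \<le> i\<close> by (intro R_iterate_small(2)[where n = n]) auto
      ultimately show ?thesis by simp
    qed
  qed
qed

text \<open>The critical point goes to \<open>c / \<pi>\<close>, which is mapped to \<open>1 / \<pi>\<close> if and only if
  \<open>c (c\<^sup>2 - c + 1) = \<pi>\<^sup>2\<close>; a solution is found near a primitive sixth root of unity.\<close>

lemma exists_landing_parameter:
  obtains c where "v c = 1" "v (c\<^sup>2 - c + 1) = q\<^sup>2" "R c (c / \<pi>) = 1 / \<pi>"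
proof -
  obtain \<omega> :: 'k where "poly [:1, -1, 1:] \<omega> = 0"
    using alg_closed_imp_poly_has_root[of "[:1, -1, 1::'k:]"] by auto
  then have w: "\<omega> * (1 - \<omega>) = 1"
    by (simp add: algebra_simps add_eq_0_iff)
  have vw: "v \<omega> = 1"
  proof -
    have prod: "v \<omega> * v (1 - \<omega>) = 1"
      using w by (metis mult one)
    have "\<not> v \<omega> < 1"
    proof
      assume "v \<omega> < 1"
      then show False using prod diff_dominant[of \<omega> 1] by simp
    qed
    moreover have "\<not> v \<omega> > 1"
    proof
      assume a: "v \<omega> > 1"
      then have "v \<omega> * v \<omega> = 1" using prod diff_dominant'[of 1 \<omega>] by simp
      then show False using a less_1_mult[of "v \<omega>" "v \<omega>"] by simp
    qed
    ultimately show ?thesis by simp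
  qed
  define h where "h = (\<lambda>z::'k. z * (1 - z * (1 - z)))"
  have rat: "rational_on (closed_disk \<omega> (q\<^sup>2)) h"
    unfolding h_def
    by (intro rational_on_mult rational_on_diff rational_on_const rational_on_ident)
  have hw: "h \<omega> = 0" using w by (simp add: h_def)
  define z where "z = \<omega> + \<pi>\<^sup>2"
  have q2: "q\<^sup>2 < 1" by (rule q2_bounds)
  have "v z = 1"
    using add_dominant[of "\<pi>\<^sup>2" \<omega>] vw q2 by (simp add: z_def abs_power)
  moreover have "1 - z * (1 - z) = \<pi>\<^sup>2 * (2 * \<omega> + \<pi>\<^sup>2 - 1)"
    using w by (simp add: z_def algebra_simps power2_eq_square)
  moreover have "v (2 * \<omega> + \<pi>\<^sup>2 - 1) = 1"
  proof -
    have "v (2 * \<omega> + \<pi>\<^sup>2) < 1"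
      using two_le[of 1] vw pi_small q2 by (intro add_less) (auto simp: mult abs_power)
    then show ?thesis using diff_dominant'[of "2 * \<omega> + \<pi>\<^sup>2" 1] by simp
  qed
  ultimately have "v (h z) = q\<^sup>2"
    by (simp only: h_def mult abs_power)
  then have "\<exists>c\<in>closed_disk \<omega> (q\<^sup>2). h c = \<pi>\<^sup>2"
    by (intro rational_covers_closed_disk[OF rat, of z]) (auto simp: hw z_def abs_power)
  then obtain c where c: "v (c - \<omega>) \<le> q\<^sup>2" "h c = \<pi>\<^sup>2" by auto
  have vc: "v c = 1"
    using close_imp_eq[of c \<omega>] c(1) q2 vw by simp
  have eq: "1 - c * (1 - c) = c\<^sup>2 - c + 1"
    by (simp add: algebra_simps power2_eq_square)
  have "v c * v (c\<^sup>2 - c + 1) = q\<^sup>2"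
    using c(2) unfolding h_def eq by (metis mult abs_power)
  then have 2: "v (c\<^sup>2 - c + 1) = q\<^sup>2" using vc by simp
  have "v (c / \<pi>) = 1 / q" using vc by (simp add: abs_divide)
  then have ne: "c / \<pi> - \<pi> \<noteq> 0" using big_region(2) by simp
  have "\<pi> * (c / \<pi> - \<pi>) = c - \<pi>\<^sup>2"
    by (simp add: algebra_simps power2_eq_square)
  also have "\<dots> = c * c * (1 - c)"
    using c(2) by (simp add: h_def algebra_simps)
  finally have den: "\<pi> * (c / \<pi> - \<pi>) = c * c * (1 - c)" .
  then have "c * c * (1 - c) \<noteq> 0" using ne by (metis mult_eq_0_iff pi_nonzero)
  then have "R c (c / \<pi>) = 1 / \<pi>"
    unfolding R_def den by simp
  then show ?thesis using that vc 2 by blast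
qed

text \<open>Blowing up at a parameter for which the critical point lands on \<open>0\<close> yields one for which it
  returns to itself.\<close>

lemma exists_centre:
  obtains \<kappa> where "centre \<kappa>"
proof -
  obtain c where c: "v c = 1" "v (c\<^sup>2 - c + 1) = q\<^sup>2" "R c (c / \<pi>) = 1 / \<pi>"
    using exists_landing_parameter by blast
  have c0: "c \<noteq> 0" using c(1) by auto
  define D where "D = closed_disk c (q ^ 4)"
  define h where "h = (\<lambda>\<kappa>. R \<kappa> (R \<kappa> (\<kappa> / \<pi>)))"
  have q42: "q ^ 4 \<le> q\<^sup>2" by (rule q_power_mono) simp
  have cond: "v \<kappa> = 1" "v (\<kappa>\<^sup>2 - \<kappa> + 1) \<le> q\<^sup>2" if "\<kappa> \<in> D" for \<kappa>
    using param_condition_perturb[OF c(1), of \<kappa>] c(2) that q42 by (auto simp: D_def)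
  have x1: "v (\<kappa> / \<pi>) = 1 / q" if "\<kappa> \<in> D" for \<kappa>
    using cond(1)[OF that] by (simp add: abs_divide)
  have cD: "c \<in> D" by (simp add: D_def)
  have dec: "R \<kappa> (\<kappa> / \<pi>) - 1 / \<pi> = (\<kappa> - c) * (slope \<kappa> (\<kappa> / \<pi>) (c / \<pi>) * (1 / \<pi>) + 1 / \<pi> / c)"
    if "\<kappa> \<in> D" for \<kappa>
    using increment_step[of "\<kappa> / \<pi>" "c / \<pi>" "\<kappa> - c" "1 / \<pi>" \<kappa> c] c0 c(3)
      big_region(2)[OF x1[OF that]] big_region(2)[OF x1[OF cD]] by (simp add: diff_divide_distrib)
  have ev: "v (slope \<kappa> (\<kappa> / \<pi>) (c / \<pi>) * (1 / \<pi>) + 1 / \<pi> / c) = 1 / q" if k: "\<kappa> \<in> D" for \<kappa>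
  proof -
    have "v (slope \<kappa> (\<kappa> / \<pi>) (c / \<pi>) - - \<kappa>) \<le> q\<^sup>2"
      using near_slope_big[OF x1[OF k] x1[OF cD], of \<kappa>] cond(1)[OF k] by (simp add: near_def)
    moreover have "v (\<kappa> - c) \<le> q\<^sup>2" using k q42 by (auto simp: D_def)
    ultimately have a: "v ((slope \<kappa> (\<kappa> / \<pi>) (c / \<pi>) - - \<kappa>) - (\<kappa> - c)) < 1"
      using q2_bounds diff_less[of "slope \<kappa> (\<kappa> / \<pi>) (c / \<pi>) - - \<kappa>" 1 "\<kappa> - c"] by linarith
    have "1 / c - c = (1 - c) * (1 - c + 2 * c) / c"
      using c0 by (simp add: field_simps power2_eq_square)
    moreover have "v (1 - c) = 1"
      using one_minus_parameter[OF c(1)] c(2) by simp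
    moreover from this have "v (1 - c + 2 * c) = 1"
      using add_dominant[of "2 * c" "1 - c"] two_le[of 1] pi_small c(1) by (simp add: mult)
    ultimately have b: "v (1 / c - c) = 1"
      using c(1) by (simp only: abs_simps)
    have "v (((slope \<kappa> (\<kappa> / \<pi>) (c / \<pi>) - - \<kappa>) - (\<kappa> - c)) + (1 / c - c)) = 1"
      using add_dominant[of "(slope \<kappa> (\<kappa> / \<pi>) (c / \<pi>) - - \<kappa>) - (\<kappa> - c)" "1 / c - c"] a b
      by (simp only: add.commute)
    also have "((slope \<kappa> (\<kappa> / \<pi>) (c / \<pi>) - - \<kappa>) - (\<kappa> - c)) + (1 / c - c) = slope \<kappa> (\<kappa> / \<pi>) (c / \<pi>) + 1 / c"
      by simp
    finally have "v (slope \<kappa> (\<kappa> / \<pi>) (c / \<pi>) + 1 / c) = 1" .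
    moreover have "slope \<kappa> (\<kappa> / \<pi>) (c / \<pi>) * (1 / \<pi>) + 1 / \<pi> / c = (slope \<kappa> (\<kappa> / \<pi>) (c / \<pi>) + 1 / c) * (1 / \<pi>)"
      by (simp add: field_simps)
    ultimately show ?thesis by (simp only: mult abs_divide) simp
  qed
  have d2: "v (R \<kappa> (\<kappa> / \<pi>) - 1 / \<pi>) = v (\<kappa> - c) / q" if "\<kappa> \<in> D" for \<kappa>
    unfolding dec[OF that] mult ev[OF that] by simp
  have x2: "v (R \<kappa> (\<kappa> / \<pi>)) = 1 / q" if "\<kappa> \<in> D" for \<kappa>
  proof -
    have "v (\<kappa> - c) \<le> q ^ 4" using that by (simp add: D_def)
    also have "\<dots> < 1" using q_power_strict_mono[of 0 4] by simp
    finally have "v (\<kappa> - c) / q < 1 / q" by (simp add: divide_strict_right_mono)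
    then show ?thesis
      using close_imp_eq[of "R \<kappa> (\<kappa> / \<pi>)" "1 / \<pi>"] d2[OF that] by (simp add: abs_divide)
  qed
  have vh: "v (h \<kappa>) = v (R \<kappa> (\<kappa> / \<pi>) - 1 / \<pi>)" if "\<kappa> \<in> D" for \<kappa>
    using R_isometry_big[OF x2[OF that] _ cond(1)[OF that], of "1 / \<pi>"] by (simp add: h_def abs_divide)
  have rat: "rational_on D h"
    unfolding h_def
    using big_region(2)[OF x1] big_region(2)[OF x2]
    by (intro rational_on_R rational_on_divide rational_on_ident rational_on_const) auto
  have hc: "h c = 0" using c(3) by (simp add: h_def)
  define z where "z = c + \<pi> ^ 4"
  have zD: "z \<in> D" by (simp add: z_def D_def abs_power)
  have hz: "v (h z) = q ^ 3"
  proof -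
    have "v (z - c) = q ^ 4" by (simp add: z_def abs_power)
    moreover have "q ^ 4 / q = q ^ 3" by (rule q4_divide)
    ultimately show ?thesis using vh[OF zD] d2[OF zD] by simp
  qed
  obtain r where r: "0 < r" "r \<le> q ^ 4" "\<And>\<kappa>. \<kappa> \<in> open_disk c r \<Longrightarrow> v (h \<kappa>) < q ^ (2 * 2 - 1)"
    "\<And>w. v w \<le> 1 \<Longrightarrow> \<exists>\<kappa>\<in>open_disk c r. (R \<kappa> ^^ 2) (h \<kappa>) = w"
  proof (rule blow_up[of c "q ^ 4" h z 2])
    show "rational_on (closed_disk c (q ^ 4)) h" using rat by (simp add: D_def)
    show "z \<in> closed_disk c (q ^ 4)" using zD by (simp add: D_def)
    show "v \<kappa> = 1" if "\<kappa> \<in> closed_disk c (q ^ 4)" for \<kappa>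
      using cond(1)[of \<kappa>] that unfolding D_def by blast
    show "h c = 0" by (rule hc)
    show "q ^ (2 * 2 - 1) \<le> v (h z)" using hz by simp
    show "1 \<le> (2::nat)" by simp
  qed (use that in blast)
  obtain \<kappa> where k: "\<kappa> \<in> open_disk c r" "(R \<kappa> ^^ 2) (h \<kappa>) = 1"
    using r(4)[of 1] by auto
  have kD: "\<kappa> \<in> D" using k(1) r(2) by (auto simp: D_def)
  have "v ((R \<kappa> ^^ 2) (h \<kappa>)) = v (h \<kappa>) / q ^ (2 * 2)"
    using R_iterate_small(1)[OF cond(1)[OF kD] r(3)[OF k(1)], of 2] by simp
  then have "v (h \<kappa>) = q ^ 4" using k(2) by (simp add: divide_eq_eq)
  then have "v (1 / \<pi> - R \<kappa> (\<kappa> / \<pi>)) = q ^ 4"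
    using vh[OF kD] by (simp add: minus_commute)
  moreover have "(R \<kappa> ^^ 5) 1 = 1"
    using k(2) by (simp add: iterate_5 iterate_2 h_def R_1)
  ultimately have "centre \<kappa>"
    using cond[OF kD] by (simp add: centre_def)
  then show ?thesis using that by blast
qed

text \<open>The starting point is a preimage of \<open>1 / \<pi>\<close> for the centre. It is on the sphere
  of radius \<open>1 / q\<close>, and the direct effect of the parameter moves its image away from
  \<open>1 / \<pi>\<close>.\<close>

lemma exists_first_stage:
  assumes c0: "centre \<kappa>0"
  obtains x K c r T where "0 < K" "v x = 1 / q" "stage \<kappa>0 x K c r T"
proof -
  have k0: "v \<kappa>0 = 1" "v (\<kappa>0\<^sup>2 - \<kappa>0 + 1) \<le> q\<^sup>2" "\<kappa>0 \<noteq> 0"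
    using c0 by (auto simp: centre_def)
  define D where "D = closed_disk \<kappa>0 (q ^ 12)"
  have unit: "v \<kappa> = 1" if "\<kappa> \<in> D" for \<kappa>
    using critical_orbit_perturb(3)[OF c0 _ order_refl, of \<kappa>] that by (auto simp: D_def admissible_def)
  obtain x where x: "v x = 1 / q" "R \<kappa>0 x = 1 / \<pi>"
  proof -
    obtain P Q where PQ: "P + Q = 1 / \<pi> - 1 / \<pi> / \<kappa>0" "P * Q = - (1 / \<pi> * \<pi> / \<kappa>0)"
      "R \<kappa>0 P = 1 / \<pi>" "R \<kappa>0 Q = 1 / \<pi>"
      using R_preimages[OF k0(3), of "1 / \<pi>"] by metis
    have "P + Q = - (1 - \<kappa>0) / (\<pi> * \<kappa>0)"
      unfolding PQ(1) using k0(3) by (simp add: field_simps)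
    then have S: "v (P + Q) = 1 / q"
      using one_minus_parameter[OF k0(1,2)] k0(1) by (simp only: abs_simps minus)
    have "1 < (1 / q)\<^sup>2" using one_less_inverse one_less_power[of "1 / q" 2] by simp
    then have M: "v (P * Q) < (1 / q)\<^sup>2"
      unfolding PQ(2) using k0(1) by (simp add: abs_divide)
    show ?thesis
    proof (cases "v P \<ge> v Q")
      case True
      then show ?thesis using roots_of_different_size(1)[OF S M] PQ that by blast
    next
      case False
      then have "v Q = 1 / q"
        using roots_of_different_size(1)[of Q P "1 / q"] S M by (simp add: add.commute mult.commute)
      then show ?thesis using PQ that by blast
    qed
  qed
  have xp: "x \<noteq> \<pi>" using big_region(2)[OF x(1)] .
  define h where "h = (\<lambda>\<kappa>. R \<kappa> (R \<kappa> x))"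
  have d1: "R \<kappa> x - 1 / \<pi> = (\<kappa> - \<kappa>0) * (1 / \<pi> / \<kappa>0)" for \<kappa>
    using increment_step[of x x "\<kappa> - \<kappa>0" 0 \<kappa> \<kappa>0] xp k0(3) x(2) by simp
  then have v1: "v (R \<kappa> x - 1 / \<pi>) = v (\<kappa> - \<kappa>0) / q" for \<kappa>
    using k0(1) by (simp only: mult abs_divide) simp
  have x1: "v (R \<kappa> x) = 1 / q" if "\<kappa> \<in> D" for \<kappa>
  proof -
    have "v (\<kappa> - \<kappa>0) \<le> q ^ 12" using that by (simp add: D_def)
    also have "\<dots> < 1" using q_power_strict_mono[of 0 12] by simp
    finally have "v (\<kappa> - \<kappa>0) / q < 1 / q" by (simp add: divide_strict_right_mono)
    then show ?thesis
      using close_imp_eq[of "R \<kappa> x" "1 / \<pi>"] v1[of \<kappa>] by (simp add: abs_divide)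
  qed
  have vh: "v (h \<kappa>) = v (\<kappa> - \<kappa>0) / q" if "\<kappa> \<in> D" for \<kappa>
    using R_isometry_big[OF x1[OF that] _ unit[OF that], of "1 / \<pi>"] v1[of \<kappa>]
    by (simp add: h_def abs_divide)
  have rat: "rational_on D h"
    unfolding h_def using xp big_region(2)[OF x1]
    by (intro rational_on_R rational_on_const) auto
  have hc: "h \<kappa>0 = 0" using x(2) by (simp add: h_def)
  define z where "z = \<kappa>0 + \<pi> ^ 12"
  have zD: "z \<in> D" by (simp add: z_def D_def abs_power)
  have hz: "v (h z) = q ^ 11"
  proof -
    have "v (z - \<kappa>0) = q ^ 12" by (simp add: z_def abs_power)
    moreover have "q ^ 12 / q = q ^ 11" by (simp add: power_eq_if)
    ultimately show ?thesis using vh[OF zD] by simp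
  qed
  obtain r where r: "0 < r" "r \<le> q ^ 12" "\<And>\<kappa>. \<kappa> \<in> open_disk \<kappa>0 r \<Longrightarrow> v (h \<kappa>) < q ^ (2 * 6 - 1)"
    "rational_on (open_disk \<kappa>0 r) (\<lambda>\<kappa>. (R \<kappa> ^^ 6) (h \<kappa>))"
    "\<And>w. v w \<le> 1 \<Longrightarrow> \<exists>\<kappa>\<in>open_disk \<kappa>0 r. (R \<kappa> ^^ 6) (h \<kappa>) = w"
  proof (rule blow_up[of \<kappa>0 "q ^ 12" h z 6])
    show "rational_on (closed_disk \<kappa>0 (q ^ 12)) h" using rat by (simp add: D_def)
    show "z \<in> closed_disk \<kappa>0 (q ^ 12)" using zD by (simp add: D_def)
    show "v \<kappa> = 1" if "\<kappa> \<in> closed_disk \<kappa>0 (q ^ 12)" for \<kappa>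
      using unit[of \<kappa>] that unfolding D_def by blast
    show "h \<kappa>0 = 0" by (rule hc)
    show "q ^ (2 * 6 - 1) \<le> v (h z)" using hz by simp
    show "1 \<le> (6::nat)" by simp
  qed (use that in blast)
  have sub: "open_disk \<kappa>0 r \<subseteq> D" using r(2) by (auto simp: D_def)
  have h8: "(R \<kappa> ^^ 6) (h \<kappa>) = (R \<kappa> ^^ (2 + 6)) x" for \<kappa>
    by (simp only: funpow_add_apply h_def iterate_2)
  have tame8: "tame (1 / q ^ 12) \<kappa> x (2 + 6)" if k: "\<kappa> \<in> open_disk \<kappa>0 r" for \<kappa>
  proof (rule tame_append)
    have kD: "\<kappa> \<in> D" using k sub by blast
    have le: "1 \<le> 1 / q ^ 12" using q_power_mono[of 0 12] by (simp add: le_divide_eq)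
    have s: "v (R \<kappa> (R \<kappa> x)) < q ^ 11" using r(3)[OF k] by (simp add: h_def)
    then have ne: "v (R \<kappa> (R \<kappa> x)) \<noteq> 1" using q_power_strict_mono[of 0 11] by simp
    have "growth \<kappa> x 0 = 1" "growth \<kappa> x 1 = 1" "growth \<kappa> x 2 = 1"
      using rate_big[OF x(1)] rate_big[OF x1[OF kD]] by (simp_all add: growth_def eval_nat_numeral)
    moreover have "i = 0 \<or> i = 1 \<or> i = 2" if "i \<le> 2" for i :: nat using that by linarith
    moreover have "in_zone \<kappa> x" "in_zone \<kappa> (R \<kappa> x)"
      using x(1) x1[OF kD] ne q_less_1 by (auto simp: in_zone_def)
    moreover have "i = 0 \<or> i = 1" if "i < 2" for i :: nat using that by linarith
    ultimately show "tame (1 / q ^ 12) \<kappa> x 2" "growth \<kappa> x 2 * (1 / q ^ 12) \<le> 1 / q ^ 12"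
      using le unfolding tame_def by fastforce+
    show "tame (1 / q ^ 12) \<kappa> ((R \<kappa> ^^ 2) x) 6"
      using tame_small[OF unit[OF kD], of "h \<kappa>" 6] r(3)[OF k] by (simp add: iterate_2 h_def)
  qed
  have "stage \<kappa>0 x (1 / q ^ 12) \<kappa>0 r (2 + 6)"
    unfolding stage_def
  proof (intro conjI ballI)
    show "open_disk \<kappa>0 r \<subseteq> closed_disk \<kappa>0 (q ^ 12)" using sub by (simp add: D_def)
    show "rational_on (open_disk \<kappa>0 r) (\<lambda>\<kappa>. (R \<kappa> ^^ (2 + 6)) x)"
      using r(4) by (simp only: h8)
    show "\<forall>w. v w \<le> 1 \<longrightarrow> (\<exists>\<kappa>\<in>open_disk \<kappa>0 r. (R \<kappa> ^^ (2 + 6)) x = w)"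
      using r(5) by (simp only: h8) blast
  qed (use r(1) tame8 in auto)
  then show ?thesis using that[of "1 / q ^ 12" x] x(1) by simp
qed

text \<open>The disks of consecutive stages are nested and their radii tend to \<open>0\<close>, so that their centres
  form a Cauchy sequence. Its limit lies in all of them, as open disks are closed.\<close>

theorem exists_wandering_orbit:
  assumes complete: "nonarch_complete v"
  obtains \<kappa> x K T where "0 < K" "v \<kappa> = 1" "v (\<kappa>\<^sup>2 - \<kappa> + 1) \<le> q\<^sup>2" "v x = 1 / q"
    "\<And>i. in_zone \<kappa> ((R \<kappa> ^^ i) x)" "\<And>i. growth \<kappa> x i \<le> K" "\<And>N. N \<le> T N"
    "\<And>N. v ((R \<kappa> ^^ T N) x - 1) < 1"
    "\<And>N i. T N - N \<le> i \<Longrightarrow> i < T N \<Longrightarrow> v ((R \<kappa> ^^ i) x) < q"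
proof -
  obtain \<kappa>0 where c0: "centre \<kappa>0" using exists_centre by blast
  obtain x K c r T where s0: "0 < K" "v x = 1 / q" "stage \<kappa>0 x K c r T"
    using exists_first_stage[OF c0] by metis
  define P where "P = (\<lambda>(c, r, T). stage \<kappa>0 x K c r T)"
  define E where "E = (\<lambda>N (c, r, T) (c', r', T'). open_disk c' r' \<subseteq> open_disk c r \<and>
    r' \<le> q ^ N \<and> T + N \<le> T' \<and> (\<forall>\<kappa>\<in>open_disk c' r'. v ((R \<kappa> ^^ T) x - 1) < 1 \<and>
      (\<forall>i. T' - N \<le> i \<longrightarrow> i < T' \<longrightarrow> v ((R \<kappa> ^^ i) x) < q)))"
  have "\<exists>s. \<forall>n. P (s n) \<and> E n (s n) (s (Suc n))"
  proof (rule dependent_nat_choice)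
    show "\<exists>s. P s" using s0(3) by (auto simp: P_def)
    fix s :: "'k \<times> real \<times> nat" and N assume "P s"
    obtain c r T where s: "s = (c, r, T)" by (cases s)
    then have "stage \<kappa>0 x K c r T" using \<open>P s\<close> by (simp add: P_def)
    then obtain c' r' T' where "stage \<kappa>0 x K c' r' T'" "open_disk c' r' \<subseteq> open_disk c r"
      "r' \<le> q ^ N" "T + N \<le> T'"
      "\<And>\<kappa>. \<kappa> \<in> open_disk c' r' \<Longrightarrow> v ((R \<kappa> ^^ T) x - 1) < 1"
      "\<And>\<kappa> i. \<kappa> \<in> open_disk c' r' \<Longrightarrow> T' - N \<le> i \<Longrightarrow> i < T' \<Longrightarrow> v ((R \<kappa> ^^ i) x) < q"
      using stage_extend[OF c0, of x K c r T N] s0(1) by (metis less_imp_le)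
    then show "\<exists>s'. P s' \<and> E N s s'"
      by (intro exI[of _ "(c', r', T')"]) (auto simp: P_def E_def s)
  qed
  then obtain s where s: "\<And>n. P (s n)" "\<And>n. E n (s n) (s (Suc n))" by blast
  define c where "c = (\<lambda>n. fst (s n))"
  define r where "r = (\<lambda>n. fst (snd (s n)))"
  define T where "T = (\<lambda>n. snd (snd (s n)))"
  have sn: "s n = (c n, r n, T n)" for n by (simp add: c_def r_def T_def)
  have st: "stage \<kappa>0 x K (c n) (r n) (T n)" for n
    using s(1)[of n] by (simp add: P_def sn)
  have nest: "open_disk (c (Suc n)) (r (Suc n)) \<subseteq> open_disk (c n) (r n)"
    and rle: "r (Suc n) \<le> q ^ n" and TT: "T n + n \<le> T (Suc n)"
    and crit: "\<And>\<kappa>. \<kappa> \<in> open_disk (c (Suc n)) (r (Suc n)) \<Longrightarrow> v ((R \<kappa> ^^ T n) x - 1) < 1"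
    and gap: "\<And>\<kappa> i. \<kappa> \<in> open_disk (c (Suc n)) (r (Suc n)) \<Longrightarrow> T (Suc n) - n \<le> i \<Longrightarrow> i < T (Suc n) \<Longrightarrow> v ((R \<kappa> ^^ i) x) < q"
    for n
    using s(2)[of n] by (auto simp: E_def sn)
  have rpos: "0 < r n" for n using st[of n] by (simp add: stage_def)
  have nest': "open_disk (c (n + k)) (r (n + k)) \<subseteq> open_disk (c n) (r n)" for n k
    by (induction k) (use nest in auto)
  have cin: "c m \<in> open_disk (c n) (r n)" if "n \<le> m" for m n
  proof -
    have "c m \<in> open_disk (c m) (r m)" using rpos[of m] by simp
    moreover have "open_disk (c m) (r m) \<subseteq> open_disk (c n) (r n)"
      using nest'[of n "m - n"] by (simp only: le_add_diff_inverse[OF that])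
    ultimately show ?thesis by blast
  qed
  interpret M: Metric_space UNIV "\<lambda>x y. v (x - y)" by (rule Metric_space_abs)
  have "M.MCauchy c"
    unfolding M.MCauchy_def
  proof (intro conjI allI impI)
    fix e :: real assume "0 < e"
    then obtain N where N: "q ^ N < e" using ex_q_power_less by blast
    have "v (c n - c n') < e" if "Suc N \<le> n" "Suc N \<le> n'" for n n'
    proof -
      have "v (c n - c (Suc N)) < r (Suc N)" "v (c (Suc N) - c n') < r (Suc N)"
        using cin[OF that(1)] cin[OF that(2)] by (simp_all add: minus_commute)
      then have "v (c n - c n') < r (Suc N)" by (rule dist_trans_less)
      then show ?thesis using rle[of N] N by linarith
    qed
    then show "\<exists>N. \<forall>n n'. N \<le> n \<longrightarrow> N \<le> n' \<longrightarrow> v (c n - c n') < e" by blast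
  qed simp
  then obtain \<kappa> where lim: "limitin M.mtopology c \<kappa> sequentially"
    using complete unfolding nonarch_complete_def M.mcomplete_def by blast
  have k: "\<kappa> \<in> open_disk (c n) (r n)" for n
  proof -
    obtain N where N: "\<And>m. m \<ge> N \<Longrightarrow> v (c m - \<kappa>) < r n"
      using lim rpos[of n] unfolding M.limit_metric_sequentially by blast
    define m where "m = max n N"
    have "v (\<kappa> - c m) < r n" using N[of m] by (simp add: m_def minus_commute)
    moreover have "v (c m - c n) < r n" using cin[of n m] by (simp add: m_def)
    ultimately have "v (\<kappa> - c n) < r n" by (rule dist_trans_less)
    then show ?thesis by simp
  qed
  have "v (\<kappa> - \<kappa>0) \<le> q ^ 12"
    using st[of 0] k[of 0] by (auto simp: stage_def)
  then have adm: "admissible \<kappa>"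
    by (rule critical_orbit_perturb(3)[OF c0 _ order_refl])
  have tame: "tame K \<kappa> x (T n)" for n
    using st[of n] k[of n] by (auto simp: stage_def)
  have Tn: "n \<le> T (Suc n)" for n using TT[of n] by linarith
  show ?thesis
  proof (rule that[of K \<kappa> x "\<lambda>N. T (Suc N)"])
    show "in_zone \<kappa> ((R \<kappa> ^^ i) x)" for i
      using tame[of "Suc (Suc i)"] Tn[of "Suc i"] by (auto simp: tame_def)
    show "growth \<kappa> x i \<le> K" for i
      using tame[of "Suc i"] Tn[of i] by (auto simp: tame_def)
    show "v ((R \<kappa> ^^ T (Suc N)) x - 1) < 1" for N
      using crit[OF k] .
    show "v ((R \<kappa> ^^ i) x) < q" if "T (Suc N) - N \<le> i" "i < T (Suc N)" for N i
      using gap[OF k that] .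
  qed (use s0 adm Tn in \<open>auto simp: admissible_def\<close>)
qed

section \<open>Balls around a tame orbit\<close>

lemma in_zone_not_pole:
  assumes "in_zone \<kappa> x" "v (y - x) < q"
  shows "y \<noteq> \<pi>"
proof
  assume y: "y = \<pi>"
  from assms(1) consider "v (x - 1) < 1" | "v x < q" | "v x = 1 / q"
    by (auto simp: in_zone_def)
  then have "v (\<pi> - x) \<ge> q"
  proof cases
    case 1
    then have "v x = 1" using close_imp_eq[of x 1] by simp
    then show ?thesis using diff_dominant'[of \<pi> x] pi_small by simp
  next
    case 2
    then show ?thesis using diff_dominant[of x \<pi>] by simp
  next
    case 3
    then show ?thesis using diff_dominant'[of \<pi> x] q_less_inverse by simp
  qed
  with assms(2) y show False by simp
qed

lemma slope_near_critical_le: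
  assumes k: "v \<kappa> = 1" and x: "q ^ 4 \<le> v (x - 1)" "v (x - 1) < 1" and r: "r < 1"
    and y: "v (y - x) \<le> r" "v (y' - x) \<le> r"
  shows "v y = 1" "y \<noteq> \<pi>" "v (slope \<kappa> y y') \<le> max ((v (x - 1))\<^sup>2) r"
proof -
  have x1: "v x = 1" using close_imp_eq[of x 1] x by simp
  have vy: "v w = 1" if "v (w - x) \<le> r" for w
    using close_imp_eq[of w x] that r x1 by simp
  show "v y = 1" "y \<noteq> \<pi>" using vy[OF y(1)] unit_region(2) by auto
  define M where "M = max ((v (x - 1))\<^sup>2) r"
  have r0: "0 \<le> r" using y(1) nonneg[of "y - x"] by linarith
  have a: "v ((y - 1)\<^sup>2) \<le> M"
  proof -
    have "v (y - 1) \<le> max (v (x - 1)) r"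
      using add_le[of "y - x" "max (v (x - 1)) r" "x - 1"] y by simp
    then have "(v (y - 1))\<^sup>2 \<le> (max (v (x - 1)) r)\<^sup>2"
      by (intro power_mono) auto
    also have "\<dots> \<le> M"
    proof (cases "v (x - 1) \<le> r")
      case True
      have "r\<^sup>2 \<le> r" using r r0 mult_left_le[of r r] by (simp add: power2_eq_square)
      then show ?thesis using True by (simp add: M_def)
    qed (simp add: M_def max_def)
    finally show ?thesis by (simp add: abs_power)
  qed
  have "(q ^ 4)\<^sup>2 \<le> (v (x - 1))\<^sup>2" using x by (intro power_mono) auto
  then have "q ^ 8 \<le> M" by (simp add: M_def flip: power_mult)
  then have b: "v (2 * (y * (1 - \<pi>))) \<le> M"
    using two_le[of 8] vy[OF y(1)] diff_dominant[of \<pi> 1] pi_small by (simp add: mult)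
  have "v (y' - y) \<le> r"
    using dist_trans_le[OF y(2), of y] y(1) by (simp add: minus_commute)
  then have "v ((y' - y) * (y - \<pi>)) \<le> M"
    using unit_region(1)[OF vy[OF y(1)]] by (simp add: mult M_def)
  then have "v ((y - 1)\<^sup>2 + 2 * (y * (1 - \<pi>)) + (y' - y) * (y - \<pi>)) \<le> M"
    by (intro add_le a b)
  then show "v (slope \<kappa> y y') \<le> max ((v (x - 1))\<^sup>2) r"
    unfolding slope_unit[OF vy[OF y(1)] vy[OF y(2)] k] slope_numerator M_def .
qed

text \<open>Besides surjectivity onto the ball of radius \<open>s\<close>, the predicate requires that each residue
  class of the ball of radius \<open>r\<close> goes into a single residue class. Hence points of
  different classes in the image have preimages in different classes.\<close>

definition ball_onto :: "'k \<Rightarrow> nat \<Rightarrow> 'k \<Rightarrow> real \<Rightarrow> real \<Rightarrow> bool" where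
  "ball_onto \<kappa> n x r s \<longleftrightarrow>
     (\<forall>y. v (y - x) \<le> r \<longrightarrow> (\<forall>i<n. (R \<kappa> ^^ i) y \<noteq> \<pi>) \<and> v ((R \<kappa> ^^ n) y - (R \<kappa> ^^ n) x) \<le> s) \<and>
     (\<forall>y y'. v (y - x) \<le> r \<longrightarrow> v (y' - x) \<le> r \<longrightarrow> v (y - y') < r \<longrightarrow>
        v ((R \<kappa> ^^ n) y - (R \<kappa> ^^ n) y') < s) \<and>
     (\<forall>p. v (p - (R \<kappa> ^^ n) x) \<le> s \<longrightarrow> (\<exists>y. v (y - x) \<le> r \<and> (R \<kappa> ^^ n) y = p))"

text \<open>A ball of radius \<open>r\<close> is scaled by \<open>max f r\<close> with \<open>f = (v (x - 1))\<^sup>2\<close>: small balls by the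
  derivative, larger ones as under squaring. Solving \<open>r * max f r = s\<close> leads to the two cases.\<close>

lemma ball_onto_critical:
  assumes k: "v \<kappa> = 1" and x: "q ^ 4 \<le> v (x - 1)" "v (x - 1) < 1" and s: "0 < s" "s < 1"
  shows "\<exists>r. 0 < r \<and> r < 1 \<and> ball_onto \<kappa> 1 x r s"
proof -
  define f where "f = (v (x - 1))\<^sup>2"
  have vx1: "v (x - 1) > 0" using x q_pos zero_less_power[of q 4] by linarith
  have f: "0 < f" "f < 1"
    unfolding f_def using zero_less_power[OF vx1, of 2] x(2) by (simp_all add: power_less_one_iff)
  define r where "r = (if f\<^sup>2 \<le> s then sqrt s else s / f)"
  have r: "0 < r \<and> r < 1 \<and> r * max f r = s"
  proof (cases "f\<^sup>2 \<le> s")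
    case True
    then have "f \<le> sqrt s" using f by (simp add: real_le_rsqrt)
    then show ?thesis using True s by (simp add: r_def)
  next
    case False
    then have "s / f < f" using f by (simp add: divide_less_eq power2_eq_square)
    moreover have "s < f"
    proof -
      have "f * f < f * 1" using f by (intro mult_strict_left_mono) auto
      then show ?thesis using False unfolding power2_eq_square by linarith
    qed
    ultimately show ?thesis using False s f by (simp add: r_def)
  qed
  have xv: "v x = 1" using close_imp_eq[of x 1] x by simp
  have lip: "v (R \<kappa> y - R \<kappa> y') \<le> max f r * v (y - y')" "y \<noteq> \<pi>"
    if "v (y - x) \<le> r" "v (y' - x) \<le> r" for y y'
  proof -
    have n: "y \<noteq> \<pi>" "y' \<noteq> \<pi>" "v (slope \<kappa> y y') \<le> max f r"
      using slope_near_critical_le[OF k x _ that] slope_near_critical_le[OF k x _ that(2,1)] r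
      by (auto simp: f_def)
    then show "v (R \<kappa> y - R \<kappa> y') \<le> max f r * v (y - y')" "y \<noteq> \<pi>"
      unfolding R_diff[OF n(1,2)] mult by (auto intro: mult_right_mono)
  qed
  have "ball_onto \<kappa> 1 x r s"
    unfolding ball_onto_def
  proof (intro conjI allI impI)
    fix y assume y: "v (y - x) \<le> r"
    show "(R \<kappa> ^^ i) y \<noteq> \<pi>" if "i < 1" for i
      using lip(2)[OF y y] that by simp
    have "v (R \<kappa> y - R \<kappa> x) \<le> max f r * r"
      using lip(1)[OF y, of x] y r by (auto intro: order_trans[OF _ mult_left_mono])
    then show "v ((R \<kappa> ^^ 1) y - (R \<kappa> ^^ 1) x) \<le> s" using r by (simp add: mult.commute)
  next
    fix y y' assume y: "v (y - x) \<le> r" "v (y' - x) \<le> r" "v (y - y') < r"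
    have "v (R \<kappa> y - R \<kappa> y') \<le> max f r * v (y - y')" by (rule lip(1)[OF y(1,2)])
    also have "\<dots> < max f r * r" using y(3) f by (intro mult_strict_left_mono) auto
    finally show "v ((R \<kappa> ^^ 1) y - (R \<kappa> ^^ 1) y') < s" using r by (simp add: mult.commute)
  next
    fix p assume "v (p - (R \<kappa> ^^ 1) x) \<le> s"
    then have p: "v (p - R \<kappa> x) \<le> s" by simp
    obtain P Q where PQ: "R \<kappa> P = p" "R \<kappa> Q = p" "P \<noteq> \<pi>" "Q \<noteq> \<pi>"
      "v (P - x) * v (Q - x) = v (x - \<pi>) * v (p - R \<kappa> x)"
      using R_preimage_distances[OF k unit_region(2)[OF xv]] by metis
    have prod: "v (P - x) * v (Q - x) \<le> s"
      using PQ(5) unit_region(1)[OF xv] p by simp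
    have "\<not> (v (P - x) > r \<and> v (Q - x) > r)"
    proof
      assume big: "v (P - x) > r \<and> v (Q - x) > r"
      show False
      proof (cases "f\<^sup>2 \<le> s")
        case True
        then have "r * r = s" using s by (simp add: r_def)
        moreover have "r * r < v (P - x) * v (Q - x)"
          using big r by (intro mult_strict_mono) auto
        ultimately show False using prod by simp
      next
        case False
        have ge: "f \<le> v (S - x)" if S: "R \<kappa> S = p" "S \<noteq> \<pi>" "v (S - x) > r" for S
        proof (rule ccontr)
          assume "\<not> f \<le> v (S - x)"
          then have lt: "v (S - x) < f" by simp
          have vS: "v S = 1" using close_imp_eq[of S x] lt f xv by simp
          have "(q ^ 4)\<^sup>2 \<le> f" unfolding f_def using x by (intro power_mono) auto
          then have "q ^ 8 \<le> f" by (simp flip: power_mult)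
          then have "v 2 < f" using two_small q_power_strict_mono[of 8 20] by linarith
          then have "v (2 * (x * (1 - \<pi>))) < f"
            using xv diff_dominant[of \<pi> 1] pi_small by (simp add: mult)
          moreover have "v ((S - x) * (x - \<pi>)) < f"
            using lt unit_region(1)[OF xv] by (simp add: mult)
          ultimately have "v (2 * (x * (1 - \<pi>)) + (S - x) * (x - \<pi>)) < v ((x - 1)\<^sup>2)"
            by (simp add: abs_power f_def add_less)
          then have "v (1 + x * S - \<pi> * (x + S)) = f"
            unfolding slope_numerator add.assoc using add_dominant by (simp add: abs_power f_def)
          then have "v (R \<kappa> x - R \<kappa> S) = f * v (x - S)"
            using R_diff[OF unit_region(2)[OF xv] S(2), of \<kappa>] slope_unit[OF xv vS k] by (simp add: mult)
          then have "v (p - R \<kappa> x) = f * v (S - x)"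
            using S(1) by (simp add: minus_commute)
          then have "f * r < s"
            using p mult_strict_left_mono[OF S(3) f(1)] by linarith
          then show False using False f by (simp add: r_def)
        qed
        have "f\<^sup>2 \<le> v (P - x) * v (Q - x)"
          unfolding power2_eq_square using ge big PQ f by (intro mult_mono) auto
        then show False using prod False by simp
      qed
    qed
    then show "\<exists>y. v (y - x) \<le> r \<and> (R \<kappa> ^^ 1) y = p"
      using PQ(1,2) by (auto simp: not_less)
  qed
  then show ?thesis using r by blast
qed

lemma ball_onto_big:
  assumes k: "v \<kappa> = 1" and x: "v x = 1 / q" and s: "0 < s" "s < 1"
  shows "ball_onto \<kappa> 1 x s s"
proof -
  have big: "v y = 1 / q" if "v (y - x) \<le> s" for y
    using close_imp_eq[of y x] that s x one_less_inverse by simp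
  then have iso: "v (R \<kappa> y - R \<kappa> y') = v (y - y')" if "v (y - x) \<le> s" "v (y' - x) \<le> s" for y y'
    using R_isometry_big k that by blast
  have x0: "v (x - x) \<le> s" using s by simp
  have pre: "\<exists>y. v (y - x) \<le> s \<and> R \<kappa> y = p" if "v (p - R \<kappa> x) \<le> s" for p
  proof -
    have "v (p - R \<kappa> x) \<le> 1" using that s by linarith
    then obtain P where "R \<kappa> P = p" "v (P - x) = v (p - R \<kappa> x)"
      using R_preimage_big[OF k x] by metis
    then show ?thesis using that by (intro exI[of _ P]) simp
  qed
  show ?thesis
    unfolding ball_onto_def
    using big_region(2)[OF big] iso iso[OF _ x0] pre by auto
qed

lemma ball_onto_small:
  assumes k: "v \<kappa> = 1" and x: "v x < q" and s: "0 < s" "s \<le> 1"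
  shows "ball_onto \<kappa> 1 x (q\<^sup>2 * s) s"
proof -
  have "q\<^sup>2 * s \<le> q\<^sup>2" using s by (simp add: mult_left_le)
  also have "\<dots> < q" using q_power_strict_mono[of 1 2] by simp
  finally have lt: "q\<^sup>2 * s < q" .
  have small: "v y < q" if "v (y - x) \<le> q\<^sup>2 * s" for y
    using add_less[of "y - x" q x] that lt x by simp
  have exp: "v (R \<kappa> y - R \<kappa> y') = v (y - y') / q\<^sup>2" if "v (y - x) \<le> q\<^sup>2 * s" "v (y' - x) \<le> q\<^sup>2 * s" for y y'
    using R_expand_small[OF small small k] that by blast
  have x0: "v (x - x) \<le> q\<^sup>2 * s" using s by simp
  show ?thesis
    unfolding ball_onto_def
  proof (intro conjI allI impI)
    fix y assume y: "v (y - x) \<le> q\<^sup>2 * s"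
    show "(R \<kappa> ^^ i) y \<noteq> \<pi>" if "i < 1" for i
      using small_region(2)[OF small[OF y]] that by simp
    show "v ((R \<kappa> ^^ 1) y - (R \<kappa> ^^ 1) x) \<le> s"
      using exp[OF y x0] y by (simp add: divide_le_eq mult.commute)
  next
    fix y y' assume y: "v (y - x) \<le> q\<^sup>2 * s" "v (y' - x) \<le> q\<^sup>2 * s" "v (y - y') < q\<^sup>2 * s"
    show "v ((R \<kappa> ^^ 1) y - (R \<kappa> ^^ 1) y') < s"
      using exp[OF y(1,2)] y(3) by (simp add: divide_less_eq mult.commute)
  next
    fix p assume p: "v (p - (R \<kappa> ^^ 1) x) \<le> s"
    then have "v (p - R \<kappa> x) \<le> 1" using s by simp
    then obtain P where P: "R \<kappa> P = p" "v (P - x) = q\<^sup>2 * v (p - R \<kappa> x)"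
      using R_preimage_small[OF k x] by metis
    moreover have "q\<^sup>2 * v (p - R \<kappa> x) \<le> q\<^sup>2 * s" using p by (intro mult_left_mono) auto
    ultimately show "\<exists>y. v (y - x) \<le> q\<^sup>2 * s \<and> (R \<kappa> ^^ 1) y = p"
      by (intro exI[of _ P]) simp
  qed
qed

lemma ball_onto_Suc:
  assumes "ball_onto \<kappa> 1 x r s" "ball_onto \<kappa> n (R \<kappa> x) s t"
  shows "ball_onto \<kappa> (Suc n) x r t"
proof -
  have a: "y \<noteq> \<pi>" "v (R \<kappa> y - R \<kappa> x) \<le> s" if "v (y - x) \<le> r" for y
    using assms(1) that unfolding ball_onto_def by auto
  have a3: "v (R \<kappa> y - R \<kappa> y') < s" if "v (y - x) \<le> r" "v (y' - x) \<le> r" "v (y - y') < r" for y y'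
    using assms(1) that unfolding ball_onto_def by auto
  have a4: "\<exists>y. v (y - x) \<le> r \<and> R \<kappa> y = p" if "v (p - R \<kappa> x) \<le> s" for p
    using assms(1) that unfolding ball_onto_def by auto
  note b = assms(2)[unfolded ball_onto_def]
  have sw: "(R \<kappa> ^^ Suc i) y = (R \<kappa> ^^ i) (R \<kappa> y)" for y i
    by (simp only: funpow_Suc_right comp_apply)
  show ?thesis
    unfolding ball_onto_def
  proof (intro conjI allI impI)
    fix y assume y: "v (y - x) \<le> r"
    show "(R \<kappa> ^^ i) y \<noteq> \<pi>" if "i < Suc n" for i
    proof (cases i)
      case 0
      then show ?thesis using a(1)[OF y] by simp
    next
      case (Suc j)
      then show ?thesis using b a(2)[OF y] that unfolding Suc sw by simp
    qed
    show "v ((R \<kappa> ^^ Suc n) y - (R \<kappa> ^^ Suc n) x) \<le> t"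
      unfolding sw using b a(2)[OF y] by blast
  next
    fix y y' assume y: "v (y - x) \<le> r" "v (y' - x) \<le> r" "v (y - y') < r"
    show "v ((R \<kappa> ^^ Suc n) y - (R \<kappa> ^^ Suc n) y') < t"
      unfolding sw using b a(2)[OF y(1)] a(2)[OF y(2)] a3[OF y] by blast
  next
    fix p assume "v (p - (R \<kappa> ^^ Suc n) x) \<le> t"
    then obtain z where z: "v (z - R \<kappa> x) \<le> s" "(R \<kappa> ^^ n) z = p"
      unfolding sw using b by blast
    then show "\<exists>y. v (y - x) \<le> r \<and> (R \<kappa> ^^ Suc n) y = p"
      unfolding sw using a4[OF z(1)] by blast
  qed
qed

text \<open>The radius is pulled back step by step along the orbit. That it stays below \<open>1\<close> before the last
  step matters near the critical point, where a ball of radius \<open>1\<close> would contain the pole.\<close>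

lemma exists_ball_onto_unit_disk:
  assumes k: "v \<kappa> = 1"
  shows "(\<And>i. i < n \<Longrightarrow> in_zone \<kappa> ((R \<kappa> ^^ i) x)) \<Longrightarrow> v ((R \<kappa> ^^ n) x) = 1 \<Longrightarrow>
    \<exists>r>0. r \<le> 1 \<and> (0 < n \<longrightarrow> r < 1) \<and> ball_onto \<kappa> n x r 1"
proof (induction n arbitrary: x)
  case 0
  have "ball_onto \<kappa> 0 x 1 1" by (auto simp: ball_onto_def)
  then show ?case by (intro exI[of _ 1]) auto
next
  case (Suc n)
  have sw: "(R \<kappa> ^^ i) (R \<kappa> x) = (R \<kappa> ^^ Suc i) x" for i
    by (simp only: funpow_Suc_right comp_apply)
  have "v ((R \<kappa> ^^ n) (R \<kappa> x)) = 1"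
    unfolding sw by (rule Suc.prems(2))
  moreover have "in_zone \<kappa> ((R \<kappa> ^^ i) (R \<kappa> x))" if "i < n" for i
    unfolding sw using that by (intro Suc.prems(1)) simp
  ultimately obtain s where s: "0 < s" "s \<le> 1" "0 < n \<longrightarrow> s < 1" "ball_onto \<kappa> n (R \<kappa> x) s 1"
    using Suc.IH by blast
  have end1: "v (R \<kappa> x) = 1" if "n = 0" using Suc.prems(2) that by simp
  have "in_zone \<kappa> x" using Suc.prems(1)[of 0] by simp
  then consider "q ^ 4 \<le> v (x - 1)" "v (x - 1) < 1" | "v x < q" | "v x = 1 / q" "v (R \<kappa> x) \<noteq> 1"
    by (auto simp: in_zone_def)
  then have "\<exists>r. 0 < r \<and> r < 1 \<and> ball_onto \<kappa> 1 x r s"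
  proof cases
    case 1
    have "v (R \<kappa> x) = 1 / q" using R_near_critical(2)[OF k 1(2)] .
    then have "n > 0" using end1 one_less_inverse by (cases n) auto
    then show ?thesis using ball_onto_critical[OF k 1 s(1)] s(3) by simp
  next
    case 2
    have "q\<^sup>2 * s \<le> q\<^sup>2" using s by (simp add: mult_left_le)
    then have "q\<^sup>2 * s < 1" using q2_bounds by linarith
    then show ?thesis using ball_onto_small[OF k 2 s(1,2)] s(1) by (intro exI[of _ "q\<^sup>2 * s"]) simp
  next
    case 3
    then have "n > 0" using end1 by (cases n) auto
    then show ?thesis using ball_onto_big[OF k 3(1) s(1)] s by (intro exI[of _ s]) simp
  qed
  then obtain r where r: "0 < r" "r < 1" "ball_onto \<kappa> 1 x r s" by blast
  then show ?case
    using ball_onto_Suc[OF r(3) s(4)] by (intro exI[of _ r]) simp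
qed

lemma tame_orbit_lipschitz:
  assumes k: "v \<kappa> = 1" and zone: "\<And>i. in_zone \<kappa> ((R \<kappa> ^^ i) x)" and K: "\<And>i. growth \<kappa> x i \<le> K"
    and y: "v (y - x) \<le> q ^ 10 / K" "v (y' - x) \<le> q ^ 10 / K"
  shows "v ((R \<kappa> ^^ n) y - (R \<kappa> ^^ n) y') \<le> growth \<kappa> x n * v (y - y')" "(R \<kappa> ^^ n) y \<noteq> \<pi>"
proof -
  have K1: "1 \<le> K" using K[of 0] by simp
  have step: "v (R \<kappa> u - R \<kappa> w) \<le> rate z * v (u - w)"
    if z: "in_zone \<kappa> z" and u: "v (u - z) \<le> q ^ 10" "v (w - z) \<le> q ^ 10" for u w z
  proof -
    have q10: "q ^ 10 < q" "q ^ 10 < 1"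
      using q_power_strict_mono[of 1 10] q_power_strict_mono[of 0 10] by auto
    from z consider "q ^ 4 \<le> v (z - 1)" "v (z - 1) < 1" | "v z < q" | "v z = 1 / q"
      by (auto simp: in_zone_def)
    then show ?thesis
    proof cases
      case 1
      note n = slope_near_critical_le[OF k 1 q10(2) u] slope_near_critical_le[OF k 1 q10(2) u(2,1)]
      have "(q ^ 4)\<^sup>2 \<le> (v (z - 1))\<^sup>2" using 1 by (intro power_mono) auto
      then have "q ^ 10 \<le> (v (z - 1))\<^sup>2"
        using q_power_mono[of 8 10] by (simp flip: power_mult)
      then have "v (slope \<kappa> u w) \<le> rate z"
        using n(3) 1 by (simp add: rate_critical)
      then show ?thesis
        unfolding R_diff[OF n(2,5)] mult by (intro mult_right_mono) auto
    next
      case 2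
      then have "v u < q" "v w < q"
        using add_less[of "u - z" q z] add_less[of "w - z" q z] u q10 by auto
      then show ?thesis using R_expand_small[OF _ _ k] 2 by (simp add: rate_small)
    next
      case 3
      then have "v u = 1 / q" "v w = 1 / q"
        using close_imp_eq[of u z] close_imp_eq[of w z] u q10 q_less_inverse by auto
      then show ?thesis using R_isometry_big[OF _ _ k] 3 by (simp add: rate_big)
    qed
  qed
  have bound: "g * d \<le> q ^ 10" if "0 \<le> d" "d \<le> q ^ 10 / K" "g \<le> K" for g d
  proof -
    have "g * d \<le> K * (q ^ 10 / K)" using that K1 by (intro mult_mono) auto
    then show ?thesis using K1 by simp
  qed
  have gen: "v ((R \<kappa> ^^ n) u - (R \<kappa> ^^ n) w) \<le> growth \<kappa> x n * v (u - w)"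
    if "v (u - x) \<le> q ^ 10 / K" "v (w - x) \<le> q ^ 10 / K"
      "\<And>y. v (y - x) \<le> q ^ 10 / K \<Longrightarrow> \<forall>i<n. v ((R \<kappa> ^^ i) y - (R \<kappa> ^^ i) x) \<le> q ^ 10" for n u w
    using that(3)
  proof (induction n)
    case (Suc n)
    then have IH: "v ((R \<kappa> ^^ n) u - (R \<kappa> ^^ n) w) \<le> growth \<kappa> x n * v (u - w)" by auto
    have "v ((R \<kappa> ^^ Suc n) u - (R \<kappa> ^^ Suc n) w)
        \<le> rate ((R \<kappa> ^^ n) x) * v ((R \<kappa> ^^ n) u - (R \<kappa> ^^ n) w)"
      using Suc.prems[OF that(1)] Suc.prems[OF that(2)] zone[of n] by (simp add: step)
    also have "\<dots> \<le> rate ((R \<kappa> ^^ n) x) * (growth \<kappa> x n * v (u - w))"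
      by (intro mult_left_mono IH rate_nonneg)
    finally show ?case by (simp add: growth_Suc mult_ac)
  qed simp
  have near: "\<forall>i<n. v ((R \<kappa> ^^ i) u - (R \<kappa> ^^ i) x) \<le> q ^ 10" if "v (u - x) \<le> q ^ 10 / K" for n u
    using that
  proof (induction n arbitrary: u)
    case (Suc n)
    have "v ((R \<kappa> ^^ n) u - (R \<kappa> ^^ n) x) \<le> growth \<kappa> x n * v (u - x)"
      using Suc K1 by (intro gen) auto
    also have "\<dots> \<le> q ^ 10"
      by (rule bound[OF nonneg Suc.prems K])
    finally show ?case using Suc less_Suc_eq by auto
  qed simp
  show "v ((R \<kappa> ^^ n) y - (R \<kappa> ^^ n) y') \<le> growth \<kappa> x n * v (y - y')"
    using y near by (intro gen) auto
  have "v ((R \<kappa> ^^ n) y - (R \<kappa> ^^ n) x) < q"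
    using near[OF y(1), of "Suc n"] q_power_strict_mono[of 1 10] by (auto intro: le_less_trans)
  then show "(R \<kappa> ^^ n) y \<noteq> \<pi>"
    using in_zone_not_pole[OF zone] by blast
qed

section \<open>Preimages of the repelling fixed point on the unit sphere\<close>

text \<open>The preimages are found backwards. Twice the larger root is chosen, on the sphere of radius
  \<open>1 / q\<close>. For the third step, \<open>\<kappa>\<^sup>2 - \<kappa> + 1 \<approx> 0\<close> makes the sum of the two roots at most \<open>1\<close> in absolute
  value, and as their product is a unit, both are units.\<close>

lemma exists_unit_preimage:
  assumes k: "v \<kappa> = 1" "v (\<kappa>\<^sup>2 - \<kappa> + 1) \<le> q\<^sup>2" and w: "v w \<le> 1"
  obtains p where "v p = 1" "v (R \<kappa> p) = 1 / q" "v (R \<kappa> (R \<kappa> p)) = 1 / q" "R \<kappa> (R \<kappa> (R \<kappa> p)) = w"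
proof -
  have k0: "\<kappa> \<noteq> 0" using k by auto
  have k1: "v (1 - \<kappa>) = 1" using one_minus_parameter[OF k] .
  define g where "g = 1 / \<pi>"
  have g: "v g = 1 / q" "q\<^sup>2 * v g = q" by (simp_all add: g_def abs_divide power2_eq_square)
  have sq: "1 < (1 / q)\<^sup>2" using one_less_inverse one_less_power[of "1 / q" 2] by simp
  have large: "\<exists>P Q. R \<kappa> P = u \<and> v P = 1 / q \<and> P + Q = g - u / \<kappa> \<and> v Q \<le> 1"
    if S: "v (g - u / \<kappa>) = 1 / q" and u: "v u \<le> 1 / q" for u
  proof -
    obtain P Q where PQ: "P + Q = g - u / \<kappa>" "P * Q = - (u * \<pi> / \<kappa>)" "R \<kappa> P = u" "R \<kappa> Q = u"
      using R_preimages[OF k0, of u] unfolding g_def by metis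
    have M1: "v (P * Q) \<le> 1"
      unfolding PQ(2) using u k(1) mult_right_mono[OF u, of q] by (simp add: abs_simps)
    then have M: "v (P * Q) < (1 / q)\<^sup>2" using sq by linarith
    have S': "v (P + Q) = 1 / q" using PQ(1) S by simp
    have le: "v (P * Q) / (1 / q) \<le> 1"
      using M1 pi_small mult_mono[OF M1, of q 1] by simp
    show ?thesis
    proof (cases "v P \<ge> v Q")
      case True
      then show ?thesis
        using roots_of_different_size[OF S' M] PQ le by metis
    next
      case False
      then have "v Q = 1 / q" "v P = v (Q * P) / (1 / q)"
        using roots_of_different_size[of Q P "1 / q"] S' M by (simp_all add: add.commute mult.commute)
      then show ?thesis
        using PQ le by (metis add.commute mult.commute)
    qed
  qed
  have "v (g - w / \<kappa>) = 1 / q"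
    using diff_dominant[of "w / \<kappa>" g] w k(1) g one_less_inverse by (simp add: abs_divide)
  then obtain q1 where q1: "R \<kappa> q1 = w" "v q1 = 1 / q"
    using large[of w] w one_less_inverse by auto
  have q1g: "v (q1 - g) \<le> 1"
    using R_isometry_big[OF q1(2) g(1) k(1)] q1(1) w by (simp add: g_def)
  have "g - q1 / \<kappa> = (- (1 - \<kappa>) * g - (q1 - g)) / \<kappa>"
    using k0 by (simp add: field_simps)
  moreover have "v (- (1 - \<kappa>) * g - (q1 - g)) = 1 / q"
  proof -
    have "v (- (1 - \<kappa>) * g) = 1 / q" unfolding mult minus using k1 g by simp
    then show ?thesis
      using diff_dominant[of "q1 - g" "- (1 - \<kappa>) * g"] q1g one_less_inverse by simp
  qed
  ultimately have "v (g - q1 / \<kappa>) = 1 / q" using k(1) by (simp add: abs_divide)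
  then obtain q2 Q where q2: "R \<kappa> q2 = q1" "v q2 = 1 / q" "q2 + Q = g - q1 / \<kappa>" "v Q \<le> 1"
    using large[of q1] q1(2) by auto
  obtain p p' where p: "p + p' = g - q2 / \<kappa>" "p * p' = - (q2 * \<pi> / \<kappa>)" "R \<kappa> p = q2"
    using R_preimages[OF k0, of q2] unfolding g_def by metis
  have prod: "v p * v p' = 1"
    using arg_cong[OF p(2), of v] q2(2) k(1) by (simp add: abs_simps)
  have sum: "v (p + p') \<le> 1"
  proof -
    have q2': "q2 = g - q1 / \<kappa> - Q" using q2(3) by (simp add: algebra_simps)
    have "p + p' = ((\<kappa>\<^sup>2 - \<kappa> + 1) * g + (q1 - g) + \<kappa> * Q) / \<kappa>\<^sup>2"
      unfolding p(1) q2' using k0 by (simp add: field_simps power2_eq_square)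
    moreover have "v ((\<kappa>\<^sup>2 - \<kappa> + 1) * g) \<le> q"
      using mult_right_mono[OF k(2), of "v g"] g(2) by (simp only: mult) simp
    then have "v ((\<kappa>\<^sup>2 - \<kappa> + 1) * g + (q1 - g) + \<kappa> * Q) \<le> 1"
      using q1g q2(4) k(1) pi_small by (intro add_le) (auto simp: mult)
    ultimately show ?thesis using k(1) by (simp add: abs_simps)
  qed
  have "v p = 1"
  proof (rule ccontr)
    assume "v p \<noteq> 1"
    have pos: "v p > 0"
      using prod by (auto simp: pos_iff)
    have p': "v p' = 1 / v p"
    proof -
      have "p \<noteq> 0" using pos by auto
      then show ?thesis using prod by (simp add: eq_divide_eq mult.commute)
    qed
    from \<open>v p \<noteq> 1\<close> consider "v p > 1" | "v p < 1" by linarith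
    then show False
    proof cases
      case 1
      then have "v p' < 1" using p' by simp
      then have "v (p + p') = v p" using 1 by (intro add_dominant) linarith
      then show False using 1 sum by linarith
    next
      case 2
      then have "v p' > 1" using p' pos by simp
      then have "v (p' + p) = v p'" using 2 by (intro add_dominant) linarith
      then show False using \<open>v p' > 1\<close> sum add.commute[of p p'] by (simp only:)
    qed
  qed
  then show ?thesis using that[of p] p(3) q2 q1 by simp
qed

text \<open>Consequently two points of a backward orbit of \<open>0\<close> that share a residue class would still do so
  after having been pushed forward until one of them is \<open>0\<close>, while the other is a unit.\<close>

lemma unit_sphere_nonexpanding:
  assumes k: "v \<kappa> = 1" and y: "v y = 1" "v (R \<kappa> (R \<kappa> y)) = 1 / q" and y': "v (y - y') < 1"
  shows "v (R \<kappa> (R \<kappa> (R \<kappa> y)) - R \<kappa> (R \<kappa> (R \<kappa> y'))) < 1"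
proof -
  have vy': "v y' = 1" using close_imp_eq[of y' y] y y' by (simp add: minus_commute)
  have "v (slope \<kappa> y y') \<le> 1"
    unfolding slope_unit[OF y(1) vy' k]
  proof (intro diff_le add_le)
    show "v (\<pi> * (y + y')) \<le> 1"
      using add_le[of y 1 y'] y vy' pi_small mult_mono[of q 1 "v (y + y')" 1] by (simp add: mult)
  qed (use y vy' in \<open>auto simp: mult\<close>)
  then have "v (slope \<kappa> y y') * v (y - y') \<le> 1 * v (y - y')"
    by (intro mult_right_mono) auto
  then have 1: "v (R \<kappa> y - R \<kappa> y') < 1"
    using R_diff[OF unit_region(2)[OF y(1)] unit_region(2)[OF vy'], of \<kappa>] y' by (simp add: mult)
  have b: "v (R \<kappa> y) = 1 / q" "v (R \<kappa> y') = 1 / q"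
    using unit_region(3)[OF _ k] y vy' by auto
  have 2: "v (R \<kappa> (R \<kappa> y) - R \<kappa> (R \<kappa> y')) < 1"
    using R_isometry_big[OF b k] 1 by simp
  then have "v (R \<kappa> (R \<kappa> y')) = 1 / q"
    using close_imp_eq[of "R \<kappa> (R \<kappa> y')" "R \<kappa> (R \<kappa> y)"] y(2) one_less_inverse
    by (simp add: minus_commute)
  then show ?thesis
    using R_isometry_big[OF y(2) _ k] 2 by simp
qed

lemma exists_separated_backward_orbit:
  assumes k: "v \<kappa> = 1" "v (\<kappa>\<^sup>2 - \<kappa> + 1) \<le> q\<^sup>2"
  obtains p :: "nat \<Rightarrow> 'k" where "\<And>i. v (p i) = 1" "(R \<kappa> ^^ 3) (p 0) = 0"
    "\<And>i. (R \<kappa> ^^ 3) (p (Suc i)) = p i" "\<And>i j. j < 3 \<Longrightarrow> (R \<kappa> ^^ j) (p i) \<noteq> \<pi>"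
    "\<And>i j. i \<noteq> j \<Longrightarrow> 1 \<le> v (p i - p j)"
proof -
  define G where "G = (\<lambda>p w. v p = 1 \<and> v (R \<kappa> p) = 1 / q \<and> v (R \<kappa> (R \<kappa> p)) = 1 / q \<and> R \<kappa> (R \<kappa> (R \<kappa> p)) = w)"
  have ex: "\<exists>p. G p w" if "v w \<le> 1" for w
    using exists_unit_preimage[OF k that] unfolding G_def by metis
  obtain p0 where p0: "G p0 0" using ex[of 0] by auto
  have "\<exists>p. \<forall>n. (v (p n) = 1 \<and> (n = 0 \<longrightarrow> p n = p0)) \<and> G (p (Suc n)) (p n)"
  proof (rule dependent_nat_choice)
    show "\<exists>x. v x = 1 \<and> (0 = (0::nat) \<longrightarrow> x = p0)" using p0 by (auto simp: G_def)
    fix x :: 'k and n :: nat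
    assume "v x = 1 \<and> (n = 0 \<longrightarrow> x = p0)"
    then obtain y where "G y x" using ex[of x] by auto
    then show "\<exists>y. (v y = 1 \<and> (Suc n = 0 \<longrightarrow> y = p0)) \<and> G y x"
      by (auto simp: G_def)
  qed
  then obtain p where p: "\<And>n. v (p n) = 1" "p 0 = p0" "\<And>n. G (p (Suc n)) (p n)"
    by blast
  have G: "\<exists>w. G (p n) w" for n
    using p p0 by (cases n) auto
  have sep: "1 \<le> v (p i - p (i + Suc d))" for i d
  proof (induction i)
    case 0
    show ?case
    proof (rule ccontr)
      assume "\<not> ?case"
      then have "v (R \<kappa> (R \<kappa> (R \<kappa> (p 0))) - R \<kappa> (R \<kappa> (R \<kappa> (p (Suc d))))) < 1"
        using p0 p(2) by (intro unit_sphere_nonexpanding k) (auto simp: G_def)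
      then have "v (0 - p d) < 1"
        using p0 p(2) p(3)[of d] by (simp add: G_def)
      then show False using p(1)[of d] by simp
    qed
  next
    case (Suc i)
    show ?case
    proof (rule ccontr)
      assume "\<not> ?case"
      then have "v (R \<kappa> (R \<kappa> (R \<kappa> (p (Suc i)))) - R \<kappa> (R \<kappa> (R \<kappa> (p (Suc i + Suc d))))) < 1"
        using p(3)[of i] by (intro unit_sphere_nonexpanding k) (auto simp: G_def)
      then have "v (p i - p (i + Suc d)) < 1"
        using p(3)[of i] p(3)[of "i + Suc d"] by (simp add: G_def)
      then show False using Suc by simp
    qed
  qed
  show ?thesis
  proof (rule that[of p])
    show "v (p i) = 1" for i by (rule p(1))
    show "(R \<kappa> ^^ 3) (p 0) = 0" using p0 p(2) by (simp add: iterate_3 G_def)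
    show "(R \<kappa> ^^ 3) (p (Suc i)) = p i" for i using p(3)[of i] by (simp add: iterate_3 G_def)
    show "(R \<kappa> ^^ j) (p i) \<noteq> \<pi>" if "j < 3" for i j
    proof -
      obtain w where "G (p i) w" using G by blast
      then have "p i \<noteq> \<pi>" "R \<kappa> (p i) \<noteq> \<pi>" "R \<kappa> (R \<kappa> (p i)) \<noteq> \<pi>"
        using unit_region(2) big_region(2) by (auto simp: G_def)
      moreover have "j = 0 \<or> j = 1 \<or> j = 2" using that by linarith
      ultimately show ?thesis by (auto simp: iterate_2)
    qed
    show "1 \<le> v (p i - p j)" if "i \<noteq> j" for i j
    proof (cases "i < j")
      case True
      then show ?thesis using sep[of i "j - Suc i"] by simp
    next
      case False
      then show ?thesis using that sep[of j "i - Suc j"] by (simp add: minus_commute)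
    qed
  qed
qed

end

section \<open>Fatou components on the projective line\<close>

context nonarch_abs
begin

lemma chordal_Fin_le: "chordal v (Fin x) (Fin y) \<le> v (x - y)"
proof -
  have "1 * 1 \<le> max 1 (v x) * max 1 (v y)" by (intro mult_mono) auto
  then have "v (x - y) / (max 1 (v x) * max 1 (v y)) \<le> v (x - y) / 1"
    by (intro divide_left_mono nonneg) auto
  then show ?thesis by simp
qed

text \<open>A connected affinoid that contains the centre of a ball and a point at distance at least
  \<open>r\<close> meets all but finitely many residue classes of the ball of radius \<open>r\<close>:
  each of the removed open disks meets at most one of them.\<close>

lemma affinoid_meets_separated_set:
  assumes X: "connected_affinoid v X" and a: "Fin a \<in> X"
    and u: "u \<in> X" "u = Infty \<or> (\<exists>b. u = Fin b \<and> r \<le> v (b - a))"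
    and s: "\<And>i. v (s i - a) \<le> r" "\<And>i j. i \<noteq> j \<Longrightarrow> r \<le> v (s i - s j)"
  shows "\<exists>i::nat. Fin (s i) \<in> X"
proof (rule ccontr)
  assume neg: "\<not> ?thesis"
  obtain \<D> where D: "finite \<D>" "\<And>D. D \<in> \<D> \<Longrightarrow> P1_open_disk v D" "X = - \<Union>\<D>"
    using X unfolding connected_affinoid_def by blast
  have one: "i = j" if D': "D \<in> \<D>" and ij: "Fin (s i) \<in> D" "Fin (s j) \<in> D" for D i j
  proof (rule ccontr)
    assume ne: "i \<noteq> j"
    have aD: "Fin a \<notin> D" "u \<notin> D" using a u D(3) D' by auto
    from D(2)[OF D'] show False
    proof cases
      case (1 \<rho> e)
      have i: "v (s i - e) < \<rho>" and j: "v (s j - e) < \<rho>"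
        using ij 1 by auto
      have "v (s i - s j) < \<rho>"
        using dist_trans_less[OF i, of "s j"] j by (simp add: minus_commute)
      then have "r < \<rho>" using s(2)[OF ne] by linarith
      then have "v (a - s i) < \<rho>" using s(1)[of i] by (simp add: minus_commute)
      then have "v (a - e) < \<rho>" using i by (rule dist_trans_less)
      then show False using aD 1 by auto
    next
      case (2 \<rho> e)
      have "u \<noteq> Infty" using aD 2 by auto
      then obtain b where b: "u = Fin b" "r \<le> v (b - a)" using u by auto
      have be: "v (b - e) \<le> \<rho>" using aD 2 b by (auto simp: not_less)
      have ae: "v (a - e) \<le> \<rho>" using aD 2 by (auto simp: not_less)
      have "v (b - a) \<le> \<rho>"
        using dist_trans_le[OF be, of a] ae by (simp add: minus_commute)
      then have "v (s i - a) \<le> \<rho>" using b(2) s(1)[of i] by linarith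
      then have "v (s i - e) \<le> \<rho>" using ae by (rule dist_trans_le)
      then show False using ij 2 by auto
    qed
  qed
  have cover: "\<exists>D\<in>\<D>. Fin (s i) \<in> D" for i
    using neg D(3) by auto
  then obtain h where h: "\<And>i. h i \<in> \<D> \<and> Fin (s i) \<in> h i" by metis
  have "inj h"
    using one h by (metis injI)
  then have "infinite (range h)" by (simp add: finite_image_iff)
  moreover have "range h \<subseteq> \<D>" using h by auto
  ultimately show False using D(1) finite_subset by blast
qed

end

context quadratic_family
begin

text \<open>The map on the projective line for \<open>a = - \<kappa> / \<pi>\<^sup>2\<close> and \<open>b = - 1 / \<kappa>\<close>, in the original coordinate
  \<open>z = \<pi> x\<close>.\<close>

definition action :: "'k \<Rightarrow> 'k P1 \<Rightarrow> 'k P1" where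
  "action \<kappa> = eval_ratio [:0, -1, 1:] [:\<pi>\<^sup>2 / \<kappa>, - (1 / \<kappa>):]"

lemma action_Fin:
  assumes "\<kappa> \<noteq> 0"
  shows "action \<kappa> (Fin (\<pi> * x)) = (if x = \<pi> then Infty else Fin (\<pi> * R \<kappa> x))"
proof -
  have q: "poly [:\<pi>\<^sup>2 / \<kappa>, - (1 / \<kappa>):] (\<pi> * x) = - (\<pi> * (x - \<pi>)) / \<kappa>"
    using assms by (simp add: field_simps power2_eq_square)
  have p: "poly [:0, -1, 1:] (\<pi> * x) = - (\<pi> * (x * (1 - \<pi> * x)))"
    by (simp add: algebra_simps)
  have "poly [:0, -1, 1:] (\<pi> * x) / poly [:\<pi>\<^sup>2 / \<kappa>, - (1 / \<kappa>):] (\<pi> * x) = \<pi> * R \<kappa> x" if "x \<noteq> \<pi>"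
    unfolding p q R_def using that assms by (simp add: field_simps)
  then show ?thesis
    using assms unfolding action_def eval_ratio.simps q by auto
qed

lemma action_iterate:
  assumes "\<kappa> \<noteq> 0" "\<And>i. i < n \<Longrightarrow> (R \<kappa> ^^ i) x \<noteq> \<pi>"
  shows "(action \<kappa> ^^ n) (Fin (\<pi> * x)) = Fin (\<pi> * (R \<kappa> ^^ n) x)"
  using assms(2) by (induction n) (simp_all add: action_Fin[OF assms(1)])

lemma finite_action_fibre:
  assumes "\<kappa> \<noteq> 0"
  shows "finite {x. action \<kappa> x = w}"
proof -
  define p :: "'k poly" where "p = [:0, -1, 1:]"
  define d where "d = [:\<pi>\<^sup>2 / \<kappa>, - (1 / \<kappa>):]"
  have d0: "d \<noteq> 0" using assms by (simp add: d_def)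
  have pd: "p - smult c d \<noteq> 0" for c
    by (simp add: p_def d_def)
  have "{x. action \<kappa> x = w} \<subseteq> insert Infty (Fin ` {z. poly d z = 0} \<union>
    Fin ` {z. poly (p - smult (case w of Fin c \<Rightarrow> c | Infty \<Rightarrow> 0) d) z = 0})"
  proof
    fix x assume "x \<in> {x. action \<kappa> x = w}"
    then have x: "eval_ratio p d x = w" by (simp add: action_def p_def d_def)
    show "x \<in> insert Infty (Fin ` {z. poly d z = 0} \<union>
      Fin ` {z. poly (p - smult (case w of Fin c \<Rightarrow> c | Infty \<Rightarrow> 0) d) z = 0})"
    proof (cases x)
      case (Fin z)
      then show ?thesis using x by (cases "poly d z = 0") (auto simp: field_simps)
    qed simp
  qed
  then show ?thesis
    using finite_subset poly_roots_finite[OF d0] poly_roots_finite[OF pd] by blast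
qed

lemma finite_action_iterate_fibre:
  assumes "\<kappa> \<noteq> 0"
  shows "finite {x. (action \<kappa> ^^ n) x = w}"
proof (induction n)
  case (Suc n)
  have "{x. (action \<kappa> ^^ Suc n) x = w} = (\<Union>y\<in>{y. (action \<kappa> ^^ n) y = w}. {x. action \<kappa> x = y})"
    by (auto simp: funpow_swap1)
  then show ?case
    using Suc finite_action_fibre[OF assms] by simp
qed simp

text \<open>Arbitrarily close to such a point there are points that miss \<open>0\<close> after \<open>n\<close> steps, because
  fibres are finite. Under equicontinuity they would have to stay near \<open>0\<close> forever, but \<open>0\<close> is
  repelling.\<close>

lemma preimage_of_repelling_not_fatou:
  assumes k: "v \<kappa> = 1" and n: "(action \<kappa> ^^ n) (Fin z) = Fin 0"
  shows "Fin z \<notin> fatou_set v (action \<kappa>)"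
proof
  interpret C: Metric_space UNIV "chordal v" by (rule Metric_space_chordal)
  have k0: "\<kappa> \<noteq> 0" using k by auto
  assume "Fin z \<in> fatou_set v (action \<kappa>)"
  then obtain U where U: "openin C.mtopology U" "Fin z \<in> U"
    "equicontinuous_on (chordal v) U (range (\<lambda>n. action \<kappa> ^^ n))"
    by (auto simp: fatou_set_def)
  obtain r where r: "r > 0" "C.mball (Fin z) r \<subseteq> U"
    using U C.openin_mtopology by blast
  obtain d where d: "d > 0" "\<And>y m. y \<in> U \<Longrightarrow> chordal v (Fin z) y < d \<Longrightarrow>
      chordal v ((action \<kappa> ^^ m) (Fin z)) ((action \<kappa> ^^ m) y) < q ^ 3"
    using U(2,3) unfolding equicontinuous_on_def by (meson q_pos rangeI zero_less_power)
  obtain J where J: "q ^ J < min r d" using ex_q_power_less[of "min r d"] r d by auto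
  define y where "y = (\<lambda>j. Fin (z + \<pi> ^ (J + j)))"
  have "inj y"
  proof (rule injI)
    fix i j assume "y i = y j"
    then have "q ^ (J + i) = q ^ (J + j)" by (metis (no_types) P1.inject abs_power add_left_cancel y_def)
    then show "i = j"
      using q_power_strict_mono[of "J + i" "J + j"] q_power_strict_mono[of "J + j" "J + i"]
      by (cases i j rule: linorder_cases) auto
  qed
  then have "infinite (range y)" by (simp add: finite_image_iff)
  then have "\<not> range y \<subseteq> {P. (action \<kappa> ^^ n) P = Fin 0}"
    using finite_action_iterate_fibre[OF k0, of n "Fin 0"] finite_subset by blast
  then obtain j where j: "(action \<kappa> ^^ n) (y j) \<noteq> Fin 0"
    by blast
  have "chordal v (Fin z) (y j) \<le> q ^ (J + j)"
    using chordal_Fin_le[of z "z + \<pi> ^ (J + j)"] by (simp add: y_def abs_power)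
  also have "\<dots> \<le> q ^ J" by (rule q_power_mono) simp
  finally have cj: "chordal v (Fin z) (y j) < min r d" using J by linarith
  then have yU: "y j \<in> U" using r(2) by (auto simp: C.in_mball)
  have fix0: "(action \<kappa> ^^ m) (Fin 0) = Fin 0" for m
    using action_iterate[OF k0, of m 0] by simp
  define w where "w = (\<lambda>m. (action \<kappa> ^^ m) ((action \<kappa> ^^ n) (y j)))"
  have w: "chordal v (Fin 0) (w m) < q ^ 3" for m
  proof -
    have "chordal v ((action \<kappa> ^^ (n + m)) (Fin z)) ((action \<kappa> ^^ (n + m)) (y j)) < q ^ 3"
      using d(2)[OF yU] cj by simp
    then show ?thesis unfolding funpow_add_apply n fix0 w_def .
  qed
  have ex: "\<exists>x. w m = Fin (\<pi> * x) \<and> v x < q" for m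
  proof (cases "w m")
    case (Fin c)
    have q3: "q ^ 3 < 1" using q_power_strict_mono[of 0 3] by simp
    have c: "v c / max 1 (v c) < q ^ 3" using w[of m] Fin by simp
    have "v c \<le> 1"
    proof (rule ccontr)
      assume "\<not> v c \<le> 1"
      then have "v c > 1" by simp
      moreover from this have "v c \<noteq> 0" by linarith
      ultimately have "v c / max 1 (v c) = 1" by simp
      then show False using c q3 by linarith
    qed
    then have "v c < q ^ 3" using c by simp
    moreover have "q ^ 3 \<le> q\<^sup>2" by (rule q_power_mono) simp
    ultimately have "v (c / \<pi>) < q\<^sup>2 / q"
      unfolding abs_divide by (intro divide_strict_right_mono) auto
    then have "v (c / \<pi>) < q" by (simp add: power2_eq_square)
    then show ?thesis using Fin by (intro exI[of _ "c / \<pi>"]) simp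
  next
    case Infty
    then have "1 < q ^ 3" using w[of m] by simp
    then show ?thesis using q_power_mono[of 0 3] by simp
  qed
  then obtain x where x: "\<And>m. w m = Fin (\<pi> * x m)" "\<And>m. v (x m) < q" by metis
  have "x (Suc m) = R \<kappa> (x m)" for m
  proof -
    have "Fin (\<pi> * x (Suc m)) = action \<kappa> (Fin (\<pi> * x m))"
      using x(1)[of "Suc m"] x(1)[of m] by (simp add: w_def)
    then show ?thesis using action_Fin[OF k0, of "x m"] small_region(2)[OF x(2)] by simp
  qed
  then have grow: "v (x m) = v (x 0) / q ^ (2 * m)" for m
    by (induction m) (simp_all add: small_region(4)[OF x(2) k] power2_eq_square)
  have "x 0 \<noteq> 0" using j x(1)[of 0] by (auto simp: w_def)
  then have "0 < v (x 0)" by (simp add: pos_iff)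
  then obtain m where m: "q ^ m < v (x 0)" using ex_q_power_less by blast
  have "q ^ (2 * m) \<le> q ^ m" by (rule q_power_mono) simp
  then have "1 < v (x 0) / q ^ (2 * m)" using m by (simp add: less_divide_eq)
  then show False using grow[of m] x(2)[of m] pi_small by linarith
qed

lemma tame_orbit_fatou:
  assumes k: "v \<kappa> = 1" and x: "v x = 1 / q" and zone: "\<And>i. in_zone \<kappa> ((R \<kappa> ^^ i) x)"
    and K: "0 < K" "\<And>i. growth \<kappa> x i \<le> K" and u: "v (u - x) < q ^ 10 / K"
  shows "Fin (\<pi> * u) \<in> fatou_set v (action \<kappa>)"
proof -
  interpret C: Metric_space UNIV "chordal v" by (rule Metric_space_chordal)
  have k0: "\<kappa> \<noteq> 0" using k by auto
  define \<rho> where "\<rho> = q ^ 10 / K"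
  have K1: "1 \<le> K" using K(2)[of 0] by simp
  have \<rho>: "0 < \<rho>" "\<rho> \<le> 1"
  proof -
    have "q ^ 10 \<le> 1" using q_power_mono[of 0 10] by simp
    then have "q ^ 10 \<le> K" using K1 by linarith
    then show "0 < \<rho>" "\<rho> \<le> 1" using K(1) by (simp_all add: \<rho>_def divide_le_eq)
  qed
  define U where "U = Fin ` {z. v (z - \<pi> * x) < q * \<rho>}"
  have "q * \<rho> \<le> q" using \<rho> by (intro mult_left_le) auto
  then have qr: "q * \<rho> < 1" using pi_small by linarith
  have vx: "v (\<pi> * x) = 1" using x by (simp add: mult)
  have one: "v z = 1" if "v (z - \<pi> * x) < q * \<rho>" for z
    using close_imp_eq[of z "\<pi> * x"] that qr vx by simp
  have rep: "\<exists>y. z = \<pi> * y \<and> v (y - x) < \<rho>" if "v (z - \<pi> * x) < q * \<rho>" for z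
  proof -
    have "v (\<pi> * (z / \<pi> - x)) < q * \<rho>" using that by (simp add: algebra_simps)
    then show ?thesis by (intro exI[of _ "z / \<pi>"]) (simp add: mult)
  qed
  have "openin C.mtopology U"
    unfolding C.openin_mtopology
  proof (intro conjI allI impI)
    fix P assume "P \<in> U"
    then obtain z where z: "P = Fin z" "v (z - \<pi> * x) < q * \<rho>" by (auto simp: U_def)
    have "C.mball P (q * \<rho>) \<subseteq> U"
    proof
      fix Q assume "Q \<in> C.mball P (q * \<rho>)"
      then have Q: "chordal v (Fin z) Q < q * \<rho>" by (simp add: C.in_mball z)
      show "Q \<in> U"
      proof (cases Q)
        case (Fin y)
        have vz: "v z = 1" using one[OF z(2)] .
        have c: "v (z - y) / max 1 (v y) < q * \<rho>" using Q Fin vz by simp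
        have "v y \<le> 1"
        proof (rule ccontr)
          assume "\<not> v y \<le> 1"
          then have y: "v y > 1" by simp
          then have "v (z - y) = v y" using diff_dominant'[of z y] vz by simp
          moreover have "v y \<noteq> 0" using y by linarith
          ultimately have "v (z - y) / max 1 (v y) = 1" using y by simp
          then show False using c qr by linarith
        qed
        then have "v (y - z) < q * \<rho>" using c by (simp add: minus_commute)
        then have "v (y - \<pi> * x) < q * \<rho>" using z(2) by (rule dist_trans_less)
        then show ?thesis using Fin by (simp add: U_def)
      next
        case Infty
        then show ?thesis using Q one[OF z(2)] qr by simp
      qed
    qed
    then show "\<exists>r>0. C.mball P r \<subseteq> U" using \<rho> by (intro exI[of _ "q * \<rho>"]) simp
  qed simp
  moreover have "equicontinuous_on (chordal v) U (range (\<lambda>n. action \<kappa> ^^ n))"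
    unfolding equicontinuous_on_def
  proof (intro ballI allI impI)
    fix P :: "'k P1" and e :: real assume P: "P \<in> U" and e: "0 < e"
    show "\<exists>d>0. \<forall>Q\<in>U. chordal v P Q < d \<longrightarrow> (\<forall>f\<in>range (\<lambda>n. action \<kappa> ^^ n). chordal v (f P) (f Q) < e)"
    proof (intro exI[of _ "e / K"] conjI ballI impI)
      show "0 < e / K" using e K(1) by simp
      fix Q f assume Q: "Q \<in> U" "chordal v P Q < e / K" and f: "f \<in> range (\<lambda>n. action \<kappa> ^^ n)"
      from f obtain n where f: "f = action \<kappa> ^^ n" by auto
      obtain a b where ab: "P = Fin a" "v (a - \<pi> * x) < q * \<rho>" "Q = Fin b" "v (b - \<pi> * x) < q * \<rho>"
        using P Q(1) by (auto simp: U_def)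
      obtain s t where s: "a = \<pi> * s" "v (s - x) < \<rho>" and t: "b = \<pi> * t" "v (t - x) < \<rho>"
        using rep[OF ab(2)] rep[OF ab(4)] by blast
      have s': "v (s - x) \<le> q ^ 10 / K" and t': "v (t - x) \<le> q ^ 10 / K"
        using s t by (simp_all add: \<rho>_def)
      have "f P = Fin (\<pi> * (R \<kappa> ^^ n) s)" "f Q = Fin (\<pi> * (R \<kappa> ^^ n) t)"
        unfolding f ab s t
        using tame_orbit_lipschitz(2)[OF k zone K(2) s' s'] tame_orbit_lipschitz(2)[OF k zone K(2) t' t']
        by (intro action_iterate[OF k0]; simp)+
      then have "chordal v (f P) (f Q) \<le> v (\<pi> * (R \<kappa> ^^ n) s - \<pi> * (R \<kappa> ^^ n) t)"
        using chordal_Fin_le by simp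
      also have "\<dots> = q * v ((R \<kappa> ^^ n) s - (R \<kappa> ^^ n) t)"
        by (metis mult right_diff_distrib)
      also have "\<dots> \<le> q * (K * v (s - t))"
        using tame_orbit_lipschitz(1)[OF k zone K(2) s' t', of n] mult_right_mono[OF K(2)[of n], of "v (s - t)"]
        by (intro mult_left_mono) auto
      also have "\<dots> = K * v (a - b)"
        by (simp add: s t mult flip: right_diff_distrib)
      also have "v (a - b) = chordal v P Q"
        using one[OF ab(2)] one[OF ab(4)] by (simp add: ab)
      also have "K * chordal v P Q < K * (e / K)"
        using Q(2) K(1) by (intro mult_strict_left_mono) auto
      finally show "chordal v (f P) (f Q) < e" using K(1) by simp
    qed
  qed
  moreover have "Fin (\<pi> * u) \<in> U"
  proof -
    have "v (\<pi> * u - \<pi> * x) = q * v (u - x)" by (metis mult right_diff_distrib)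
    then have "v (\<pi> * u - \<pi> * x) < q * \<rho>" using u by (simp only: \<rho>_def mult_less_cancel_left_pos q_pos)
    then show ?thesis by (simp add: U_def)
  qed
  ultimately show ?thesis unfolding fatou_set_def by blast
qed

text \<open>Pull the unit disk back to a ball around \<open>x\<close>. An affinoid containing \<open>x\<close> and a point at least
  as far away as the radius of this ball meets almost all of its residue classes, and infinitely
  many of these contain preimages of \<open>0\<close>, which are not in the Fatou set. So the component lies
  inside the ball, in the residue class of \<open>x\<close>.\<close>

lemma component_follows_orbit:
  assumes k: "v \<kappa> = 1" "v (\<kappa>\<^sup>2 - \<kappa> + 1) \<le> q\<^sup>2"
    and zone: "\<And>i. in_zone \<kappa> ((R \<kappa> ^^ i) x)" and xn: "v ((R \<kappa> ^^ n) x - 1) < 1"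
    and P: "P \<in> analytic_component v (fatou_set v (action \<kappa>)) (Fin (\<pi> * x))"
  obtains y where "(action \<kappa> ^^ n) P = Fin (\<pi> * y)" "v (y - 1) < 1"
proof -
  have k0: "\<kappa> \<noteq> 0" using k(1) by auto
  obtain X where X: "connected_affinoid v X" "Fin (\<pi> * x) \<in> X" "X \<subseteq> fatou_set v (action \<kappa>)" "P \<in> X"
    using P unfolding analytic_component_def by blast
  have vxn: "v ((R \<kappa> ^^ n) x) = 1" using close_imp_eq[of "(R \<kappa> ^^ n) x" 1] xn by simp
  obtain r where r: "r > 0" "ball_onto \<kappa> n x r 1"
    using exists_ball_onto_unit_disk[OF k(1) zone vxn] by blast
  have nopole: "(R \<kappa> ^^ i) y \<noteq> \<pi>" if "v (y - x) \<le> r" "i < n" for y i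
    using r(2) that unfolding ball_onto_def by blast
  have close: "v ((R \<kappa> ^^ n) y - (R \<kappa> ^^ n) y') < 1" if "v (y - x) \<le> r" "v (y' - x) \<le> r" "v (y - y') < r" for y y'
    using r(2) that unfolding ball_onto_def by blast
  have onto: "\<exists>y. v (y - x) \<le> r \<and> (R \<kappa> ^^ n) y = p" if "v (p - (R \<kappa> ^^ n) x) \<le> 1" for p
    using r(2) that unfolding ball_onto_def by blast
  obtain p :: "nat \<Rightarrow> 'k" where p: "\<And>i. v (p i) = 1" "(R \<kappa> ^^ 3) (p 0) = 0"
    "\<And>i. (R \<kappa> ^^ 3) (p (Suc i)) = p i" "\<And>i j. j < 3 \<Longrightarrow> (R \<kappa> ^^ j) (p i) \<noteq> \<pi>"
    "\<And>i j. i \<noteq> j \<Longrightarrow> 1 \<le> v (p i - p j)"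
    using exists_separated_backward_orbit[OF k] by metis
  have "v (p i - (R \<kappa> ^^ n) x) \<le> 1" for i
    using p(1) vxn by (intro diff_le) auto
  then have "\<forall>i. \<exists>y. v (y - x) \<le> r \<and> (R \<kappa> ^^ n) y = p i"
    using onto by blast
  then obtain y where y: "\<And>i. v (y i - x) \<le> r" "\<And>i. (R \<kappa> ^^ n) (y i) = p i"
    by metis
  have "(action \<kappa> ^^ (3 * Suc i)) (Fin (\<pi> * p i)) = Fin 0" for i
  proof (induction i)
    case 0
    then show ?case using action_iterate[OF k0 p(4), of 3 0] p(2) by simp
  next
    case (Suc i)
    have "(action \<kappa> ^^ 3) (Fin (\<pi> * p (Suc i))) = Fin (\<pi> * p i)"
      using action_iterate[OF k0 p(4), of 3 "Suc i"] p(3) by simp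
    moreover have "3 * Suc (Suc i) = 3 + 3 * Suc i" by simp
    ultimately show ?case using Suc by (simp only: funpow_add_apply)
  qed
  moreover have "(action \<kappa> ^^ n) (Fin (\<pi> * y i)) = Fin (\<pi> * p i)" for i
    using action_iterate[OF k0 nopole[OF y(1)], of n i] y(2) by simp
  ultimately have "(action \<kappa> ^^ (n + 3 * Suc i)) (Fin (\<pi> * y i)) = Fin 0" for i
    by (simp only: funpow_add_apply)
  then have notX: "Fin (\<pi> * y i) \<notin> X" for i
    using preimage_of_repelling_not_fatou[OF k(1)] X(3) by blast
  have scale: "v (\<pi> * a - \<pi> * b) = q * v (a - b)" for a b
    by (metis mult right_diff_distrib)
  have far: "\<not> (P = Infty \<or> (\<exists>b. P = Fin b \<and> q * r \<le> v (b - \<pi> * x)))"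
  proof
    assume "P = Infty \<or> (\<exists>b. P = Fin b \<and> q * r \<le> v (b - \<pi> * x))"
    then have "\<exists>i. Fin (\<pi> * y i) \<in> X"
    proof (rule affinoid_meets_separated_set[OF X(1,2,4)])
      show "v (\<pi> * y i - \<pi> * x) \<le> q * r" for i
        unfolding scale using y(1)[of i] by (intro mult_left_mono) auto
      show "q * r \<le> v (\<pi> * y i - \<pi> * y j)" if "i \<noteq> j" for i j
      proof -
        have "r \<le> v (y i - y j)"
          using close[OF y(1)[of i] y(1)[of j]] p(5)[OF that] y(2) by fastforce
        then show ?thesis unfolding scale by (intro mult_left_mono) auto
      qed
    qed
    then show False using notX by blast
  qed
  then obtain b where b: "P = Fin b" "v (b - \<pi> * x) < q * r"
    by (cases P) (auto simp: not_le)
  define u where "u = b / \<pi>"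
  have bu: "b = \<pi> * u" by (simp add: u_def)
  have ux: "v (u - x) < r" using b(2) unfolding bu scale by simp
  have "v ((R \<kappa> ^^ n) u - (R \<kappa> ^^ n) x) < 1"
    using close[of u x] ux r(1) by simp
  then have "v ((R \<kappa> ^^ n) u - 1) < 1" using xn by (rule dist_trans_less)
  moreover have "(action \<kappa> ^^ n) P = Fin (\<pi> * (R \<kappa> ^^ n) u)"
    unfolding b(1) bu using nopole[of u] ux by (intro action_iterate k0) simp
  ultimately show ?thesis using that by blast
qed

theorem exists_wandering_component:
  assumes complete: "nonarch_complete v"
  obtains \<kappa> U where "\<kappa> \<noteq> 0" "wandering_component v (action \<kappa>) U"
proof -
  obtain \<kappa> x K T where o: "0 < K" "v \<kappa> = 1" "v (\<kappa>\<^sup>2 - \<kappa> + 1) \<le> q\<^sup>2" "v x = 1 / q"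
    "\<And>i. in_zone \<kappa> ((R \<kappa> ^^ i) x)" "\<And>i. growth \<kappa> x i \<le> K" "\<And>N. N \<le> T N"
    "\<And>N. v ((R \<kappa> ^^ T N) x - 1) < 1"
    "\<And>N i. T N - N \<le> i \<Longrightarrow> i < T N \<Longrightarrow> v ((R \<kappa> ^^ i) x) < q"
    using exists_wandering_orbit[OF complete] by metis
  have k0: "\<kappa> \<noteq> 0" using o(2) by auto
  define F where "F = fatou_set v (action \<kappa>)"
  define z where "z = Fin (\<pi> * x)"
  define U where "U = analytic_component v F z"
  have fatou: "Fin (\<pi> * u) \<in> F" if "v (u - x) < q ^ 10 / K" for u
    unfolding F_def using tame_orbit_fatou[OF o(2,4,5,1,6) that] .
  have \<rho>: "0 < q ^ 10 / K" using o(1) by simp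
  have zF: "z \<in> F" using fatou[of x] \<rho> by (simp add: z_def)
  have zU: "z \<in> U"
  proof -
    define \<sigma> where "\<sigma> = q * (q ^ 11 / K)"
    have \<sigma>: "\<sigma> > 0" using o(1) by (simp add: \<sigma>_def)
    define X where "X = Fin ` {w. v (w - \<pi> * x) \<le> \<sigma>}"
    have zX: "z \<in> X" using \<sigma> by (simp add: X_def z_def)
    have "connected_affinoid v X"
      unfolding connected_affinoid_def
    proof (intro exI[of _ "{insert Infty (Fin ` {w. v (w - \<pi> * x) > \<sigma>})}"] conjI)
      show "X = - \<Union> {insert Infty (Fin ` {w. v (w - \<pi> * x) > \<sigma>})}"
      proof (rule Set.set_eqI)
        fix P show "P \<in> X \<longleftrightarrow> P \<in> - \<Union> {insert Infty (Fin ` {w. v (w - \<pi> * x) > \<sigma>})}"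
          by (cases P) (auto simp: X_def image_iff not_less)
      qed
      show "X \<noteq> {}" using zX by blast
    qed (use P1_open_disk.intros(2)[OF \<sigma>] in auto)
    moreover have "X \<subseteq> F"
    proof
      fix P assume "P \<in> X"
      then obtain w where w: "P = Fin w" "v (w - \<pi> * x) \<le> \<sigma>" by (auto simp: X_def)
      define u where "u = w / \<pi>"
      have wu: "w = \<pi> * u" by (simp add: u_def)
      have "v (w - \<pi> * x) = q * v (u - x)" unfolding wu by (metis mult right_diff_distrib)
      then have "v (u - x) \<le> q ^ 11 / K"
        using w(2) mult_le_cancel_left_pos[OF q_pos, of "v (u - x)" "q ^ 11 / K"] unfolding \<sigma>_def by simp
      also have "\<dots> < q ^ 10 / K"
        using o(1) q_power_strict_mono[of 10 11] by (simp add: divide_strict_right_mono)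
      finally show "P \<in> F" using fatou w wu by simp
    qed
    ultimately show ?thesis
      using zX unfolding U_def analytic_component_def by blast
  qed
  have "(R \<kappa> ^^ i) x \<noteq> \<pi>" for i
    by (rule in_zone_not_pole[OF o(5)[of i]]) simp
  then have orbit: "(action \<kappa> ^^ i) z = Fin (\<pi> * (R \<kappa> ^^ i) x)" for i
    unfolding z_def by (intro action_iterate k0)
  have "\<not> preperiodic (action \<kappa>) U"
  proof
    assume "preperiodic (action \<kappa>) U"
    then obtain m n where mn: "m < n" "(action \<kappa> ^^ n) ` U = (action \<kappa> ^^ m) ` U"
      unfolding preperiodic_def by blast
    have "(action \<kappa> ^^ m) z \<in> (action \<kappa> ^^ n) ` U" using zU mn(2) by blast
    then obtain P where P: "P \<in> U" "(action \<kappa> ^^ n) P = (action \<kappa> ^^ m) z" by (metis imageE)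
    define i where "i = T n"
    have i: "n \<le> i" using o(7)[of n] by (simp add: i_def)
    obtain y where y: "(action \<kappa> ^^ i) P = Fin (\<pi> * y)" "v (y - 1) < 1"
      using component_follows_orbit[OF o(2,3,5), of i P] P(1) o(8)[of n]
      unfolding U_def F_def z_def i_def by metis
    \<comment> \<open>the image of \<open>P\<close> is a point of the orbit of \<open>x\<close> that lies in the gap before time \<open>i\<close>\<close>
    have "(action \<kappa> ^^ i) P = (action \<kappa> ^^ (i - n)) ((action \<kappa> ^^ n) P)"
      using i by (simp flip: funpow_add_apply)
    also have "\<dots> = (action \<kappa> ^^ (m + (i - n))) z"
      unfolding P(2) by (simp only: funpow_add_apply)
    finally have "y = (R \<kappa> ^^ (m + (i - n))) x"
      using y(1) unfolding orbit by simp
    moreover have "v ((R \<kappa> ^^ (m + (i - n))) x) < q"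
      using mn(1) i by (intro o(9)[of n]) (auto simp: i_def)
    moreover have "v y = 1" using close_imp_eq[of y 1] y(2) by simp
    ultimately show False using pi_small by simp
  qed
  then have "wandering_component v (action \<kappa>) U"
    unfolding wandering_component_def fatou_component_def using zF by (auto simp: U_def F_def)
  then show ?thesis using that k0 by blast
qed

lemma rat_action_eq_action:
  assumes k: "\<kappa> \<noteq> 0"
  shows "rat_action (Fract [:0, -1, 1:] [:- (1 / (- (\<kappa> / \<pi>\<^sup>2))), - (1 / \<kappa>):]) = action \<kappa>"
proof -
  have den: "[:- (1 / (- (\<kappa> / \<pi>\<^sup>2))), - (1 / \<kappa>):] = [:\<pi>\<^sup>2 / \<kappa>, - (1 / \<kappa>):]" by simp
  define p :: "'k poly" where "p = [:0, -1, 1:]"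
  define d where "d = [:\<pi>\<^sup>2 / \<kappa>, - (1 / \<kappa>):]"
  have "d \<noteq> 0" using k by (simp add: d_def)
  moreover have "coprime p d"
  proof (rule coprimeI)
    fix c assume c: "c dvd p" "c dvd d"
    have "p = [:1 - \<pi>\<^sup>2, - 1:] * smult \<kappa> d + [:\<pi>\<^sup>2 * (\<pi>\<^sup>2 - 1):]"
      using k by (simp add: p_def d_def algebra_simps)
    then have "[:\<pi>\<^sup>2 * (\<pi>\<^sup>2 - 1):] = p - [:1 - \<pi>\<^sup>2, - 1:] * smult \<kappa> d" by simp
    moreover have "c dvd p - [:1 - \<pi>\<^sup>2, - 1:] * smult \<kappa> d"
      using c by (intro dvd_diff dvd_mult dvd_smult) auto
    ultimately have "c dvd [:\<pi>\<^sup>2 * (\<pi>\<^sup>2 - 1):]" by simp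
    moreover have "\<pi>\<^sup>2 \<noteq> 1" using pi_small power2_eq_1_iff[of \<pi>] by auto
    then have "[:\<pi>\<^sup>2 * (\<pi>\<^sup>2 - 1):] dvd 1" by (simp add: is_unit_pCons_iff)
    ultimately show "c dvd 1" by (rule dvd_trans)
  qed
  ultimately show ?thesis
    unfolding den using rat_action_Fract[of d p] by (simp add: p_def d_def action_def)
qed

end

section \<open>Residue characteristic two\<close>

context nonarch_abs
begin

text \<open>In the residue field, multiples of \<open>1\<close> are represented as cosets of the maximal ideal.\<close>

lemma residue_field_multiple_of_one:
  "add_pow (residue_field v) n \<one>\<^bsub>residue_field v\<^esub> = {x. v (x - of_nat n) < 1}"
proof (induction n)
  case 0
  show ?case
    by (simp add: add_pow_def residue_field_def FactRing_def valuation_ring_def)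
next
  case (Suc n)
  have one: "\<one>\<^bsub>residue_field v\<^esub> = {x. v (x - 1) < 1}"
  proof -
    have "\<one>\<^bsub>residue_field v\<^esub> = (\<lambda>x. x + 1) ` {x. v x < 1}"
      by (auto simp: residue_field_def FactRing_def valuation_ring_def a_r_coset_def')
    also have "\<dots> = {x. v (x - 1) < 1}"
      by (auto intro!: image_eqI[where x = "_ - 1"])
    finally show ?thesis .
  qed
  have add: "A \<oplus>\<^bsub>residue_field v\<^esub> B = (\<Union>a\<in>A. \<Union>b\<in>B. {a + b})" for A B
    by (simp add: residue_field_def FactRing_def valuation_ring_def set_add_def')
  have "add_pow (residue_field v) (Suc n) \<one>\<^bsub>residue_field v\<^esub>
      = add_pow (residue_field v) n \<one>\<^bsub>residue_field v\<^esub> \<oplus>\<^bsub>residue_field v\<^esub> \<one>\<^bsub>residue_field v\<^esub>"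
    by (simp add: add_pow_def)
  also have "\<dots> = {x. v (x - of_nat (Suc n)) < 1}"
  proof (rule Set.set_eqI)
    fix x
    show "x \<in> add_pow (residue_field v) n \<one>\<^bsub>residue_field v\<^esub> \<oplus>\<^bsub>residue_field v\<^esub> \<one>\<^bsub>residue_field v\<^esub>
        \<longleftrightarrow> x \<in> {x. v (x - of_nat (Suc n)) < 1}"
    proof
      assume "x \<in> add_pow (residue_field v) n \<one>\<^bsub>residue_field v\<^esub> \<oplus>\<^bsub>residue_field v\<^esub> \<one>\<^bsub>residue_field v\<^esub>"
      then obtain a b where ab: "v (a - of_nat n) < 1" "v (b - 1) < 1" "x = a + b"
        unfolding add Suc unfolding one by auto
      have "v ((a - of_nat n) + (b - 1)) < 1" using ab by (intro add_less) auto
      then show "x \<in> {x. v (x - of_nat (Suc n)) < 1}" by (simp add: ab algebra_simps)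
    next
      assume "x \<in> {x. v (x - of_nat (Suc n)) < 1}"
      then have "v ((x - 1) - of_nat n) < 1" by (simp add: algebra_simps)
      then show "x \<in> add_pow (residue_field v) n \<one>\<^bsub>residue_field v\<^esub> \<oplus>\<^bsub>residue_field v\<^esub> \<one>\<^bsub>residue_field v\<^esub>"
        unfolding add Suc unfolding one by (intro UN_I[of "x - 1"] UN_I[of 1]) auto
    qed
  qed
  finally show ?case .
qed

lemma abs_of_nat_le_1: "v (of_nat n) \<le> 1"
  by (induction n) (auto intro: add_le)

text \<open>The least positive integer of absolute value less than \<open>1\<close> is even. Its half has absolute
  value \<open>1\<close>, so the smallness is due to the factor \<open>2\<close>.\<close>

lemma abs_two_less_1:
  assumes "ring_char (residue_field v) = 2"
  shows "v 2 < 1"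
proof -
  define S where "S = {n. v (of_nat n) < 1}"
  have zero: "\<zero>\<^bsub>residue_field v\<^esub> = {x. v x < 1}"
    by (simp add: residue_field_def FactRing_def)
  have "{x. v (x - of_nat n) < 1} = {x. v x < 1} \<longleftrightarrow> v (of_nat n) < 1" for n
  proof
    assume eq: "{x. v (x - of_nat n) < 1} = {x. v x < 1}"
    have "of_nat n \<in> {x. v (x - of_nat n) < 1}" by simp
    then have "of_nat n \<in> {x. v x < 1}" unfolding eq .
    then show "v (of_nat n) < 1" by simp
  next
    assume n: "v (of_nat n) < 1"
    show "{x. v (x - of_nat n) < 1} = {x. v x < 1}"
    proof (rule Collect_cong)
      fix x
      show "v (x - of_nat n) < 1 \<longleftrightarrow> v x < 1"
        using n diff_less[of x 1 "of_nat n"] add_less[of "x - of_nat n" 1 "of_nat n"] by auto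
    qed
  qed
  then have gcd: "Gcd S = 2"
    using assms by (simp add: ring_char_def residue_field_multiple_of_one zero S_def)
  have "\<exists>n\<in>S. n \<noteq> 0"
  proof (rule ccontr)
    assume "\<not> ?thesis"
    then have "S \<subseteq> {0}" by auto
    then have "Gcd S = 0" by (simp add: Gcd_0_iff)
    then show False using gcd by simp
  qed
  then obtain n where n: "n \<in> S" "n \<noteq> 0" "\<And>m. m \<in> S \<Longrightarrow> m \<noteq> 0 \<Longrightarrow> n \<le> m"
    using exists_least_iff[of "\<lambda>n. n \<in> S \<and> n \<noteq> 0"] by (metis not_le)
  have "2 dvd n" using gcd n(1) by (metis Gcd_dvd)
  then obtain j where j: "n = 2 * j" by auto
  have "j \<notin> S"
  proof
    assume "j \<in> S"
    then have "n \<le> j" using n(2,3) j by simp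
    then show False using n(2) j by simp
  qed
  then have "v (of_nat j) = 1" using abs_of_nat_le_1[of j] by (simp add: S_def)
  moreover have "v (of_nat n) < 1" using n(1) by (simp add: S_def)
  ultimately show ?thesis by (simp add: j mult)
qed

end

theorem theoremA:
  fixes v :: "'k::alg_closed_field \<Rightarrow> real"
  assumes "nonarch_abs v"
    and "nonarch_complete v"
    and "ring_char (residue_field v) = 2"
  shows "\<exists>a b. a \<noteq> 0 \<and>
    (\<exists>U. wandering_component v (rat_action (Fract [:0, -1, 1:] [:- (1 / a), b:])) U)"
proof -
  interpret nonarch_abs v by fact
  have two: "v 2 < 1" using assms(3) by (rule abs_two_less_1)
  have "\<exists>p. p \<noteq> 0 \<and> v p < 1 \<and> v 2 \<le> v p ^ 20"
  proof (cases "(2::'k) = 0")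
    case True
    obtain x where x: "x \<noteq> 0" "v x \<noteq> 1" using nontrivial by blast
    have "v x < 1 \<or> v (inverse x) < 1"
      using x pos_iff[of x] by (auto simp: abs_inverse inverse_less_1_iff)
    then obtain p where "p \<noteq> 0" "v p < 1"
      using x by (metis inverse_nonzero_iff_nonzero)
    then show ?thesis unfolding True by (intro exI[of _ p]) (simp add: nonneg)
  next
    case False
    obtain p :: 'k where p: "p ^ 20 = 2" using nth_root_exists[of 20 2] by auto
    then have "p \<noteq> 0" using False by auto
    moreover have p20: "v p ^ 20 = v 2" using p by (metis abs_power)
    moreover have "v p < 1"
    proof (rule ccontr)
      assume "\<not> v p < 1"
      then have "1 \<le> v p ^ 20" by (simp add: one_le_power)
      then show False using p20 two by linarith
    qed
    ultimately show ?thesis by (intro exI[of _ p]) simp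
  qed
  then obtain p where p: "p \<noteq> 0" "v p < 1" "v 2 \<le> v p ^ 20" by blast
  interpret quadratic_family v p
    by unfold_locales (use p in auto)
  obtain \<kappa> U where k: "\<kappa> \<noteq> 0" "wandering_component v (action \<kappa>) U"
    using exists_wandering_component[OF assms(2)] by metis
  show ?thesis
  proof (intro exI conjI)
    show "- (\<kappa> / p\<^sup>2) \<noteq> 0" using k(1) p(1) by simp
    show "wandering_component v (rat_action (Fract [:0, -1, 1:] [:- (1 / (- (\<kappa> / p\<^sup>2))), - (1 / \<kappa>):])) U"
      unfolding rat_action_eq_action[OF k(1)] by (rule k(2))
  qed
qed

end
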